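(* Let $\alpha>0$, $\beta\in\mathbb R$, $T>0$, let $Q$ be an admissible harmonic map, and let $u\in C([0,T];\mathcal H^3_Q)$ be a solution of $u_t=\alpha\tau(u)-\beta J(u)\tau(u)$. For each $t\in[0,T]$ let $\widetilde u(s,t,x)$, $s\ge0$, be the solution of the heat flow $\partial_s\widetilde u=\tau(\widetilde u)$, $\widetilde u(0,t,x)=u(t,x)$. Then there exists a harmonic map $Q_\infty:\mathbb H^2\to\mathbb H^2$ (independent of $t$) such that $$\lim_{s\to\infty}\ \sup_{(x,t)\in\mathbb H^2\times[0,T]} d_{\mathbb H^2}\big(\widetilde u(s,t,x),Q_\infty(x)\big)=0 .$$
   Context: $\mathbb H^2=\{x\in\mathbb R^{2+1}:(x^0)^2-(x^1)^2-(x^2)^2=1,\ x^0>0\}$ with the metric induced from the Minkowski metric; $d_{\mathbb H^2}$ is the geodesic distance. Global coordinates: $\Psi(x_1,x_2)=(\cosh x_2+e^{-x_2}x_1^2/2,\ \sinh x_2+e^{-x_2}x_1^2/2,\ e^{-x_2}x_1)$, in which the metric is $e^{-2x_2}(dx_1)^2+(dx_2)^2$; it is denoted $h$ on the domain and $g$ on the target (target coordinates $(y_1,y_2)$, Christoffel symbols $\overline\Gamma$). $J\partial_{y_1}=e^{-y_2}\partial_{y_2}$, $J\partial_{y_2}=-e^{y_2}\partial_{y_1}$. A map $u:\mathbb H^2\to\mathbb H^2$ is identified with $(u^1,u^2)$, $\Psi(u^1(x),u^2(x))=u(x)$. Tension field: $\tau(u)=(\Delta_{\mathbb H^2}u^l+h^{ij}\overline\Gamma^l_{mn}(u)\partial_iu^m\partial_ju^n)\partial_{y_l}$;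 $u$ is harmonic if $\tau(u)=0$. $H^k(\mathbb H^2;\mathbb R)$ has norm $\|f\|_{H^k}^2=\sum_{l=1}^k\|\nabla^lf\|_{L^2}^2$. A harmonic map $Q:\mathbb H^2\to\mathbb H^2$ is admissible if $\overline{Q(\mathbb H^2)}$ is compact and $dQ,\nabla dQ,\nabla^2dQ\in L^2$. $\mathcal H^k_Q=\{u:\ u^j-Q^j\in H^k(\mathbb H^2;\mathbb R),\ j=1,2\}$ with metric $\sum_j\|u^j-w^j\|_{H^k}$. *)

theory Defs
  imports "HOL-Analysis.Analysis"
begin

section \<open>The hyperbolic plane\<close>

text \<open>The component indices 1, 2, 3 of \<^typ>\<open>real^3\<close> stand for the Minkowski indices 0, 1, 2.\<close>

definition minkowski :: "real^3 \<Rightarrow> real^3 \<Rightarrow> real" where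
  "minkowski v w = - (v$1 * w$1) + v$2 * w$2 + v$3 * w$3"

definition H2 :: "(real^3) set" where
  "H2 = {x. (x$1)\<^sup>2 - (x$2)\<^sup>2 - (x$3)\<^sup>2 = 1 \<and> x$1 > 0}"

text \<open>Geodesic distance as the infimum of the lengths of piecewise C1 curves. The length is required
  to exist as an integral: \<^const>\<open>valid_path\<close> admits curves of infinite length (the derivative need
  not be bounded near the exceptional points), whose \<^const>\<open>integral\<close> would be 0 by convention.\<close>

definition hdist :: "real^3 \<Rightarrow> real^3 \<Rightarrow> real" where
  "hdist x y = Inf {L. \<exists>\<gamma>. valid_path \<gamma> \<and> path_image \<gamma> \<subseteq> H2 \<and> pathstart \<gamma> = x \<and> pathfinish \<gamma> = y \<and>
     ((\<lambda>r. sqrt (minkowski (vector_derivative \<gamma> (at r within {0..1}))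
                            (vector_derivative \<gamma> (at r within {0..1})))) has_integral L) {0..1}}"

definition Psi :: "real^2 \<Rightarrow> real^3" where
  "Psi p = vector [cosh (p$2) + exp (- p$2) * (p$1)\<^sup>2 / 2,
                   sinh (p$2) + exp (- p$2) * (p$1)\<^sup>2 / 2,
                   exp (- p$2) * p$1]"

text \<open>\<^term>\<open>coords u p $ j\<close> is the j-th coordinate function of the map u, evaluated at the point with
  coordinates p: a map u from H2 to H2 satisfies \<^prop>\<open>Psi (coords u p) = u (Psi p)\<close>.\<close>

definition coords :: "(real^3 \<Rightarrow> real^3) \<Rightarrow> real^2 \<Rightarrow> real^2" where
  "coords u p = inv Psi (u (Psi p))"

section \<open>Classical and weak derivatives in coordinates\<close>

definition partial :: "2 \<Rightarrow> (real^2 \<Rightarrow> real) \<Rightarrow> real^2 \<Rightarrow> real" where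
  "partial i f p = deriv (\<lambda>r. f (p + r *\<^sub>R axis i 1)) 0"

primrec Ck :: "nat \<Rightarrow> (real^2 \<Rightarrow> real) \<Rightarrow> bool" where
  "Ck 0 f \<longleftrightarrow> continuous_on UNIV f"
| "Ck (Suc k) f \<longleftrightarrow> f differentiable_on UNIV \<and> (\<forall>i. Ck k (partial i f))"

definition smooth :: "(real^2 \<Rightarrow> real) \<Rightarrow> bool" where
  "smooth f \<longleftrightarrow> (\<forall>k. Ck k f)"

definition test_function :: "(real^2 \<Rightarrow> real) \<Rightarrow> bool" where
  "test_function \<phi> \<longleftrightarrow> smooth \<phi> \<and> compact (closure {p. \<phi> p \<noteq> 0})"

definition locally_integrable :: "(real^2 \<Rightarrow> real) \<Rightarrow> bool" where
  "locally_integrable f \<longleftrightarrow> (\<forall>K. compact K \<longrightarrow> set_integrable lborel K f)"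

definition is_weak_partial :: "2 \<Rightarrow> (real^2 \<Rightarrow> real) \<Rightarrow> (real^2 \<Rightarrow> real) \<Rightarrow> bool" where
  "is_weak_partial i f g \<longleftrightarrow> locally_integrable f \<and> locally_integrable g \<and>
     (\<forall>\<phi>. test_function \<phi> \<longrightarrow>
        (\<integral>p. f p * partial i \<phi> p \<partial>lborel) = - (\<integral>p. g p * \<phi> p \<partial>lborel))"

text \<open>Unique up to null sets whenever a weak derivative exists; only used under integrals.\<close>

definition weak_partial :: "2 \<Rightarrow> (real^2 \<Rightarrow> real) \<Rightarrow> real^2 \<Rightarrow> real" where
  "weak_partial i f = (SOME g. is_weak_partial i f g)"

primrec weakly_differentiable :: "nat \<Rightarrow> (real^2 \<Rightarrow> real) \<Rightarrow> bool" where
  "weakly_differentiable 0 f \<longleftrightarrow> locally_integrable f"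
| "weakly_differentiable (Suc k) f \<longleftrightarrow>
     (\<forall>i. (\<exists>g. is_weak_partial i f g) \<and> weakly_differentiable k (weak_partial i f))"

section \<open>Riemannian geometry in coordinates\<close>

text \<open>The metric \<open>exp (-2 x2) (dx1)^2 + (dx2)^2\<close>, its inverse, its Christoffel symbols
  (\<open>christoffel p k i j\<close> has upper index k), and its volume measure. They serve both for the domain
  metric h and, evaluated at the image point, for the target metric g.\<close>

definition met :: "real^2 \<Rightarrow> 2 \<Rightarrow> 2 \<Rightarrow> real" where
  "met p i j = (if i \<noteq> j then 0 else if i = 1 then exp (- 2 * p$2) else 1)"

definition met_inv :: "real^2 \<Rightarrow> 2 \<Rightarrow> 2 \<Rightarrow> real" where
  "met_inv p i j = (if i \<noteq> j then 0 else if i = 1 then exp (2 * p$2) else 1)"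

definition christoffel :: "real^2 \<Rightarrow> 2 \<Rightarrow> 2 \<Rightarrow> 2 \<Rightarrow> real" where
  "christoffel p k i j = (\<Sum>l\<in>UNIV. met_inv p k l *
     (partial i (\<lambda>q. met q j l) p + partial j (\<lambda>q. met q i l) p - partial l (\<lambda>q. met q i j) p)) / 2"

definition hvol :: "(real^2) measure" where
  "hvol = density lborel (\<lambda>p. ennreal (exp (- p$2)))"

text \<open>Components of the iterated covariant derivative of a function; the index list has length l, and
  its head is the direction of the last differentiation. The argument D is the notion of partial
  derivative, \<^const>\<open>partial\<close> or \<^const>\<open>weak_partial\<close>.\<close>

primrec nabla :: "(2 \<Rightarrow> (real^2 \<Rightarrow> real) \<Rightarrow> real^2 \<Rightarrow> real) \<Rightarrow> nat \<Rightarrow> (real^2 \<Rightarrow> real) \<Rightarrow>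
    2 list \<Rightarrow> real^2 \<Rightarrow> real" where
  "nabla D 0 f = (\<lambda>I p. f p)"
| "nabla D (Suc l) f = (\<lambda>I p. D (hd I) (nabla D l f (tl I)) p -
     (\<Sum>a<l. \<Sum>k\<in>UNIV. christoffel p k (hd I) (tl I ! a) * nabla D l f ((tl I)[a := k]) p))"

definition tensor_inner :: "nat \<Rightarrow> real^2 \<Rightarrow> (2 list \<Rightarrow> real) \<Rightarrow> (2 list \<Rightarrow> real) \<Rightarrow> real" where
  "tensor_inner l p S T = (\<Sum>I\<in>{I. length I = l}. \<Sum>K\<in>{K. length K = l}.
     (\<Prod>a<l. met_inv p (I ! a) (K ! a)) * S I * T K)"

definition nabla_normsq :: "nat \<Rightarrow> (real^2 \<Rightarrow> real) \<Rightarrow> real^2 \<Rightarrow> real" where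
  "nabla_normsq l f p =
     tensor_inner l p (\<lambda>I. nabla weak_partial l f I p) (\<lambda>I. nabla weak_partial l f I p)"

definition laplace :: "(2 \<Rightarrow> (real^2 \<Rightarrow> real) \<Rightarrow> real^2 \<Rightarrow> real) \<Rightarrow> (real^2 \<Rightarrow> real) \<Rightarrow> real^2 \<Rightarrow> real" where
  "laplace D f p = (\<Sum>i\<in>UNIV. \<Sum>j\<in>UNIV. met_inv p i j * nabla D 2 f [i, j] p)"

text \<open>Components of the l-th covariant derivative of the differential of a map w (in coordinates), as
  a section of a bundle involving the pull-back of the tangent bundle: m is the target index, and the
  index list has length l + 1.\<close>

primrec nabla_d :: "nat \<Rightarrow> (real^2 \<Rightarrow> real^2) \<Rightarrow> 2 \<Rightarrow> 2 list \<Rightarrow> real^2 \<Rightarrow> real" where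
  "nabla_d 0 w = (\<lambda>m I p. partial (hd I) (\<lambda>q. w q $ m) p)"
| "nabla_d (Suc l) w = (\<lambda>m I p. partial (hd I) (nabla_d l w m (tl I)) p -
     (\<Sum>a<Suc l. \<Sum>k\<in>UNIV. christoffel p k (hd I) (tl I ! a) * nabla_d l w m ((tl I)[a := k]) p) +
     (\<Sum>n\<in>UNIV. \<Sum>r\<in>UNIV. christoffel (w p) m n r * partial (hd I) (\<lambda>q. w q $ n) p *
        nabla_d l w r (tl I) p))"

definition nabla_d_normsq :: "nat \<Rightarrow> (real^2 \<Rightarrow> real^2) \<Rightarrow> real^2 \<Rightarrow> real" where
  "nabla_d_normsq l w p = (\<Sum>m\<in>UNIV. \<Sum>n\<in>UNIV. met (w p) m n *
     tensor_inner (Suc l) p (\<lambda>I. nabla_d l w m I p) (\<lambda>I. nabla_d l w n I p))"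

section \<open>Harmonic maps and Sobolev spaces\<close>

definition tension :: "(2 \<Rightarrow> (real^2 \<Rightarrow> real) \<Rightarrow> real^2 \<Rightarrow> real) \<Rightarrow> (real^2 \<Rightarrow> real^2) \<Rightarrow> real^2 \<Rightarrow> real^2" where
  "tension D w p = (\<chi> l. laplace D (\<lambda>q. w q $ l) p +
     (\<Sum>i\<in>UNIV. \<Sum>j\<in>UNIV. \<Sum>m\<in>UNIV. \<Sum>n\<in>UNIV. met_inv p i j * christoffel (w p) l m n *
        D i (\<lambda>q. w q $ m) p * D j (\<lambda>q. w q $ n) p))"

definition Jmap :: "real^2 \<Rightarrow> real^2 \<Rightarrow> real^2" where
  "Jmap y v = vector [- exp (y$2) * v$2, exp (- y$2) * v$1]"

definition harmonic_map :: "(real^3 \<Rightarrow> real^3) \<Rightarrow> bool" where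
  "harmonic_map Q \<longleftrightarrow> Q ` H2 \<subseteq> H2 \<and> (\<forall>j. smooth (\<lambda>p. coords Q p $ j)) \<and>
     (\<forall>p. tension partial (coords Q) p = 0)"

definition admissible :: "(real^3 \<Rightarrow> real^3) \<Rightarrow> bool" where
  "admissible Q \<longleftrightarrow> harmonic_map Q \<and> compact (closure (Q ` H2)) \<and>
     (\<forall>l\<le>2. integrable hvol (nabla_d_normsq l (coords Q)))"

text \<open>Functions on the plane are given in coordinates. The norm carries no term for the function
  itself, by the Poincare inequality; membership does require the function to be in L2 (the case
  \<open>l = 0\<close>), so that nonzero constants are excluded and compactly supported functions are dense.\<close>

definition sobolev :: "nat \<Rightarrow> (real^2 \<Rightarrow> real) set" where
  "sobolev k = {f. weakly_differentiable k f \<and> (\<forall>l\<le>k. integrable hvol (nabla_normsq l f))}"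

definition sobolev_norm :: "nat \<Rightarrow> (real^2 \<Rightarrow> real) \<Rightarrow> real" where
  "sobolev_norm k f = sqrt (\<Sum>l=1..k. \<integral>p. nabla_normsq l f p \<partial>hvol)"

definition sobolev_maps :: "nat \<Rightarrow> (real^3 \<Rightarrow> real^3) \<Rightarrow> (real^3 \<Rightarrow> real^3) set" where
  "sobolev_maps k Q = {u. u ` H2 \<subseteq> H2 \<and> (\<forall>j. (\<lambda>p. coords u p $ j - coords Q p $ j) \<in> sobolev k)}"

definition sobolev_dist :: "nat \<Rightarrow> (real^3 \<Rightarrow> real^3) \<Rightarrow> (real^3 \<Rightarrow> real^3) \<Rightarrow> real" where
  "sobolev_dist k u w = (\<Sum>j\<in>UNIV. sobolev_norm k (\<lambda>p. coords u p $ j - coords w p $ j))"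

section \<open>The flows\<close>

definition continuous_into_sobolev_maps ::
    "real \<Rightarrow> nat \<Rightarrow> (real^3 \<Rightarrow> real^3) \<Rightarrow> (real \<Rightarrow> real^3 \<Rightarrow> real^3) \<Rightarrow> bool" where
  "continuous_into_sobolev_maps T k Q u \<longleftrightarrow> (\<forall>t\<in>{0..T}. u t \<in> sobolev_maps k Q \<and>
     ((\<lambda>r. sobolev_dist k (u r) (u t)) \<longlongrightarrow> 0) (at t within {0..T}))"

text \<open>For maps of class H3 the right-hand side involves weak derivatives and is an L2 function; the time
  derivative of each coordinate function is the limit in L2 of its difference quotients, one-sided at
  the end points of the time interval.\<close>

definition landau_lifshitz_flow :: "real \<Rightarrow> real \<Rightarrow> real \<Rightarrow> (real \<Rightarrow> real^3 \<Rightarrow> real^3) \<Rightarrow> bool" where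
  "landau_lifshitz_flow \<alpha> \<beta> T u \<longleftrightarrow> (\<forall>t\<in>{0..T}. \<forall>j.
     ((\<lambda>r. \<integral>\<^sup>+p. ennreal (((coords (u r) p $ j - coords (u t) p $ j) / (r - t) -
         (\<alpha> *\<^sub>R tension weak_partial (coords (u t)) p -
          \<beta> *\<^sub>R Jmap (coords (u t) p) (tension weak_partial (coords (u t)) p)) $ j)\<^sup>2) \<partial>hvol)
      \<longlongrightarrow> 0) (at t within {0..T}))"

text \<open>Classical global solution v of the harmonic map heat flow with initial map w. The last condition,
  bounded displacement on bounded time intervals, is the growth condition under which solutions on the
  noncompact domain are unique (distances between two solutions are bounded subsolutions of the heat
  equation); without it one cannot speak of the solution. Solutions that are continuous in time with
  values in the space \<^term>\<open>sobolev_maps 3 Q\<close> satisfy it by Sobolev embedding.\<close>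

definition heat_flow :: "(real \<Rightarrow> real^3 \<Rightarrow> real^3) \<Rightarrow> (real^3 \<Rightarrow> real^3) \<Rightarrow> bool" where
  "heat_flow v w \<longleftrightarrow>
     (\<forall>s\<ge>0. v s ` H2 \<subseteq> H2) \<and>
     continuous_on ({0..} \<times> H2) (\<lambda>(s, x). v s x) \<and>
     (\<forall>x\<in>H2. v 0 x = w x) \<and>
     (\<forall>s>0. \<forall>j. Ck 2 (\<lambda>p. coords (v s) p $ j)) \<and>
     (\<forall>s>0. \<forall>p. ((\<lambda>r. coords (v r) p) has_vector_derivative tension partial (coords (v s)) p) (at s)) \<and>
     (\<forall>S. bdd_above ((\<lambda>(s, x). hdist (v s x) (w x)) ` ({0..S} \<times> H2)))"

end

theory Submission
  imports Defs
begin

text \<open>One can take \<open>Q\<^sub>\<infinity> = Q\<close>. If v and w solve the heat flow with values in the hyperbolic plane, then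
  cosh of their distance, which is minus the Minkowski product and a rational expression in the
  coordinates and their exponentials, is a subsolution of the scalar heat equation, because it is a convex
  function on the product of two hyperbolic planes. With \<open>\<phi> = x\<^sup>0\<close> the height function, \<open>\<Delta>\<phi> = 2\<phi>\<close> yields
  the supersolutions \<open>exp(3s) \<phi>\<close>, a barrier at infinity, and \<open>exp(-s/4) \<phi> powr (-1/2)\<close>. Hence a distance to Q
  that initially tends to 0 at infinity decays uniformly as \<open>s \<rightarrow> \<infinity>\<close>. The decay of
  \<open>u(t) - Q\<close> at infinity, uniformly in t, follows from a Sobolev embedding of \<open>H\<^sup>2\<close> into the continuous functions
  that vanish at infinity and from the compactness of \<open>[0,T]\<close>.\<close>

section \<open>The hyperboloid in coordinates\<close>

text \<open>The obstacle is that \<open>sobolev_norm\<close> has no term of order zero, while the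
  comparison needs sup bounds on u(t) - Q that are uniform in t. Membership in
  \<open>sobolev 3\<close> includes square integrability, which gives decay at infinity for each
  fixed t by an estimate on boxes of fixed hyperbolic size. Continuity in time controls derivatives
  only; so a second, Poincare-type estimate bounds a function already known to vanish at infinity by
  its derivatives alone: averages are moved towards x2 = -infinity, where the hyperbolic volume
  grows exponentially. Cosh of the distance is smooth on the diagonal, unlike the distance itself. A
  constant excess \<epsilon> does not decay under the heat equation; only the part of the initial
  data above 1 + \<epsilon>, which lives over a bounded set, is dominated by a multiple of \<phi>
  powr (-1/2), and \<epsilon> is arbitrary. The integral estimates have the form C (\<mu> E +
  1/\<mu>) with free \<mu> > 0, an additive version of C sqrt E that needs only a pointwise
  inequality under the integral.\<close>

definition hcosh :: "real^2 \<Rightarrow> real^2 \<Rightarrow> real" where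
  "hcosh y z = cosh (y$2 - z$2) + (y$1 - z$1)\<^sup>2 * exp (- y$2 - z$2) / 2"

definition height :: "real^2 \<Rightarrow> real" where
  "height p = cosh (p$2) + exp (- p$2) * (p$1)\<^sup>2 / 2"

lemma Psi_nth [simp]:
  "Psi p $ 1 = height p"
  "Psi p $ 2 = sinh (p$2) + exp (- p$2) * (p$1)\<^sup>2 / 2"
  "Psi p $ 3 = exp (- p$2) * p$1"
  by (simp_all add: Psi_def height_def)

lemma height_ge_1: "1 \<le> height p"
  unfolding height_def using cosh_real_ge_1[of "p$2"] by (smt (verit) divide_nonneg_nonneg exp_ge_zero zero_le_mult_iff zero_le_power2)

lemma cosh_sinh_exp: "cosh x - sinh x = exp (- x)" for x :: real
  by (simp add: cosh_def sinh_def field_simps)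

text \<open>In the half-plane coordinates \<open>(y$1, exp (y$2))\<close> the metric is conformal to
  the Euclidean one, and \<open>hcosh\<close> becomes the classical formula 1 + (Euclidean
  distance)^2 / (2 * product of the heights) for cosh of the distance. In particular
  \<open>height p\<close> is \<open>hcosh p 0\<close>.\<close>

lemma minkowski_Psi: "minkowski (Psi y) (Psi z) = - hcosh y z"
  by (simp add: minkowski_def height_def hcosh_def cosh_def sinh_def exp_diff exp_minus exp_add power2_eq_square
      field_simps)

lemma hcosh_self [simp]: "hcosh y y = 1"
  by (simp add: hcosh_def)

lemma hcosh_ge_1: "1 \<le> hcosh y z"
  unfolding hcosh_def using cosh_real_ge_1[of "y$2 - z$2"]
  by (smt (verit) divide_nonneg_nonneg exp_ge_zero zero_le_mult_iff zero_le_power2)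

lemma H2_iff_minkowski: "x \<in> H2 \<longleftrightarrow> minkowski x x = -1 \<and> x$1 > 0"
  by (auto simp: H2_def minkowski_def power2_eq_square)

lemma Psi_in_H2: "Psi p \<in> H2"
  using height_ge_1[of p] by (simp add: H2_iff_minkowski minkowski_Psi)

text \<open>At \<open>x = Psi p\<close> the light-cone coordinate \<open>x$1 - x$2\<close> equals
  \<open>exp (- p$2)\<close>, and this determines p. The explicit formula makes the continuity of
  \<open>coords\<close> visible, which is defined through \<open>inv Psi\<close>.\<close>

definition Psi_inv :: "real^3 \<Rightarrow> real^2" where
  "Psi_inv x = vector [x$3 / (x$1 - x$2), - ln (x$1 - x$2)]"

lemma Psi_inv_Psi: "Psi_inv (Psi p) = p"
proof -
  have "Psi p $ 1 - Psi p $ 2 = exp (- p$2)"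
    using cosh_sinh_exp[of "p$2"] by (simp add: height_def)
  then show ?thesis
    by (simp add: Psi_inv_def vec_eq_iff forall_2)
qed

lemma inj_Psi: "inj Psi"
  by (metis Psi_inv_Psi injI)

lemma inv_Psi_Psi [simp]: "inv Psi (Psi p) = p"
  by (simp add: inj_Psi)

lemma H2_diff_pos:
  assumes "x \<in> H2" shows "x$1 - x$2 > 0"
proof -
  have "(x$2)\<^sup>2 < (x$1)\<^sup>2" "x$1 > 0"
    using assms by (auto simp: H2_def) (smt (verit) zero_le_power2)
  then show ?thesis
    using power2_less_imp_less[of "x$2" "x$1"] by linarith
qed

lemma Psi_Psi_inv:
  assumes "x \<in> H2" shows "Psi (Psi_inv x) = x"
proof -
  define d where "d = x$1 - x$2"
  have d: "d > 0" using H2_diff_pos[OF assms] by (simp add: d_def)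
  have eq: "(x$1 + x$2) * d = 1 + (x$3)\<^sup>2"
    using assms by (simp add: H2_def d_def power2_eq_square algebra_simps)
  then have s: "x$1 + x$2 = (1 + (x$3)\<^sup>2) / d"
    using d by (simp add: field_simps)
  have x: "x$1 = ((1 + (x$3)\<^sup>2) / d + d) / 2" "x$2 = ((1 + (x$3)\<^sup>2) / d - d) / 2"
    using s by (auto simp: d_def)
  have "Psi_inv x $ 1 = x$3 / d" "Psi_inv x $ 2 = - ln d"
    by (simp_all add: Psi_inv_def d_def)
  then show ?thesis
    using d x unfolding vec_eq_iff forall_3
    by (simp add: height_def cosh_def sinh_def exp_minus power2_eq_square add_divide_distrib diff_divide_distrib inverse_eq_divide)
qed

lemma inv_Psi_H2: "x \<in> H2 \<Longrightarrow> inv Psi x = Psi_inv x"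
  by (metis Psi_Psi_inv inv_Psi_Psi)

lemma range_Psi: "range Psi = H2"
  using Psi_in_H2 Psi_Psi_inv by (metis image_subset_iff rangeI subsetI subset_antisym)

lemma Psi_coords:
  assumes "u ` H2 \<subseteq> H2" shows "Psi (coords u p) = u (Psi p)"
  using assms Psi_in_H2[of p] by (simp add: coords_def inv_Psi_H2 Psi_Psi_inv image_subset_iff)

lemma continuous_Psi: "continuous_on A Psi"
proof -
  have "continuous_on A (\<lambda>p. Psi p $ i)" for i
    using exhaust_3[of i] by (elim disjE) (auto simp: height_def intro!: continuous_intros)
  then show ?thesis
    using continuous_on_vec_lambda[of A "\<lambda>i p. Psi p $ i"] by simp
qed

lemma continuous_Psi_inv: "continuous_on H2 Psi_inv"
proof -
  have "continuous_on H2 (\<lambda>x. Psi_inv x $ i)" for i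
    using exhaust_2[of i] H2_diff_pos
    by (elim disjE) (auto simp: Psi_inv_def intro!: continuous_intros, (force simp: order_less_le)+)
  then show ?thesis
    using continuous_on_vec_lambda[of H2 "\<lambda>i p. Psi_inv p $ i"] by simp
qed

section \<open>Comparison of the geodesic distance with the Minkowski product\<close>

lemma minkowski_bilinear [algebra_simps]:
  "minkowski (a + b) c = minkowski a c + minkowski b c"
  "minkowski a (b + c) = minkowski a b + minkowski a c"
  "minkowski (a - b) c = minkowski a c - minkowski b c"
  "minkowski a (b - c) = minkowski a b - minkowski a c"
  by (simp_all add: minkowski_def algebra_simps)

lemma minkowski_scaleR [simp]:
  "minkowski (r *\<^sub>R a) c = r * minkowski a c"
  "minkowski a (r *\<^sub>R c) = r * minkowski a c"
  by (simp_all add: minkowski_def algebra_simps)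

lemma minkowski_commute: "minkowski a b = minkowski b a"
  by (simp add: minkowski_def)

lemma H2_time_square: "x \<in> H2 \<Longrightarrow> (x$1)\<^sup>2 = 1 + (x$2)\<^sup>2 + (x$3)\<^sup>2"
  by (simp add: H2_def)

lemma minkowski_H2_le: "x \<in> H2 \<Longrightarrow> y \<in> H2 \<Longrightarrow> minkowski x y \<le> -1"
  using minkowski_Psi[of "Psi_inv x" "Psi_inv y"] hcosh_ge_1[of "Psi_inv x" "Psi_inv y"] by (simp add: Psi_Psi_inv)

text \<open>Orthogonality expresses \<open>x$1 * v$1\<close> as an inner product of the space
  components; Cauchy--Schwarz there, together with \<open>(x$2)^2 + (x$3)^2 < (x$1)^2\<close>,
  leaves no room for a timelike v.\<close>

lemma minkowski_tangent_nonneg: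
  assumes "x \<in> H2" and "minkowski x v = 0"
  shows "0 \<le> minkowski v v"
proof -
  have eq: "x$1 * v$1 = x$2 * v$2 + x$3 * v$3"
    using assms(2) by (simp add: minkowski_def)
  have "(x$1)\<^sup>2 * (v$1)\<^sup>2 = (x$2 * v$2 + x$3 * v$3)\<^sup>2"
    using eq by (metis power_mult_distrib)
  also have "\<dots> \<le> ((x$2)\<^sup>2 + (x$3)\<^sup>2) * ((v$2)\<^sup>2 + (v$3)\<^sup>2)"
    using zero_le_power2[of "x$2 * v$3 - x$3 * v$2"] by (simp add: power2_eq_square algebra_simps)
  also have "\<dots> \<le> (x$1)\<^sup>2 * ((v$2)\<^sup>2 + (v$3)\<^sup>2)"
    using H2_time_square[OF assms(1)] by (intro mult_right_mono) auto
  finally have "(v$1)\<^sup>2 \<le> (v$2)\<^sup>2 + (v$3)\<^sup>2"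
    using assms(1) by (simp add: H2_def)
  then show ?thesis by (simp add: minkowski_def power2_eq_square)
qed

text \<open>Cauchy--Schwarz in the tangent space at y, applied to v and to the projection
  \<open>x + \<langle>x,y\<rangle> y\<close> of x, whose square is \<open>\<langle>x,y\<rangle>\<^sup>2 - 1\<close>.\<close>

lemma minkowski_tangent_le:
  assumes "x \<in> H2" "y \<in> H2" and "minkowski y v = 0"
  shows "\<bar>minkowski x v\<bar> \<le> - minkowski x y * sqrt (minkowski v v)"
proof -
  define p where "p = minkowski x y"
  define z where "z = x + p *\<^sub>R y"
  have xx: "minkowski x x = -1" "minkowski y y = -1" using assms by (auto simp: H2_iff_minkowski)
  have pm: "p \<le> -1" using minkowski_H2_le[OF assms(1,2)] by (simp add: p_def)
  have yz: "minkowski y z = 0" using xx by (simp add: z_def algebra_simps p_def minkowski_commute)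
  have zv: "minkowski z v = minkowski x v" using assms(3) by (simp add: z_def algebra_simps)
  have zz: "minkowski z z = p\<^sup>2 - 1" using xx
    by (simp add: z_def algebra_simps p_def minkowski_commute power2_eq_square)
  have vv: "0 \<le> minkowski v v" using minkowski_tangent_nonneg[OF assms(2,3)] .
  have q: "0 \<le> minkowski z z * a\<^sup>2 + 2 * a * b * minkowski z v + minkowski v v * b\<^sup>2" for a b :: real
  proof -
    have "minkowski y (a *\<^sub>R z + b *\<^sub>R v) = 0" using yz assms(3) by (simp add: algebra_simps)
    from minkowski_tangent_nonneg[OF assms(2) this] show ?thesis
      by (simp add: algebra_simps minkowski_commute power2_eq_square)
  qed
  have cs: "(minkowski z v)\<^sup>2 \<le> minkowski z z * minkowski v v"
  proof (cases "minkowski v v = 0")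
    case True
    \<comment> \<open>With v of square 0 the form in \<open>q\<close> is affine in b, and if
      \<open>minkowski z v\<close> were nonzero, the second choice of a and b would give it the
      value -1.\<close>
    then have "minkowski z v = 0"
      using q[of "minkowski z v" "- (minkowski z z + 1) * minkowski z v ^2"] q[of 1 "- (minkowski z z + 1) / (2 * minkowski z v)"]
      by (cases "minkowski z v = 0") (auto simp: field_simps)
    with True show ?thesis by simp
  next
    case False
    then have pos: "0 < minkowski v v" using vv by simp
    have "0 \<le> minkowski v v * (minkowski z z * minkowski v v - (minkowski z v)\<^sup>2)"
      using q[of "minkowski v v" "- minkowski z v"] by (simp add: power2_eq_square algebra_simps)
    then show ?thesis using pos by (simp add: zero_le_mult_iff)
  qed
  have "(minkowski x v)\<^sup>2 \<le> (p\<^sup>2 - 1) * minkowski v v" using cs zv zz by simp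
  also have "\<dots> \<le> p\<^sup>2 * minkowski v v" using vv by (intro mult_right_mono) auto
  also have "\<dots> = (- p * sqrt (minkowski v v))\<^sup>2" using vv by (simp add: power_mult_distrib)
  finally show ?thesis
    using pm vv by (intro power2_le_imp_le[of "\<bar>_\<bar>"]) (auto simp: p_def mult_nonpos_nonneg)
qed

section \<open>Lengths of curves on the hyperboloid and the geodesic between two points\<close>

definition lengths :: "real^3 \<Rightarrow> real^3 \<Rightarrow> real set" where
  "lengths x y = {L. \<exists>\<gamma>. valid_path \<gamma> \<and> path_image \<gamma> \<subseteq> H2 \<and> pathstart \<gamma> = x \<and> pathfinish \<gamma> = y \<and>
     ((\<lambda>r. sqrt (minkowski (vector_derivative \<gamma> (at r within {0..1}))
                            (vector_derivative \<gamma> (at r within {0..1})))) has_integral L) {0..1}}"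

lemma hdist_eq_Inf: "hdist x y = Inf (lengths x y)"
  by (simp add: hdist_def lengths_def)

lemma vec_nth_has_real_derivative:
  "(g has_vector_derivative g') F \<Longrightarrow> ((\<lambda>r. g r $ i) has_real_derivative g' $ i) F"
  using bounded_linear.has_vector_derivative[OF bounded_linear_vec_nth]
  by (auto simp: has_real_derivative_iff_has_vector_derivative)

lemma minkowski_has_derivative:
  assumes "(g has_vector_derivative g') (at t within A)"
  shows "((\<lambda>r. minkowski x (g r)) has_real_derivative minkowski x g') (at t within A)"
proof -
  note [derivative_intros] = vec_nth_has_real_derivative[OF assms]
  show ?thesis unfolding minkowski_def by (auto intro!: derivative_eq_intros)
qed

text \<open>Along a curve \<gamma> from x, the function f = - minkowski x \<gamma> grows at a rate
  of at most f times the speed, by \<open>minkowski_tangent_le\<close>, so ln f grows by at most the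
  length. Using ln in place of the sharp arcosh avoids a derivative that is singular at the starting
  point, where f = 1; the weaker bound still turns bounded distance into bounded
  \<open>hcosh\<close>.\<close>

lemma lengths_lower_bound:
  assumes "L \<in> lengths x y"
  shows "0 \<le> L" and "ln (- minkowski x y) \<le> L"
proof -
  obtain \<gamma> where vp: "valid_path \<gamma>" and im: "path_image \<gamma> \<subseteq> H2"
    and ends: "pathstart \<gamma> = x" "pathfinish \<gamma> = y"
    and int: "((\<lambda>r. sqrt (minkowski (vector_derivative \<gamma> (at r within {0..1}))
                            (vector_derivative \<gamma> (at r within {0..1})))) has_integral L) {0..1}"
    using assms by (auto simp: lengths_def)
  obtain S where S: "finite S" "continuous_on {0..1} \<gamma>" "\<gamma> C1_differentiable_on ({0..1} - S)"
    using vp by (auto simp: valid_path_def piecewise_C1_differentiable_on_def)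
  define f where "f = (\<lambda>r. - minkowski x (\<gamma> r))"
  define g where "g r = vector_derivative \<gamma> (at r within {0..1})" for r
  have H: "\<gamma> r \<in> H2" if "r \<in> {0..1}" for r using im that by (auto simp: path_image_def)
  have x: "x \<in> H2" using H[of 0] ends by (simp add: pathstart_def)
  have f1: "f r \<ge> 1" if "r \<in> {0..1}" for r
    using minkowski_H2_le[OF x H[OF that]] by (simp add: f_def)
  have der: "(\<gamma> has_vector_derivative g r) (at r)" and tan: "minkowski (\<gamma> r) (g r) = 0"
    if r: "r \<in> {0<..<1} - S" for r
  proof -
    have "\<gamma> differentiable at r" using S(3) r by (auto simp: C1_differentiable_on_eq)
    then have d: "(\<gamma> has_vector_derivative vector_derivative \<gamma> (at r)) (at r)"
      by (simp add: vector_derivative_works)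
    have "g r = vector_derivative \<gamma> (at r)"
      unfolding g_def using d r by (intro vector_derivative_within_cbox[of 0 1, simplified]) (auto intro: has_vector_derivative_at_within)
    then show d: "(\<gamma> has_vector_derivative g r) (at r)" using d by simp
    note [derivative_intros] = vec_nth_has_real_derivative[OF d]
    have "((\<lambda>s. minkowski (\<gamma> s) (\<gamma> s)) has_real_derivative 2 * minkowski (\<gamma> r) (g r)) (at r)"
      unfolding minkowski_def by (auto intro!: derivative_eq_intros)
    moreover have "((\<lambda>s. minkowski (\<gamma> s) (\<gamma> s)) has_real_derivative 0) (at r)"
    proof (rule has_field_derivative_transform_within_open[where S="{0<..<1}"])
      show "((\<lambda>s. -1::real) has_real_derivative 0) (at r)" by simp
      show "-1 = minkowski (\<gamma> s) (\<gamma> s)" if "s \<in> {0<..<1}" for s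
        using H[of s] that by (auto simp: H2_iff_minkowski)
    qed (use r in auto)
    ultimately show "minkowski (\<gamma> r) (g r) = 0" using DERIV_unique by fastforce
  qed
  have fder: "((\<lambda>r. ln (f r)) has_vector_derivative (- minkowski x (g r) / f r)) (at r)"
    if r: "r \<in> {0<..<1} - S" for r
  proof -
    have "(f has_real_derivative - minkowski x (g r)) (at r)"
      unfolding f_def by (intro derivative_intros minkowski_has_derivative der r)
    then show ?thesis using f1[of r] r
      by (auto simp flip: has_real_derivative_iff_has_vector_derivative intro!: derivative_eq_intros)
  qed
  have cont: "continuous_on {0..1} (\<lambda>r. ln (f r))"
  proof -
    have "continuous_on {0..1} f" unfolding f_def minkowski_def by (intro continuous_intros S)
    then show ?thesis using f1 by (intro continuous_on_ln) force+
  qed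
  have "((\<lambda>r. - minkowski x (g r) / f r) has_integral (ln (f 1) - ln (f 0))) {0..1}"
    using fundamental_theorem_of_calculus_interior_strong[OF S(1) _ fder cont] by simp
  \<comment> \<open>Derivatives and tangency are known only off S and inside the interval, so both
    integrands are set to 0 at these finitely many points before they are compared
    pointwise.\<close>
  then have FTC: "((\<lambda>r. if r \<in> insert 0 (insert 1 S) then 0 else - minkowski x (g r) / f r) has_integral (ln (f 1) - ln (f 0))) {0..1}"
    by (rule has_integral_spike_finite[rotated 2, where S="insert 0 (insert 1 S)"]) (use S(1) in auto)
  have len: "((\<lambda>r. if r \<in> insert 0 (insert 1 S) then 0 else sqrt (minkowski (g r) (g r))) has_integral L) {0..1}"
    using int unfolding g_def[symmetric]
    by (rule has_integral_spike_finite[rotated 2, where S="insert 0 (insert 1 S)"]) (use S(1) in auto)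
  have "ln (f 1) - ln (f 0) \<le> L"
  proof (rule has_integral_le[OF FTC len])
    fix r :: real assume r: "r \<in> {0..1}"
    have "- minkowski x (g r) / f r \<le> sqrt (minkowski (g r) (g r))" if "r \<notin> insert 0 (insert 1 S)"
    proof -
      have "- minkowski x (g r) \<le> f r * sqrt (minkowski (g r) (g r))"
        using minkowski_tangent_le[OF x H[OF r] tan] r that by (auto simp: f_def)
      then show ?thesis using f1[OF r] by (subst pos_divide_le_eq) (auto simp: mult.commute)
    qed
    then show "(if r \<in> insert 0 (insert 1 S) then 0 else - minkowski x (g r) / f r)
       \<le> (if r \<in> insert 0 (insert 1 S) then 0 else sqrt (minkowski (g r) (g r)))" by simp
  qed
  moreover have "f 0 = 1" "f 1 = - minkowski x y"
    using ends x by (auto simp: f_def pathstart_def pathfinish_def H2_iff_minkowski)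
  ultimately show "ln (- minkowski x y) \<le> L" by simp
  show "0 \<le> L"
    using minkowski_tangent_nonneg[OF H tan] by (intro has_integral_nonneg[OF len]) auto
qed

text \<open>The branch of hyperbola cosh(rd) x + sinh(rd) v, with v the unit tangent vector at x
  pointing to y, has constant speed d. Normalising v divides by sinh d, hence the separate case
  \<open>x = y\<close>.\<close>

lemma geodesic_length:
  assumes "x \<in> H2" "y \<in> H2"
  shows "arcosh (- minkowski x y) \<in> lengths x y"
proof (cases "x = y")
  case True
  have "valid_path (\<lambda>r::real. x)" "vector_derivative (\<lambda>r::real. x) (at r within {0..1}) = 0" if "r \<in> {0..1}" for r :: real
    using that vector_derivative_within_cbox[of 0 1 r "\<lambda>r. x" 0]
    by (auto simp: valid_path_def piecewise_C1_differentiable_on_def intro!: exI[of _ "{}"])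
  then have "((\<lambda>r. sqrt (minkowski (vector_derivative (\<lambda>r::real. x) (at r within {0..1}))
                            (vector_derivative (\<lambda>r::real. x) (at r within {0..1})))) has_integral 0) {0..1}"
    by (intro has_integral_is_0) (simp add: minkowski_def)
  moreover have "valid_path (\<lambda>r::real. x)" by (auto simp: valid_path_def piecewise_C1_differentiable_on_def intro!: exI[of _ "{}"])
  ultimately show ?thesis using True assms
    by (auto simp: lengths_def H2_iff_minkowski pathstart_def pathfinish_def path_image_def intro!: exI[of _ "\<lambda>r::real. x"])
next
  case False
  define c where "c = - minkowski x y"
  define d where "d = arcosh c"
  have c1: "c \<ge> 1" using minkowski_H2_le[OF assms] by (simp add: c_def)
  have cd: "cosh d = c" using c1 by (simp add: d_def)
  have xx: "minkowski x x = -1" "minkowski y y = -1" "minkowski x y = - c" "minkowski y x = - c"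
    using assms by (auto simp: H2_iff_minkowski c_def minkowski_commute)
  have "c \<noteq> 1"
  proof
    assume "c = 1"
    then have "hcosh (Psi_inv x) (Psi_inv y) = 1"
      using assms minkowski_Psi[of "Psi_inv x" "Psi_inv y"] by (simp add: Psi_Psi_inv c_def)
    then have "cosh (Psi_inv x $ 2 - Psi_inv y $ 2) = 1"
      and "(Psi_inv x $ 1 - Psi_inv y $ 1)\<^sup>2 * exp (- Psi_inv x $ 2 - Psi_inv y $ 2) / 2 \<le> 0"
      unfolding hcosh_def using cosh_real_ge_1[of "Psi_inv x $ 2 - Psi_inv y $ 2"] by (smt (verit) divide_nonneg_nonneg exp_ge_zero zero_le_mult_iff zero_le_power2)+
    then have "Psi_inv x $ 2 = Psi_inv y $ 2" "Psi_inv x $ 1 = Psi_inv y $ 1"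
      by (auto simp: mult_le_0_iff cosh_real_one_iff)
    then have "Psi_inv x = Psi_inv y" by (simp add: vec_eq_iff forall_2)
    with False assms show False by (metis Psi_Psi_inv)
  qed
  then have d0: "d > 0" using c1 by (simp add: d_def arcosh_real_gt_1_iff)
  define s where "s = sinh d"
  have s: "s > 0" "s\<^sup>2 = c\<^sup>2 - 1" using d0 cd by (auto simp: s_def sinh_square_eq)
  define v where "v = (1 / s) *\<^sub>R (y - c *\<^sub>R x)"
  have xv: "minkowski x v = 0" "minkowski v x = 0" using xx by (auto simp: v_def algebra_simps)
  have vv: "minkowski v v = 1" using xx s
    by (simp add: v_def algebra_simps power2_eq_square divide_simps)
  define \<gamma> where "\<gamma> r = cosh (r * d) *\<^sub>R x + sinh (r * d) *\<^sub>R v" for r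
  define \<gamma>' where "\<gamma>' r = d *\<^sub>R (sinh (r * d) *\<^sub>R x + cosh (r * d) *\<^sub>R v)" for r
  have der: "(\<gamma> has_vector_derivative \<gamma>' r) (at r)" for r
    unfolding \<gamma>_def \<gamma>'_def by (auto intro!: derivative_eq_intros simp: algebra_simps)
  have vd: "vector_derivative \<gamma> (at r) = \<gamma>' r" for r using der by (rule vector_derivative_at)
  have speed: "minkowski (\<gamma>' r) (\<gamma>' r) = d\<^sup>2" for r
    using xx vv xv cosh_square_eq[of "r * d"] by (simp add: \<gamma>'_def algebra_simps power2_eq_square)
  have C1: "\<gamma> C1_differentiable_on {0..1}"
    unfolding C1_differentiable_on_def \<gamma>'_def
    by (intro exI[of _ \<gamma>'] conjI ballI der) (auto simp: \<gamma>'_def intro!: continuous_intros)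
  then have vp: "valid_path \<gamma>" by (simp add: valid_path_def C1_differentiable_imp_piecewise)
  have mem: "\<gamma> r \<in> H2" if r: "r \<in> {0..1}" for r
  proof -
    have "minkowski (\<gamma> r) (\<gamma> r) = -1"
      using xx vv xv cosh_square_eq[of "r * d"] by (simp add: \<gamma>_def algebra_simps power2_eq_square)
    \<comment> \<open>The time component of v may be negative, so positivity is read off from the
      expression in the two end points, whose coefficients are nonnegative.\<close>
    moreover have "s * \<gamma> r $ 1 = sinh ((1 - r) * d) * x$1 + sinh (r * d) * y$1"
    proof -
      have "sinh ((1 - r) * d) = s * cosh (r * d) - c * sinh (r * d)"
        using sinh_diff[of d "r * d"] cd by (simp add: s_def algebra_simps)
      then have "sinh ((1 - r) * d) * x$1 = s * (cosh (r * d) * x$1) - c * (sinh (r * d) * x$1)"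
        by (simp add: left_diff_distrib)
      then show ?thesis using s by (simp add: \<gamma>_def v_def right_diff_distrib distrib_left)
    qed
    moreover have "sinh ((1 - r) * d) * x$1 + sinh (r * d) * y$1 > 0"
    proof (cases "r = 0")
      case True then show ?thesis using assms d0 by (simp add: H2_def)
    next
      case False
      then have "sinh (r * d) * y$1 > 0" "sinh ((1 - r) * d) * x$1 \<ge> 0"
        using r assms d0 by (auto simp: H2_def)
      then show ?thesis by simp
    qed
    ultimately show ?thesis using s by (metis H2_iff_minkowski zero_less_mult_pos)
  qed
  have "((\<lambda>r. sqrt (minkowski (vector_derivative \<gamma> (at r within {0..1}))
                            (vector_derivative \<gamma> (at r within {0..1})))) has_integral d) {0..1}"
  proof (rule has_integral_eq[where f = "\<lambda>r. d"])
    show "((\<lambda>r. d) has_integral d) {0..1::real}" using has_integral_const_real[of d 0 1] by simp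
    fix r :: real assume r: "r \<in> {0..1}"
    have "vector_derivative \<gamma> (at r within {0..1}) = \<gamma>' r"
      using r by (intro vector_derivative_within_cbox[of 0 1, simplified]) (auto intro: has_vector_derivative_at_within der)
    then show "d = sqrt (minkowski (vector_derivative \<gamma> (at r within {0..1}))
                            (vector_derivative \<gamma> (at r within {0..1})))"
      using speed d0 by simp
  qed
  moreover have "\<gamma> 0 = x" "\<gamma> 1 = y" using s cd by (simp_all add: \<gamma>_def v_def flip: s_def)
  ultimately show ?thesis
    using vp mem unfolding lengths_def d_def c_def
    by (auto simp: pathstart_def pathfinish_def path_image_def intro!: exI[of _ \<gamma>])
qed

lemma hdist_nonneg: "x \<in> H2 \<Longrightarrow> y \<in> H2 \<Longrightarrow> 0 \<le> hdist x y"
  unfolding hdist_eq_Inf using geodesic_length lengths_lower_bound(1) by (intro cInf_greatest) fast+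

text \<open>Two one-sided comparisons replace an exact formula for the distance: this one turns
  decay of \<open>hcosh\<close> into decay of the distance, and \<open>hcosh_le\<close> turns the
  bounded displacement in \<open>heat_flow\<close> into bounds on the coordinates.\<close>

lemma hdist_le: "hdist (Psi y) (Psi z) \<le> arcosh (hcosh y z)"
  unfolding hdist_eq_Inf using geodesic_length[OF Psi_in_H2 Psi_in_H2, of y z] lengths_lower_bound(1)
  by (intro cInf_lower) (auto simp: minkowski_Psi bdd_below_def)

lemma hcosh_le: "hcosh y z \<le> exp (hdist (Psi y) (Psi z))"
proof -
  have "ln (hcosh y z) \<le> hdist (Psi y) (Psi z)"
    unfolding hdist_eq_Inf using geodesic_length[OF Psi_in_H2 Psi_in_H2, of y z] lengths_lower_bound(2)[of _ "Psi y" "Psi z"]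
    by (intro cInf_greatest) (auto simp: minkowski_Psi)
  then show ?thesis using hcosh_ge_1[of y z] by (metis exp_le_cancel_iff exp_ln less_le_trans zero_less_one)
qed

section \<open>Derivatives along coordinate lines\<close>

lemma vec2_nth_line [simp]:
  fixes p :: "real^2"
  shows "(p + r *\<^sub>R axis 1 1) $ 1 = p$1 + r" "(p + r *\<^sub>R axis 1 1) $ 2 = p$2"
    "(p + r *\<^sub>R axis 2 1) $ 1 = p$1" "(p + r *\<^sub>R axis 2 1) $ 2 = p$2 + r"
  by (simp_all add: axis_def)

lemma partial_works:
  assumes "f differentiable_on UNIV"
  shows "((\<lambda>r. f (p + r *\<^sub>R axis i 1)) has_real_derivative partial i f (p + r *\<^sub>R axis i 1)) (at r)"
proof -
  define q where "q = p + r *\<^sub>R axis i (1::real)"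
  obtain f' where f': "(f has_derivative f') (at q)"
    using assms by (auto simp: differentiable_on_def differentiable_def)
  have lin: "((\<lambda>t. p' + t *\<^sub>R axis i (1::real)) has_derivative (\<lambda>t. t *\<^sub>R axis i 1)) (at x)" for x p'
    by (auto intro!: derivative_eq_intros)
  have scale: "f' (t *\<^sub>R axis i 1) = t * f' (axis i 1)" for t
    using linear_scale[OF has_derivative_linear[OF f'], of t "axis i 1"] by simp
  have "((\<lambda>t. f (q + t *\<^sub>R axis i 1)) has_derivative (\<lambda>t. f' (t *\<^sub>R axis i 1))) (at 0)"
    using has_derivative_compose[OF lin[of q 0], of f f'] f' by simp
  then have "((\<lambda>t. f (q + t *\<^sub>R axis i 1)) has_real_derivative f' (axis i 1)) (at 0)"
    by (simp add: scale has_field_derivative_def mult_commute_abs)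
  then have "partial i f q = f' (axis i 1)" unfolding partial_def by (rule DERIV_imp_deriv)
  moreover have "((\<lambda>t. f (p + t *\<^sub>R axis i 1)) has_derivative (\<lambda>t. f' (t *\<^sub>R axis i 1))) (at r)"
    using has_derivative_compose[OF lin[of p r], of f f'] f' by (simp add: q_def)
  ultimately show ?thesis
    by (simp add: scale has_field_derivative_def mult_commute_abs q_def)
qed

lemma partial_eqI:
  assumes "((\<lambda>r. f (p + r *\<^sub>R axis i 1)) has_real_derivative D) (at 0)"
  shows "partial i f p = D"
  unfolding partial_def using assms by (rule DERIV_imp_deriv)

text \<open>First and second derivative along a coordinate line, as a relation. The metric is
  diagonal, so the Laplacian contains only pure second derivatives and the data on the two
  coordinate lines suffice at a maximum; the comparison functions need not be shown to satisfy
  \<open>Ck 2\<close>.\<close>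

definition line_deriv2 :: "2 \<Rightarrow> (real^2 \<Rightarrow> real) \<Rightarrow> real^2 \<Rightarrow> real \<Rightarrow> real \<Rightarrow> bool" where
  "line_deriv2 i f p a b \<longleftrightarrow> (\<exists>f'. (\<forall>r. ((\<lambda>r. f (p + r *\<^sub>R axis i 1)) has_real_derivative f' r) (at r)) \<and>
     f' 0 = a \<and> (f' has_real_derivative b) (at 0))"

lemma line_deriv2_Ck2:
  assumes "Ck 2 f"
  shows "line_deriv2 i f p (partial i f p) (partial i (partial i f) p)"
proof -
  have "f differentiable_on UNIV" "partial i f differentiable_on UNIV"
    using assms by (simp_all add: numeral_2_eq_2)
  from partial_works[OF this(1), of p i] partial_works[OF this(2), of p i 0] show ?thesis
    unfolding line_deriv2_def by (intro exI[of _ "\<lambda>r. partial i f (p + r *\<^sub>R axis i 1)"]) simp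
qed

lemma line_deriv2_max:
  assumes "line_deriv2 i f p a b" and max: "\<And>q. f q \<le> f p"
  shows "a = 0" and "b \<le> 0"
proof -
  obtain f' where f': "\<And>r. ((\<lambda>r. f (p + r *\<^sub>R axis i 1)) has_real_derivative f' r) (at r)"
    "f' 0 = a" "(f' has_real_derivative b) (at 0)"
    using assms by (auto simp: line_deriv2_def)
  show a: "a = 0"
    using DERIV_local_max[OF f'(1)[of 0], of 1] max f'(2) by auto
  show "b \<le> 0"
  proof (rule ccontr)
    assume "\<not> b \<le> 0"
    then obtain d where d: "d > 0" "\<And>h. 0 < h \<Longrightarrow> h < d \<Longrightarrow> f' 0 < f' (0 + h)"
      using DERIV_pos_inc_right[OF f'(3)] by auto
    have "f (p + 0 *\<^sub>R axis i 1) < f (p + (d/2) *\<^sub>R axis i 1)"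
    proof (rule DERIV_pos_imp_increasing_open[where f="\<lambda>r. f (p + r *\<^sub>R axis i 1)" and a=0 and b="d/2"])
      show "\<exists>y. ((\<lambda>r. f (p + r *\<^sub>R axis i 1)) has_real_derivative y) (at x) \<and> 0 < y"
        if "0 < x" "x < d/2" for x
        using f'(1)[of x] d(2)[of x] that a f'(2) d(1) by (intro exI[of _ "f' x"]) auto
      show "continuous_on {0..d/2} (\<lambda>r. f (p + r *\<^sub>R axis i 1))"
        using f'(1) DERIV_isCont by (intro continuous_at_imp_continuous_on) blast
    qed (use d in auto)
    with max[of "p + (d/2) *\<^sub>R axis i 1"] show False by simp
  qed
qed

section \<open>The geometry in coordinates\<close>

lemma met_inv_simps [simp]:
  "met_inv p 1 1 = exp (2 * p$2)" "met_inv p 2 2 = 1" "met_inv p 1 2 = 0" "met_inv p 2 1 = 0"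
  by (simp_all add: met_inv_def)

lemma partial_met:
  "partial k (\<lambda>q. met q i j) p = (if i = 1 \<and> j = 1 \<and> k = 2 then - 2 * exp (- 2 * p$2) else 0)"
  using exhaust_2[of k] exhaust_2[of i] exhaust_2[of j]
  by (elim disjE; intro partial_eqI) (auto simp: met_def axis_def intro!: derivative_eq_intros)

lemma christoffel_simps [simp]:
  "christoffel p 1 1 1 = 0" "christoffel p 1 1 2 = -1" "christoffel p 1 2 1 = -1" "christoffel p 1 2 2 = 0"
  "christoffel p 2 1 1 = exp (- 2 * p$2)" "christoffel p 2 1 2 = 0" "christoffel p 2 2 1 = 0"
  "christoffel p 2 2 2 = 0"
  by (simp_all add: christoffel_def sum_2 partial_met exp_minus)

lemma laplace_partial:
  "laplace partial f p = exp (2 * p$2) * partial 1 (partial 1 f) p + partial 2 (partial 2 f) p - partial 2 f p"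
  by (simp add: laplace_def sum_2 numeral_2_eq_2 exp_minus algebra_simps)

lemma tension_partial:
  defines "g \<equiv> \<lambda>f h p. exp (2 * p$2) * partial 1 f p * partial 1 h p + partial 2 f p * partial 2 h p"
  shows "tension partial w p $ 1 = laplace partial (\<lambda>q. w q $ 1) p - 2 * g (\<lambda>q. w q $ 1) (\<lambda>q. w q $ 2) p"
    "tension partial w p $ 2 = laplace partial (\<lambda>q. w q $ 2) p + exp (- 2 * w p $ 2) * g (\<lambda>q. w q $ 1) (\<lambda>q. w q $ 1) p"
  by (simp_all add: tension_def g_def sum_2 algebra_simps)

section \<open>The distance between two solutions of the heat flow\<close>

definition hcosh_deriv :: "real^2 \<Rightarrow> real^2 \<Rightarrow> real^2 \<Rightarrow> real^2 \<Rightarrow> real" where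
  "hcosh_deriv y z \<xi> \<zeta> = sinh (y$2 - z$2) * (\<xi>$2 - \<zeta>$2) +
     ((y$1 - z$1) * (\<xi>$1 - \<zeta>$1) - (y$1 - z$1)\<^sup>2 * (\<xi>$2 + \<zeta>$2) / 2) * exp (- y$2 - z$2)"

definition hcosh_deriv2 :: "real^2 \<Rightarrow> real^2 \<Rightarrow> real^2 \<Rightarrow> real^2 \<Rightarrow> real" where
  "hcosh_deriv2 y z \<xi> \<zeta> = cosh (y$2 - z$2) * (\<xi>$2 - \<zeta>$2)\<^sup>2 +
     ((\<xi>$1 - \<zeta>$1)\<^sup>2 - 2 * (y$1 - z$1) * (\<xi>$1 - \<zeta>$1) * (\<xi>$2 + \<zeta>$2) +
      (y$1 - z$1)\<^sup>2 * (\<xi>$2 + \<zeta>$2)\<^sup>2 / 2) * exp (- y$2 - z$2)"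

text \<open>The Christoffel symbols contracted twice with \<xi>. The same expression is the
  nonlinear term of the tension field and the correction that turns the coordinate Hessian on the
  target into the covariant one.\<close>

definition quad_christoffel :: "real^2 \<Rightarrow> real^2 \<Rightarrow> real^2" where
  "quad_christoffel y \<xi> = vector [- 2 * \<xi>$1 * \<xi>$2, exp (- 2 * y$2) * (\<xi>$1)\<^sup>2]"

text \<open>The right-hand side is the covariant Hessian of \<^const>\<open>hcosh\<close> on the product of two hyperbolic planes, and a
  sum of three squares after multiplication by P X Y, with P, X, Y as in the proof.\<close>

lemma hcosh_convex:
  "0 \<le> hcosh_deriv2 y z \<xi> \<zeta> - hcosh_deriv y z (quad_christoffel y \<xi>) (quad_christoffel z \<zeta>)"
proof -
  \<comment> \<open>X and Y are the half-plane heights; A, B and C, D below are the components of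
    \<xi> and \<zeta> in orthonormal frames, so that only polynomials remain.\<close>
  define X Y m where "X = exp (y$2)" and "Y = exp (z$2)" and "m = y$1 - z$1"
  define A B C D where "A = \<xi>$1 / X" and "B = \<xi>$2" and "C = \<zeta>$1 / Y" and "D = \<zeta>$2"
  have pos: "X > 0" "Y > 0" by (simp_all add: X_def Y_def)
  define E where "E = hcosh_deriv2 y z \<xi> \<zeta> - hcosh_deriv y z (quad_christoffel y \<xi>) (quad_christoffel z \<zeta>)"
  define P where "P = (X\<^sup>2 + Y\<^sup>2 + m\<^sup>2) / 2"
  have P: "P > 0" using pos unfolding P_def
    by (metis add_pos_nonneg add_pos_pos half_gt_zero zero_le_power2 zero_less_power)
  have comp: "\<xi>$1 = X * A" "\<xi>$2 = B" "\<zeta>$1 = Y * C" "\<zeta>$2 = D"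
    using pos by (simp_all add: A_def B_def C_def D_def)
  have ex: "exp (- y$2 - z$2) = 1 / (X * Y)" "exp (- 2 * y$2) = 1 / X\<^sup>2" "exp (- 2 * z$2) = 1 / Y\<^sup>2"
    "cosh (y$2 - z$2) = (X / Y + Y / X) / 2" "sinh (y$2 - z$2) = (X / Y - Y / X) / 2"
    by (simp_all add: X_def Y_def cosh_def sinh_def exp_minus exp_diff exp_add power2_eq_square field_simps flip: exp_add)
  have G: "quad_christoffel y \<xi> $ 1 = - 2 * (X * A) * B" "quad_christoffel y \<xi> $ 2 = A\<^sup>2"
    "quad_christoffel z \<zeta> $ 1 = - 2 * (Y * C) * D" "quad_christoffel z \<zeta> $ 2 = C\<^sup>2"
    using pos ex(2,3) by (simp_all add: quad_christoffel_def comp[symmetric] A_def C_def power_divide)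
  have "(X * Y) * E = (X\<^sup>2 + Y\<^sup>2) / 2 * (B - D)\<^sup>2 + (X * A - Y * C)\<^sup>2 - 2 * m * (X * A - Y * C) * (B + D) + m\<^sup>2 * (B + D)\<^sup>2 / 2
     - ((X\<^sup>2 - Y\<^sup>2) / 2 * (A\<^sup>2 - C\<^sup>2) + m * (- 2 * X * A * B + 2 * Y * C * D) - m\<^sup>2 / 2 * (A\<^sup>2 + C\<^sup>2))"
  proof -
    have XY: "X * Y * cosh (y$2 - z$2) = (X\<^sup>2 + Y\<^sup>2) / 2" "X * Y * sinh (y$2 - z$2) = (X\<^sup>2 - Y\<^sup>2) / 2"
      "X * Y * exp (- y$2 - z$2) = 1"
      using pos unfolding ex by (simp_all add: field_simps power2_eq_square)
    have "k * (ch * T + N * e - (sh * T' + N' * e)) = k * ch * T + k * e * N - (k * sh * T' + k * e * N')"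
      for k ch T N e sh T' N' :: real by (simp add: algebra_simps)
    then show ?thesis
      unfolding E_def hcosh_deriv2_def hcosh_deriv_def comp G m_def[symmetric]
      by (simp only: XY) (simp add: algebra_simps)
  qed
  \<comment> \<open>P is \<open>X * Y * hcosh y z\<close>. In X Y E the squares of C and D both have
    coefficient P and the mixed term in C and D cancels; after multiplication by P the square is
    completed in C and in D separately, and the third square is the remainder in A and B.\<close>
  then have "P * ((X * Y) * E) = (P * C - (X * Y * A - m * Y * B))\<^sup>2
      + (P * D - ((X\<^sup>2 + Y\<^sup>2 - m\<^sup>2) / 2 * B + m * X * A))\<^sup>2 + ((X\<^sup>2 - Y\<^sup>2 - m\<^sup>2) / 2 * A - m * X * B)\<^sup>2"
    unfolding P_def by (simp only:) (simp add: power2_eq_square field_simps)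
  then have "0 \<le> P * ((X * Y) * E)" by (simp only:) (intro add_nonneg_nonneg zero_le_power2)
  then have "0 \<le> E" using P pos by (metis mult_pos_pos zero_le_mult_iff less_le_not_le)
  then show ?thesis by (simp add: E_def)
qed

lemma line_deriv2_hcosh:
  assumes "\<And>j. line_deriv2 i (\<lambda>q. y q $ j) p (\<xi>$j) (\<xi>'$j)" "\<And>j. line_deriv2 i (\<lambda>q. z q $ j) p (\<zeta>$j) (\<zeta>'$j)"
  shows "line_deriv2 i (\<lambda>q. hcosh (y q) (z q)) p (hcosh_deriv (y p) (z p) \<xi> \<zeta>)
     (hcosh_deriv (y p) (z p) \<xi>' \<zeta>' + hcosh_deriv2 (y p) (z p) \<xi> \<zeta>)"
proof -
  define L where "L r = p + r *\<^sub>R axis i (1::real)" for r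
  have L0: "L 0 = p" by (simp add: L_def)
  from assms obtain f g where
    f: "\<And>j r. ((\<lambda>r. y (L r) $ j) has_real_derivative f j r) (at r)" "\<And>j. f j 0 = \<xi>$j"
       "\<And>j. (f j has_real_derivative \<xi>'$j) (at 0)" and
    g: "\<And>j r. ((\<lambda>r. z (L r) $ j) has_real_derivative g j r) (at r)" "\<And>j. g j 0 = \<zeta>$j"
       "\<And>j. (g j has_real_derivative \<zeta>'$j) (at 0)"
    unfolding line_deriv2_def L_def by metis
  define m k l where "m r = y (L r) $ 1 - z (L r) $ 1" and "k r = - y (L r) $ 2 - z (L r) $ 2"
    and "l r = y (L r) $ 2 - z (L r) $ 2" for r
  define m' k' l' where "m' r = f 1 r - g 1 r" and "k' r = - (f 2 r + g 2 r)" and "l' r = f 2 r - g 2 r" for r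
  have d1: "(m has_real_derivative m' r) (at r)" "(k has_real_derivative k' r) (at r)" "(l has_real_derivative l' r) (at r)" for r
    unfolding m_def k_def l_def m'_def k'_def l'_def by (auto intro!: derivative_eq_intros f g)
  have d2: "(m' has_real_derivative \<xi>'$1 - \<zeta>'$1) (at 0)" "(k' has_real_derivative - (\<xi>'$2 + \<zeta>'$2)) (at 0)"
    "(l' has_real_derivative \<xi>'$2 - \<zeta>'$2) (at 0)"
    unfolding m'_def k'_def l'_def by (auto intro!: derivative_eq_intros f g)
  define F where "F r = sinh (l r) * l' r + (m r * m' r + (m r)\<^sup>2 * k' r / 2) * exp (k r)" for r
  have "((\<lambda>r. hcosh (y (L r)) (z (L r))) has_real_derivative F r) (at r)" for r
    unfolding hcosh_def m_def[symmetric] k_def[symmetric] l_def[symmetric] F_def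
    by (rule derivative_eq_intros d1 refl | simp add: field_simps power2_eq_square)+
  moreover have "F 0 = hcosh_deriv (y p) (z p) \<xi> \<zeta>"
    by (simp add: F_def hcosh_deriv_def L0 f(2) g(2) m_def k_def l_def m'_def k'_def l'_def algebra_simps add_divide_distrib diff_divide_distrib)
  moreover have "(F has_real_derivative cosh (l 0) * (l' 0)\<^sup>2 + sinh (l 0) * (\<xi>'$2 - \<zeta>'$2) +
      ((m' 0)\<^sup>2 + m 0 * (\<xi>'$1 - \<zeta>'$1) + 2 * m 0 * m' 0 * k' 0 - (m 0)\<^sup>2 * (\<xi>'$2 + \<zeta>'$2) / 2
        + (m 0)\<^sup>2 * (k' 0)\<^sup>2 / 2) * exp (k 0)) (at 0)"
    unfolding F_def by (rule derivative_eq_intros d1 d2 refl | simp add: field_simps power2_eq_square)+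
  moreover have "cosh (l 0) * (l' 0)\<^sup>2 + sinh (l 0) * (\<xi>'$2 - \<zeta>'$2) +
      ((m' 0)\<^sup>2 + m 0 * (\<xi>'$1 - \<zeta>'$1) + 2 * m 0 * m' 0 * k' 0 - (m 0)\<^sup>2 * (\<xi>'$2 + \<zeta>'$2) / 2
        + (m 0)\<^sup>2 * (k' 0)\<^sup>2 / 2) * exp (k 0)
    = hcosh_deriv (y p) (z p) \<xi>' \<zeta>' + hcosh_deriv2 (y p) (z p) \<xi> \<zeta>"
  proof -
    have sq: "(- a - b)\<^sup>2 = (a + b)\<^sup>2" for a b :: real by (simp add: power2_eq_square algebra_simps)
    show ?thesis
      unfolding hcosh_deriv_def hcosh_deriv2_def m_def k_def l_def m'_def k'_def l'_def L0 f(2) g(2)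
      by (simp add: sq distrib_right distrib_left left_diff_distrib right_diff_distrib)
  qed
  ultimately show ?thesis unfolding line_deriv2_def L_def[symmetric] by (intro exI[of _ F]) auto
qed

section \<open>Calculus of derivatives along lines, and the derivatives of the height
  function\<close>

lemma line_deriv2_add:
  assumes "line_deriv2 i f p a b" "line_deriv2 i g p a' b'"
  shows "line_deriv2 i (\<lambda>q. f q + g q) p (a + a') (b + b')"
proof -
  obtain f' g' where "\<And>r. ((\<lambda>r. f (p + r *\<^sub>R axis i 1)) has_real_derivative f' r) (at r)"
    "f' 0 = a" "(f' has_real_derivative b) (at 0)"
    "\<And>r. ((\<lambda>r. g (p + r *\<^sub>R axis i 1)) has_real_derivative g' r) (at r)"
    "g' 0 = a'" "(g' has_real_derivative b') (at 0)"
    using assms by (auto simp: line_deriv2_def)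
  then show ?thesis unfolding line_deriv2_def
    by (intro exI[of _ "\<lambda>r. f' r + g' r"]) (auto intro!: DERIV_add)
qed

lemma line_deriv2_compose:
  assumes "line_deriv2 i f p a b" "\<And>q. f q > 0"
    and "\<And>t::real. t > 0 \<Longrightarrow> (g has_real_derivative g' t) (at t)" "(g' has_real_derivative g'') (at (f p))"
  shows "line_deriv2 i (\<lambda>q. g (f q)) p (g' (f p) * a) (g'' * a\<^sup>2 + g' (f p) * b)"
proof -
  obtain f' where f': "\<And>r. ((\<lambda>r. f (p + r *\<^sub>R axis i 1)) has_real_derivative f' r) (at r)"
    "f' 0 = a" "(f' has_real_derivative b) (at 0)"
    using assms by (auto simp: line_deriv2_def)
  have 1: "((\<lambda>r. g (f (p + r *\<^sub>R axis i 1))) has_real_derivative g' (f (p + r *\<^sub>R axis i 1)) * f' r) (at r)" for r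
    using DERIV_chain2[OF assms(3)[OF assms(2)] f'(1)] .
  have "((\<lambda>r. g' (f (p + r *\<^sub>R axis i 1))) has_real_derivative g'' * f' 0) (at 0)"
    using DERIV_chain2[of g' g'' "\<lambda>r. f (p + r *\<^sub>R axis i 1)" 0] assms(4) f'(1)[of 0] by simp
  from DERIV_mult[OF this f'(3)]
  have "((\<lambda>r. g' (f (p + r *\<^sub>R axis i 1)) * f' r) has_real_derivative g'' * a\<^sup>2 + g' (f p) * b) (at 0)"
    by (rule DERIV_cong) (simp add: f'(2) power2_eq_square)
  moreover have "g' (f (p + 0 *\<^sub>R axis i 1)) * f' 0 = g' (f p) * a" by (simp add: f'(2))
  ultimately show ?thesis
    unfolding line_deriv2_def using 1 by (intro exI[of _ "\<lambda>r. g' (f (p + r *\<^sub>R axis i 1)) * f' r"] conjI allI)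
qed

lemma line_deriv2_cmult:
  assumes "line_deriv2 i f p a b" shows "line_deriv2 i (\<lambda>q. c * f q) p (c * a) (c * b)"
proof -
  obtain f' where "\<And>r. ((\<lambda>r. f (p + r *\<^sub>R axis i 1)) has_real_derivative f' r) (at r)"
    "f' 0 = a" "(f' has_real_derivative b) (at 0)"
    using assms by (auto simp: line_deriv2_def)
  then show ?thesis unfolding line_deriv2_def
    by (intro exI[of _ "\<lambda>r. c * f' r"]) (auto intro!: DERIV_cmult)
qed

lemma line_deriv2_height:
  "line_deriv2 1 height p (exp (- p$2) * p$1) (exp (- p$2))"
  "line_deriv2 2 height p (sinh (p$2) - exp (- p$2) * (p$1)\<^sup>2 / 2) (height p)"
proof -
  show "line_deriv2 1 height p (exp (- p$2) * p$1) (exp (- p$2))"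
    unfolding line_deriv2_def height_def vec2_nth_line
    by (intro exI[of _ "\<lambda>r. exp (- p$2) * (p$1 + r)"] conjI allI) (auto intro!: derivative_eq_intros)
  show "line_deriv2 2 height p (sinh (p$2) - exp (- p$2) * (p$1)\<^sup>2 / 2) (height p)"
    unfolding line_deriv2_def height_def vec2_nth_line
    by (intro exI[of _ "\<lambda>r. sinh (p$2 + r) - exp (- (p$2 + r)) * (p$1)\<^sup>2 / 2"] conjI allI)
       (auto intro!: derivative_eq_intros)
qed

section \<open>The comparison principle\<close>

lemma abs_le_2_cosh: "\<bar>x\<bar> \<le> 2 * cosh x" for x :: real
proof -
  have "1 + \<bar>x\<bar> \<le> exp \<bar>x\<bar>" by (rule exp_ge_add_one_self)
  also have "\<dots> \<le> 2 * cosh x" by (simp add: cosh_def abs_if)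
  finally show ?thesis by simp
qed

lemma abs_le_square_plus_1: "\<bar>x\<bar> \<le> x\<^sup>2 + 1" for x :: real
  using zero_le_power2[of "\<bar>x\<bar> - 1/2"] by (simp add: power2_eq_square algebra_simps)

text \<open>Properness of \<open>height\<close> in explicit form: the cosh term bounds
  \<open>p$2\<close>, and then the other term bounds \<open>p$1\<close>. The right-hand side is
  increasing in the height, so bounded height means bounded coordinates.\<close>

lemma height_bounds_norm: "norm p \<le> 2 * height p + (2 * height p * exp (2 * height p) + 1)"
proof -
  define h where "h = height p"
  have h: "h \<ge> 1" using height_ge_1 by (simp add: h_def)
  have q: "exp (- p$2) * (p$1)\<^sup>2 / 2 \<ge> 0" by simp
  then have c: "cosh (p$2) \<le> h" by (simp add: h_def height_def)
  have y: "\<bar>p$2\<bar> \<le> 2 * h" using c abs_le_2_cosh[of "p$2"] by simp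
  have "exp (- p$2) * (p$1)\<^sup>2 \<le> 2 * h" using cosh_real_ge_1[of "p$2"] by (simp add: h_def height_def)
  then have "(p$1)\<^sup>2 \<le> 2 * h * exp (p$2)" by (simp add: exp_minus field_simps)
  also have "\<dots> \<le> 2 * h * exp (2 * h)" using y h by (intro mult_left_mono) auto
  finally have "(p$1)\<^sup>2 \<le> 2 * h * exp (2 * h)" .
  moreover have "\<bar>p$1\<bar> \<le> (p$1)\<^sup>2 + 1" by (rule abs_le_square_plus_1)
  ultimately have "\<bar>p$1\<bar> \<le> 2 * h * exp (2 * h) + 1" by linarith
  moreover have "norm p \<le> \<bar>p$1\<bar> + \<bar>p$2\<bar>" using norm_le_l1_cart[of p] by (simp add: sum_2)
  ultimately show ?thesis using y unfolding h_def by linarith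
qed

text \<open>A positive maximum exists because W is negative outside a ball, and there the strict
  inequality in \<open>deriv\<close> contradicts the derivative tests at once. Strictness has to be
  supplied by the caller; in \<open>heat_flow_decay\<close> it comes from the barrier.\<close>

lemma max_principle:
  fixes W :: "real \<Rightarrow> real^2 \<Rightarrow> real"
  assumes cont: "continuous_on ({0..S} \<times> UNIV) (\<lambda>(s, p). W s p)"
    and far: "\<And>s p. s \<in> {0..S} \<Longrightarrow> norm p > R \<Longrightarrow> W s p < 0"
    and init: "\<And>p. W 0 p \<le> 0"
    and deriv: "\<And>s p. 0 < s \<Longrightarrow> s \<le> S \<Longrightarrow> \<exists>d a1 a2 b1 b2.
      ((\<lambda>s. W s p) has_real_derivative d) (at s) \<and> line_deriv2 1 (W s) p a1 b1 \<and> line_deriv2 2 (W s) p a2 b2 \<and>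
      d < exp (2 * p$2) * b1 + b2 - a2"
    and s: "s \<in> {0..S}"
  shows "W s p \<le> 0"
proof (rule ccontr)
  assume "\<not> W s p \<le> 0"
  then have pos: "W s p > 0" by simp
  define K where "K = {0..S} \<times> cball (0::real^2) R"
  have mem: "(s, p) \<in> K" using far[OF s, of p] pos s by (force simp: K_def)
  have "compact K" by (simp add: K_def compact_Times)
  moreover have "continuous_on K (\<lambda>(s, p). W s p)" using cont by (rule continuous_on_subset) (auto simp: K_def)
  ultimately obtain z where z: "z \<in> K" "\<And>y. y \<in> K \<Longrightarrow> (\<lambda>(s, p). W s p) y \<le> (\<lambda>(s, p). W s p) z"
    using continuous_attains_sup[of K "\<lambda>(s, p). W s p"] mem by blast
  obtain s1 p1 where zz: "z = (s1, p1)" by (cases z)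
  have W1: "W s1 p1 > 0" using z(2)[OF mem] pos zz by simp
  have s1: "s1 \<in> {0..S}" using z zz by (simp add: K_def)
  have mx: "W r q \<le> W s1 p1" if "r \<in> {0..S}" for r q
  proof (cases "norm q \<le> R")
    case True then show ?thesis using z(2)[of "(r, q)"] that zz by (simp add: K_def)
  next
    case False then show ?thesis using far[OF that, of q] W1 by simp
  qed
  have "s1 \<noteq> 0" using init[of p1] W1 by auto
  then have s1': "0 < s1" "s1 \<le> S" using s1 by auto
  from deriv[OF this, of p1] obtain d a1 a2 b1 b2 where
    D: "((\<lambda>s. W s p1) has_real_derivative d) (at s1)" "line_deriv2 1 (W s1) p1 a1 b1" "line_deriv2 2 (W s1) p1 a2 b2"
      "d < exp (2 * p1$2) * b1 + b2 - a2" by blast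
  have "a2 = 0" "b1 \<le> 0" "b2 \<le> 0"
    using line_deriv2_max[OF D(2)] line_deriv2_max[OF D(3)] mx[OF s1] by auto
  \<comment> \<open>The maximum may be attained at the final time S, so only earlier times are
    compared.\<close>
  moreover have "d \<ge> 0"
  proof (rule ccontr)
    assume "\<not> d \<ge> 0"
    then obtain e where e: "e > 0" "\<And>h. 0 < h \<Longrightarrow> h < e \<Longrightarrow> W s1 p1 < W (s1 - h) p1"
      using DERIV_neg_dec_left[OF D(1)] by auto
    have "W s1 p1 < W (s1 - min (e/2) s1) p1" using e(1) s1' by (intro e(2)) auto
    then show False using mx[of "s1 - min (e/2) s1" p1] s1' e(1) by (auto simp: min_def split: if_splits)
  qed
  moreover have "exp (2 * p1$2) * b1 \<le> 0" using \<open>b1 \<le> 0\<close> by (simp add: mult_nonneg_nonpos)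
  ultimately show False using D(4) by linarith
qed

section \<open>Subsolutions, supersolutions and the decay estimate\<close>

lemma hcosh_deriv_linear:
  "hcosh_deriv y z (\<xi> + \<xi>') (\<zeta> + \<zeta>') = hcosh_deriv y z \<xi> \<zeta> + hcosh_deriv y z \<xi>' \<zeta>'"
  "hcosh_deriv y z (\<xi> - \<xi>') (\<zeta> - \<zeta>') = hcosh_deriv y z \<xi> \<zeta> - hcosh_deriv y z \<xi>' \<zeta>'"
  "hcosh_deriv y z (c *\<^sub>R \<xi>) (c *\<^sub>R \<zeta>) = c * hcosh_deriv y z \<xi> \<zeta>"
  unfolding hcosh_deriv_def by (simp_all add: algebra_simps add_divide_distrib diff_divide_distrib)

lemma tension_partial_eq:
  "tension partial w p = exp (2 * p$2) *\<^sub>R (\<chi> j. partial 1 (partial 1 (\<lambda>q. w q $ j)) p) +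
     (\<chi> j. partial 2 (partial 2 (\<lambda>q. w q $ j)) p) - (\<chi> j. partial 2 (\<lambda>q. w q $ j) p) +
     exp (2 * p$2) *\<^sub>R quad_christoffel (w p) (\<chi> j. partial 1 (\<lambda>q. w q $ j) p) +
     quad_christoffel (w p) (\<chi> j. partial 2 (\<lambda>q. w q $ j) p)"
  by (simp add: vec_eq_iff forall_2 tension_partial laplace_partial quad_christoffel_def power2_eq_square algebra_simps)

lemma hcosh_has_derivative:
  assumes "(y has_vector_derivative y') (at s)"
  shows "((\<lambda>s. hcosh (y s) z) has_real_derivative hcosh_deriv (y s) z y' 0) (at s)"
proof -
  note [derivative_intros] = vec_nth_has_real_derivative[OF assms]
  show ?thesis unfolding hcosh_def hcosh_deriv_def
    by (rule derivative_eq_intros refl | simp add: field_simps power2_eq_square)+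
qed

text \<open>A harmonic q is a stationary solution, so its vanishing tension field may replace the 0
  in the second slot. Then the terms linear in the second derivatives agree on both sides, and what
  remains is, for each direction i with its positive weight, the covariant Hessian of
  \<open>hcosh\<close> on the pair of i-th partial derivatives, nonnegative by
  \<open>hcosh_convex\<close>.\<close>

lemma hcosh_subsolution:
  assumes "\<And>j. Ck 2 (\<lambda>p. w p $ j)" "\<And>j. Ck 2 (\<lambda>p. q p $ j)" "tension partial q p = 0"
  obtains a1 b1 a2 b2 where
    "line_deriv2 1 (\<lambda>p. hcosh (w p) (q p)) p a1 b1" "line_deriv2 2 (\<lambda>p. hcosh (w p) (q p)) p a2 b2"
    "hcosh_deriv (w p) (q p) (tension partial w p) 0 \<le> exp (2 * p$2) * b1 + b2 - a2"
proof -
  define X X' where "X i = (\<chi> j. partial i (\<lambda>p. w p $ j) p)" and "X' i = (\<chi> j. partial i (partial i (\<lambda>p. w p $ j)) p)" for i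
  define Z Z' where "Z i = (\<chi> j. partial i (\<lambda>p. q p $ j) p)" and "Z' i = (\<chi> j. partial i (partial i (\<lambda>p. q p $ j)) p)" for i
  define D where "D = hcosh_deriv (w p) (q p)"
  define D2 where "D2 i = hcosh_deriv2 (w p) (q p) (X i) (Z i)" for i
  define C where "C i = D (quad_christoffel (w p) (X i)) (quad_christoffel (q p) (Z i))" for i
  have 1: "line_deriv2 i (\<lambda>p. hcosh (w p) (q p)) p (D (X i) (Z i)) (D (X' i) (Z' i) + D2 i)" for i
    unfolding D_def D2_def
    by (rule line_deriv2_hcosh) (simp_all add: X_def X'_def Z_def Z'_def line_deriv2_Ck2 assms)
  have "D (tension partial w p) 0 = D (tension partial w p) (tension partial q p)"
    by (simp add: assms)
  also have "\<dots> = exp (2 * p$2) * D (X' 1) (Z' 1) + D (X' 2) (Z' 2) - D (X 2) (Z 2) + exp (2 * p$2) * C 1 + C 2"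
    unfolding tension_partial_eq C_def X_def[symmetric] X'_def[symmetric] Z_def[symmetric] Z'_def[symmetric]
    by (simp add: D_def hcosh_deriv_linear)
  also have "\<dots> \<le> exp (2 * p$2) * (D (X' 1) (Z' 1) + D2 1) + (D (X' 2) (Z' 2) + D2 2) - D (X 2) (Z 2)"
  proof -
    have "C i \<le> D2 i" for i using hcosh_convex[of "w p" "q p" "X i" "Z i"] by (simp add: C_def D2_def D_def)
    then have "exp (2 * p$2) * C 1 + C 2 \<le> exp (2 * p$2) * D2 1 + D2 2" by (intro add_mono mult_left_mono) auto
    then show ?thesis by (simp add: distrib_left)
  qed
  finally show ?thesis using that[OF 1 1] by (simp add: D_def)
qed

lemma height_laplace:
  "exp (2 * p$2) * exp (- p$2) + height p - (sinh (p$2) - exp (- p$2) * (p$1)\<^sup>2 / 2) = 2 * height p"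
proof -
  have "exp (2 * p$2) * exp (- p$2) = exp (p$2)" by (simp flip: exp_add)
  then show ?thesis by (simp add: height_def cosh_def sinh_def add_divide_distrib diff_divide_distrib)
qed

text \<open>With \<rho> the distance to \<open>Psi 0\<close>, whose gradient has length one, this is
  |grad cosh \<rho>|^2 = (sinh \<rho>)^2.\<close>

lemma height_gradient:
  "exp (2 * p$2) * (exp (- p$2) * p$1)\<^sup>2 + (sinh (p$2) - exp (- p$2) * (p$1)\<^sup>2 / 2)\<^sup>2 = (height p)\<^sup>2 - 1"
proof -
  have "cosh (p$2) = exp (- p$2) + sinh (p$2)" using cosh_sinh_exp[of "p$2"] by simp
  moreover have "exp (2 * p$2) * (exp (- p$2))\<^sup>2 = 1" by (simp add: power2_eq_square flip: exp_add)
  moreover have "(cosh (p$2))\<^sup>2 = (sinh (p$2))\<^sup>2 + 1" by (rule cosh_square_eq)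
  ultimately have "(height p)\<^sup>2 - 1 = (sinh (p$2) - exp (- p$2) * (p$1)\<^sup>2 / 2)\<^sup>2
      + 2 * (cosh (p$2) + sinh (p$2)) * (exp (- p$2) * (p$1)\<^sup>2 / 2)"
    unfolding height_def by (simp add: power2_eq_square algebra_simps)
  moreover have "(cosh (p$2) + sinh (p$2)) * exp (- p$2) = 1"
    by (simp add: cosh_plus_sinh flip: exp_add)
  then have "2 * (cosh (p$2) + sinh (p$2)) * (exp (- p$2) * (p$1)\<^sup>2 / 2) = (p$1)\<^sup>2"
  proof -
    have "2 * a * (e * x / 2) = a * e * x" for a e x :: real by simp
    then show ?thesis using \<open>(cosh (p$2) + sinh (p$2)) * exp (- p$2) = 1\<close> by (simp only: mult_1)
  qed
  moreover have "exp (2 * p$2) * (exp (- p$2) * p$1)\<^sup>2 = (p$1)\<^sup>2"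
    by (simp add: power_mult_distrib power2_eq_square flip: exp_add mult.assoc)
  ultimately show ?thesis by simp
qed

text \<open>The exponent -1/2 gives the bottom 1/4 of the spectrum of the hyperbolic plane as decay rate.\<close>

lemma height_powr_supersolution:
  obtains a1 b1 a2 b2 where
    "line_deriv2 1 (\<lambda>p. height p powr (-1/2)) p a1 b1" "line_deriv2 2 (\<lambda>p. height p powr (-1/2)) p a2 b2"
    "exp (2 * p$2) * b1 + b2 - a2 \<le> - (1/4) * height p powr (-1/2)"
proof -
  define h where "h = height p"
  have hp: "height q > 0" for q using height_ge_1[of q] by simp
  have h: "h > 0" using hp by (simp add: h_def)
  define g' where "g' t = -1/2 * t powr (-3/2)" for t :: real
  define g'' where "g'' = 3/4 * h powr (-5/2)"
  have g: "((\<lambda>t. t powr (-1/2)) has_real_derivative g' t) (at t)" if "t > 0" for t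
    using that unfolding g'_def by (auto intro!: derivative_eq_intros)
  have g2: "(g' has_real_derivative g'') (at (height p))"
    using hp[of p] unfolding g'_def g''_def h_def by (auto intro!: derivative_eq_intros)
  note L = line_deriv2_compose[OF line_deriv2_height(1)[of p] hp g g2] line_deriv2_compose[OF line_deriv2_height(2)[of p] hp g g2]
  have e1: "g' h * (2 * h) = - (h powr (-1/2))"
    using h powr_mult_base[of h "-3/2"] by (simp add: g'_def mult.commute)
  have "h powr (-5/2) * h\<^sup>2 = h powr (-1/2)"
    using h by (simp flip: powr_numeral powr_add)
  then have e2: "g'' * (h\<^sup>2 - 1) = 3/4 * h powr (-1/2) - g''"
    by (simp add: g''_def right_diff_distrib)
  have eq: "exp (2 * p$2) * (g'' * (exp (- p$2) * p$1)\<^sup>2 + g' h * exp (- p$2)) +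
    (g'' * (sinh (p$2) - exp (- p$2) * (p$1)\<^sup>2 / 2)\<^sup>2 + g' h * h) - g' h * (sinh (p$2) - exp (- p$2) * (p$1)\<^sup>2 / 2)
     = g'' * (h\<^sup>2 - 1) + g' h * (2 * h)"
    unfolding h_def height_laplace[symmetric] height_gradient[symmetric] by (simp add: algebra_simps)
  have "g'' \<ge> 0" by (simp add: g''_def)
  then have "g'' * (h\<^sup>2 - 1) + g' h * (2 * h) \<le> - (1/4) * h powr (-1/2)" using e1 e2 by simp
  then show ?thesis using that[OF L] unfolding eq[symmetric] by (simp only: h_def)
qed

text \<open>Comparison with the sum of the constant 1 + \<epsilon>, a decaying multiple of \<phi>
  powr (-1/2), and \<eta> exp(3s) \<phi>. The bound K serves to make the last term dominate far
  away; as \<eta> is arbitrary, neither K nor the growth of exp(3s) is left in the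
  conclusion.\<close>

lemma heat_flow_decay:
  fixes v :: "real \<Rightarrow> real^2 \<Rightarrow> real^2" and q :: "real^2 \<Rightarrow> real^2"
  assumes cont: "continuous_on ({0..} \<times> UNIV) (\<lambda>(s, p). v s p)" "continuous_on UNIV q"
    and C2: "\<And>s j. s > 0 \<Longrightarrow> Ck 2 (\<lambda>p. v s p $ j)" "\<And>j. Ck 2 (\<lambda>p. q p $ j)"
    and harm: "\<And>p. tension partial q p = 0"
    and flow: "\<And>s p. s > 0 \<Longrightarrow> ((\<lambda>r. v r p) has_vector_derivative tension partial (v s) p) (at s)"
    and bdd: "\<And>s p. s \<in> {0..S} \<Longrightarrow> hcosh (v s p) (q p) \<le> K"
    and init: "\<And>p. hcosh (v 0 p) (q p) \<le> 1 + \<epsilon> + M * height p powr (-1/2)"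
    and M: "\<epsilon> \<ge> 0" "M \<ge> 0" and S: "S \<ge> 0"
  shows "hcosh (v S p) (q p) \<le> 1 + \<epsilon> + M * exp (- S / 4)"
proof -
  have key: "hcosh (v S p) (q p) \<le> 1 + \<epsilon> + M * exp (- S / 4) * height p powr (-1/2) + \<eta> * (exp (3 * S) * height p)"
    if \<eta>: "\<eta> > 0" for \<eta>
  proof -
    define W where "W s p = hcosh (v s p) (q p) + (- (M * exp (- s / 4))) * height p powr (-1/2)
      + (- (\<eta> * exp (3 * s))) * height p + - (1 + \<epsilon>)" for s p
    have cv: "continuous_on ({0..S} \<times> UNIV) (\<lambda>x. v (fst x) (snd x))"
      using continuous_on_subset[OF cont(1), of "{0..S} \<times> UNIV"] by (simp add: case_prod_beta subset_eq)
    have cq: "continuous_on ({0..S} \<times> UNIV) (\<lambda>x. q (snd x))"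
      by (rule continuous_on_compose2[OF cont(2)]) (auto intro!: continuous_intros)
    have ch: "continuous_on ({0..S} \<times> UNIV) (\<lambda>x. height (snd x))"
      unfolding height_def by (intro continuous_intros) auto
    have h0: "height q \<noteq> 0" for q using height_ge_1[of q] by simp
    have W1: "continuous_on ({0..S} \<times> UNIV) (\<lambda>(s, p). W s p)"
      unfolding W_def hcosh_def case_prod_beta
      by (intro continuous_intros cv cq ch) (auto simp: h0)
    \<comment> \<open>The radius is the bound of \<open>height_bounds_norm\<close> at the height |K|
      / \<eta>; beyond it the barrier exceeds K.\<close>
    have W2: "W s p < 0"
      if s: "s \<in> {0..S}" and p: "norm p > 2 * (\<bar>K\<bar> / \<eta>) + (2 * (\<bar>K\<bar> / \<eta>) * exp (2 * (\<bar>K\<bar> / \<eta>)) + 1)" for s p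
    proof -
      have "height p > \<bar>K\<bar> / \<eta>"
      proof (rule ccontr)
        assume "\<not> height p > \<bar>K\<bar> / \<eta>"
        then have le: "height p \<le> \<bar>K\<bar> / \<eta>" by simp
        then have "2 * height p * exp (2 * height p) \<le> 2 * (\<bar>K\<bar> / \<eta>) * exp (2 * (\<bar>K\<bar> / \<eta>))"
          using height_ge_1[of p] by (intro mult_mono) auto
        then show False using height_bounds_norm[of p] p le by linarith
      qed
      then have "K < \<eta> * height p" using \<eta> by (simp add: field_simps)
      also have "\<dots> \<le> \<eta> * exp (3 * s) * height p"
        using s \<eta> height_ge_1[of p] by (intro mult_right_mono) auto
      finally have "hcosh (v s p) (q p) < \<eta> * exp (3 * s) * height p" using bdd[OF s, of p] by simp
      moreover have "M * exp (- s / 4) * height p powr (-1/2) \<ge> 0" using M by simp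
      moreover have "W s p = hcosh (v s p) (q p) - M * exp (- s / 4) * height p powr (-1/2) - \<eta> * exp (3 * s) * height p - (1 + \<epsilon>)"
        unfolding W_def by simp
      ultimately show ?thesis using M by linarith
    qed
    have W3: "W 0 p \<le> 0" for p
    proof -
      have "\<eta> * height p \<ge> 0" using \<eta> height_ge_1[of p] by simp
      then show ?thesis using init[of p] unfolding W_def by simp
    qed
    have W4: "\<exists>d a1 a2 b1 b2. ((\<lambda>s. W s p) has_real_derivative d) (at s) \<and>
        line_deriv2 1 (W s) p a1 b1 \<and> line_deriv2 2 (W s) p a2 b2 \<and> d < exp (2 * p$2) * b1 + b2 - a2"
      if s: "0 < s" "s \<le> S" for s p
    proof -
      obtain a1 b1 a2 b2 where H: 
        "line_deriv2 1 (\<lambda>p. hcosh (v s p) (q p)) p a1 b1" "line_deriv2 2 (\<lambda>p. hcosh (v s p) (q p)) p a2 b2"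
        "hcosh_deriv (v s p) (q p) (tension partial (v s) p) 0 \<le> exp (2 * p$2) * b1 + b2 - a2"
        using hcosh_subsolution[OF C2(1)[OF s(1)] C2(2) harm] by blast
      obtain c1 d1 c2 d2 where G:
        "line_deriv2 1 (\<lambda>p. height p powr (-1/2)) p c1 d1" "line_deriv2 2 (\<lambda>p. height p powr (-1/2)) p c2 d2"
        "exp (2 * p$2) * d1 + d2 - c2 \<le> - (1/4) * height p powr (-1/2)"
        by (rule height_powr_supersolution)
      define m e where "m = M * exp (- s / 4)" and "e = \<eta> * exp (3 * s)"
      have me: "m \<ge> 0" "e > 0" using M \<eta> by (auto simp: m_def e_def)
      have const: "line_deriv2 i (\<lambda>p. c) p 0 0" for i c
        unfolding line_deriv2_def by (intro exI[of _ "\<lambda>r. 0"]) auto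
      \<comment> \<open>The barrier grows in time at rate 3, while its Laplacian is only twice the
        barrier; the surplus \<open>e * height p\<close> is the strictness that
        \<open>max_principle\<close> asks for.\<close>
      define d where "d = hcosh_deriv (v s p) (q p) (tension partial (v s) p) 0 + m / 4 * height p powr (-1/2) - 3 * e * height p"
      have "((\<lambda>s. W s p) has_real_derivative d) (at s)"
        unfolding W_def d_def m_def e_def
        by (rule derivative_eq_intros hcosh_has_derivative[OF flow[OF s(1)]] refl | simp)+
      moreover note line_deriv2_add[OF line_deriv2_add[OF line_deriv2_add[OF H(1) line_deriv2_cmult[OF G(1), of "- m"]]
          line_deriv2_cmult[OF line_deriv2_height(1)[of p], of "- e"]] const[of _ "- (1 + \<epsilon>)"]]
        line_deriv2_add[OF line_deriv2_add[OF line_deriv2_add[OF H(2) line_deriv2_cmult[OF G(2), of "- m"]]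
          line_deriv2_cmult[OF line_deriv2_height(2)[of p], of "- e"]] const[of _ "- (1 + \<epsilon>)"]]
      moreover have "d < exp (2 * p$2) * (b1 + - m * d1 + - e * exp (- p$2) + 0) + (b2 + - m * d2 + - e * height p + 0)
          - (a2 + - m * c2 + - e * (sinh (p$2) - exp (- p$2) * (p$1)\<^sup>2 / 2) + 0)" (is "_ < ?R")
      proof -
        have "?R = (exp (2 * p$2) * b1 + b2 - a2) - m * (exp (2 * p$2) * d1 + d2 - c2) - e * (2 * height p)"
          unfolding height_laplace[symmetric] by (simp add: algebra_simps)
        moreover have "m * (exp (2 * p$2) * d1 + d2 - c2) \<le> m * (- (1/4) * height p powr (-1/2))"
          using G(3) me by (intro mult_left_mono)
        moreover have "e * height p > 0" using me height_ge_1[of p] by simp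
        ultimately show ?thesis using H(3) unfolding d_def by simp
      qed
      ultimately show ?thesis unfolding W_def m_def e_def by (intro exI conjI)
    qed
    have "S \<in> {0..S}" using S by simp
    from max_principle[OF W1 W2 W3 W4 this] have "W S p \<le> 0" by this
    moreover have "W S p = hcosh (v S p) (q p) - M * exp (- S / 4) * height p powr (-1/2) - \<eta> * (exp (3 * S) * height p) - (1 + \<epsilon>)"
      unfolding W_def by simp
    ultimately show ?thesis by linarith
  qed
  have "hcosh (v S p) (q p) \<le> 1 + \<epsilon> + M * exp (- S / 4) * height p powr (-1/2)"
  proof (rule field_le_epsilon)
    fix e :: real assume "e > 0"
    then show "hcosh (v S p) (q p) \<le> 1 + \<epsilon> + M * exp (- S / 4) * height p powr (-1/2) + e"
      using key[of "e / (exp (3 * S) * height p)"] height_ge_1[of p] by (simp add: field_simps)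
  qed
  also have "\<dots> \<le> 1 + \<epsilon> + M * exp (- S / 4)"
  proof -
    have "height p powr (-1/2) \<le> 1 powr (-1/2)" using height_ge_1[of p] by (intro powr_mono2') auto
    then have "M * exp (- S / 4) * height p powr (-1/2) \<le> M * exp (- S / 4) * 1" using M by (intro mult_left_mono) auto
    then show ?thesis by simp
  qed
  finally show ?thesis .
qed

section \<open>A smooth step function\<close>

text \<open>Quantifying over a derivative function lets the closure properties go through by
  induction on k with explicit witnesses. At level 0 nothing is asked, as \<open>smooth1\<close>
  requires every level.\<close>

primrec Ck1 :: "nat \<Rightarrow> (real \<Rightarrow> real) \<Rightarrow> bool" where
  "Ck1 0 f \<longleftrightarrow> True"
| "Ck1 (Suc k) f \<longleftrightarrow> (\<exists>f'. (\<forall>x. (f has_real_derivative f' x) (at x)) \<and> Ck1 k f')"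

definition smooth1 :: "(real \<Rightarrow> real) \<Rightarrow> bool" where
  "smooth1 f \<longleftrightarrow> (\<forall>k. Ck1 k f)"

lemma Ck1_SucD: "Ck1 (Suc k) f \<Longrightarrow> Ck1 k f"
proof (induction k arbitrary: f)
  case (Suc k)
  then obtain f' where f': "\<forall>x. (f has_real_derivative f' x) (at x)" "Ck1 (Suc k) f'"
    by (auto simp only: Ck1.simps(2)[of "Suc k"])
  then show ?case using Suc.IH[OF f'(2)] by auto
qed simp

lemma Ck1_const: "Ck1 k (\<lambda>x. c)"
proof (induction k arbitrary: c)
  case (Suc k)
  then show ?case by (auto intro!: exI[of _ "\<lambda>x. 0"])
qed simp

lemma Ck1_add: "Ck1 k f \<Longrightarrow> Ck1 k g \<Longrightarrow> Ck1 k (\<lambda>x. f x + g x)"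
proof (induction k arbitrary: f g)
  case (Suc k)
  then obtain f' g' where "\<forall>x. (f has_real_derivative f' x) (at x)" "Ck1 k f'"
    "\<forall>x. (g has_real_derivative g' x) (at x)" "Ck1 k g'" by auto
  with Suc.IH show ?case by (auto intro!: exI[of _ "\<lambda>x. f' x + g' x"] DERIV_add)
qed simp

lemma Ck1_mult: "Ck1 k f \<Longrightarrow> Ck1 k g \<Longrightarrow> Ck1 k (\<lambda>x. f x * g x)"
proof (induction k arbitrary: f g)
  case (Suc k)
  then obtain f' g' where d: "\<And>x. (f has_real_derivative f' x) (at x)" "Ck1 k f'"
    "\<And>x. (g has_real_derivative g' x) (at x)" "Ck1 k g'" by auto
  have "Ck1 k (\<lambda>x. f' x * g x + g' x * f x)"
    using Suc.IH d Suc.prems Ck1_SucD by (intro Ck1_add) auto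
  then show ?case using d by (auto intro!: exI[of _ "\<lambda>x. f' x * g x + g' x * f x"] DERIV_mult)
qed simp

lemma Ck1_affine: "Ck1 k f \<Longrightarrow> Ck1 k (\<lambda>x. f (a * x + b))"
proof (induction k arbitrary: f)
  case (Suc k)
  then obtain f' where d: "\<And>x. (f has_real_derivative f' x) (at x)" "Ck1 k f'" by auto
  have "((\<lambda>x. f (a * x + b)) has_real_derivative a * f' (a * x + b)) (at x)" for x
  proof -
    have "((\<lambda>x. a * x + b) has_real_derivative a) (at x)" by (auto intro!: derivative_eq_intros)
    from DERIV_chain2[OF d(1) this] show ?thesis by (simp add: mult.commute)
  qed
  moreover have "Ck1 k (\<lambda>x. a * f' (a * x + b))" using Ck1_mult[OF Ck1_const Suc.IH[OF d(2)]] .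
  ultimately show ?case by (auto intro!: exI[of _ "\<lambda>x. a * f' (a * x + b)"])
qed simp

lemma Ck1_inverse: "Ck1 k f \<Longrightarrow> (\<And>x. f x \<noteq> 0) \<Longrightarrow> Ck1 k (\<lambda>x. inverse (f x))"
proof (induction k arbitrary: f)
  case (Suc k)
  then obtain f' where d: "\<And>x. (f has_real_derivative f' x) (at x)" "Ck1 k f'" by auto
  have "Ck1 k (\<lambda>x. (-1) * (f' x * (inverse (f x) * inverse (f x))))"
    using Suc d Ck1_SucD by (intro Ck1_mult Ck1_const Suc.IH) auto
  moreover have "((\<lambda>x. inverse (f x)) has_real_derivative (-1) * (f' x * (inverse (f x) * inverse (f x)))) (at x)" for x
    using Suc.prems d(1)[of x] by (auto intro!: derivative_eq_intros)
  ultimately show ?case unfolding Ck1.simps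
    by (intro exI[of _ "\<lambda>x. (-1) * (f' x * (inverse (f x) * inverse (f x)))"]) auto
qed simp

lemma smooth1_intros:
  "smooth1 (\<lambda>x. c)" "smooth1 f \<Longrightarrow> smooth1 g \<Longrightarrow> smooth1 (\<lambda>x. f x + g x)"
  "smooth1 f \<Longrightarrow> smooth1 g \<Longrightarrow> smooth1 (\<lambda>x. f x * g x)" "smooth1 f \<Longrightarrow> smooth1 (\<lambda>x. f (a * x + b))"
  "smooth1 f \<Longrightarrow> (\<And>x. f x \<noteq> 0) \<Longrightarrow> smooth1 (\<lambda>x. inverse (f x))"
  unfolding smooth1_def by (auto intro: Ck1_const Ck1_add Ck1_mult Ck1_affine Ck1_inverse)

lemma smooth1_deriv:
  assumes "smooth1 f"
  shows "(f has_real_derivative deriv f x) (at x)" and "smooth1 (deriv f)"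
proof -
  have *: "\<exists>f'. (\<forall>x. (f has_real_derivative f' x) (at x)) \<and> Ck1 k f'" for k
    using assms unfolding smooth1_def by (metis Ck1.simps(2))
  have eq: "(\<forall>x. (f has_real_derivative f' x) (at x)) \<Longrightarrow> f' = deriv f" for f'
    by (rule ext) (metis DERIV_imp_deriv)
  show "(f has_real_derivative deriv f x) (at x)" "smooth1 (deriv f)"
    using * eq unfolding smooth1_def by metis+
qed

text \<open>The powers of 1/x close the family under differentiation up to linear combinations, so
  smoothness of exp(-1/x), extended by 0, follows by an induction on k that runs over all n at
  once.\<close>

definition flat :: "nat \<Rightarrow> real \<Rightarrow> real" where
  "flat n x = (if x > 0 then (1/x)^n * exp (- (1/x)) else 0)"

lemma flat_tendsto_0: "(flat n \<longlongrightarrow> 0) (at 0)"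
proof (rule filterlim_split_at)
  show "(flat n \<longlongrightarrow> 0) (at_left 0)"
    by (rule tendsto_eventually) (auto simp: flat_def eventually_at_left_field intro!: exI[of _ "-1"])
  have "((\<lambda>x::real. (inverse x)^n / exp (inverse x)) \<longlongrightarrow> 0) (at_right 0)"
    by (rule filterlim_compose[OF tendsto_power_div_exp_0 filterlim_inverse_at_top_right])
  moreover have "\<forall>\<^sub>F x in at_right (0::real). (inverse x)^n / exp (inverse x) = flat n x"
    by (auto simp: flat_def eventually_at_right_field exp_minus divide_simps intro!: exI[of _ 1])
  ultimately show "(flat n \<longlongrightarrow> 0) (at_right 0)" by (rule Lim_transform_eventually)
qed

lemma flat_has_derivative: "(flat n has_real_derivative (flat (n + 2) x + (- real n) * flat (n + 1) x)) (at x)"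
proof -
  consider "x > 0" | "x < 0" | "x = 0" by linarith
  then show ?thesis
  proof cases
    case 1
    have "((\<lambda>x. (1/x)^n * exp (- (1/x))) has_real_derivative (flat (n + 2) x + (- real n) * flat (n + 1) x)) (at x)"
    proof (cases n)
      case 0
      then show ?thesis using 1 by (auto intro!: derivative_eq_intros simp: flat_def power2_eq_square field_simps)
    next
      case (Suc m)
      have "((\<lambda>x. 1/x) has_real_derivative - ((1/x)\<^sup>2)) (at x)"
        using 1 by (auto intro!: derivative_eq_intros simp: power2_eq_square)
      note [derivative_intros] = this
      have "((\<lambda>x. (1/x)^n * exp (- (1/x))) has_real_derivative
          real n * ((1/x)^m * - ((1/x)\<^sup>2)) * exp (- (1/x)) + exp (- (1/x)) * (1/x)\<^sup>2 * (1/x)^n) (at x)"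
        by (rule derivative_eq_intros refl | simp add: Suc)+
      moreover have "real n * (u^m * - u\<^sup>2) * e + e * u\<^sup>2 * u^n = u^(n + 2) * e + (- real n) * (u^(n + 1) * e)" for u e :: real
        by (simp add: Suc power2_eq_square algebra_simps)
      ultimately show ?thesis using 1 by (simp add: flat_def)
    qed
    then show ?thesis
      by (rule has_field_derivative_transform_within_open[where S="{0<..}"]) (use 1 in \<open>auto simp: flat_def\<close>)
  next
    case 2
    have "((\<lambda>x. 0) has_real_derivative (flat (n + 2) x + (- real n) * flat (n + 1) x)) (at x)"
      using 2 by (simp add: flat_def)
    then show ?thesis
      by (rule has_field_derivative_transform_within_open[where S="{..<0}"]) (use 2 in \<open>auto simp: flat_def\<close>)
  next
    \<comment> \<open>At 0 the difference quotient of \<open>flat n\<close> is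
      \<open>flat (n + 1)\<close> itself, on both sides of 0.\<close>
    case 3
    have "\<forall>\<^sub>F h in at (0::real). flat (n + 1) h = (flat n (0 + h) - flat n 0) / h"
      by (auto simp: flat_def eventually_at intro!: exI[of _ 1])
    then have "((\<lambda>h. (flat n (0 + h) - flat n 0) / h) \<longlongrightarrow> 0) (at 0)"
      using flat_tendsto_0 by (rule Lim_transform_eventually[rotated])
    then show ?thesis using 3 by (simp add: DERIV_def flat_def)
  qed
qed

lemma smooth1_flat: "smooth1 (flat n)"
proof -
  have "Ck1 k (flat n)" for k
  proof (induction k arbitrary: n)
    case (Suc k)
    have "Ck1 k (\<lambda>x. flat (n + 2) x + (- real n) * flat (n + 1) x)"
      using Suc.IH by (intro Ck1_add Ck1_mult Ck1_const)
    then show ?case unfolding Ck1.simps using flat_has_derivative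
      by (intro exI[of _ "\<lambda>x. flat (n + 2) x + (- real n) * flat (n + 1) x"]) auto
  qed simp
  then show ?thesis by (simp add: smooth1_def)
qed

text \<open>A smooth monotone transition from 0 to 1 over the unit interval. The reflected argument
  is written \<open>- 1 * x + 1\<close> to fit the affine substitution rule in
  \<open>smooth1_intros\<close>.\<close>

definition step :: "real \<Rightarrow> real" where
  "step x = flat 0 x * inverse (flat 0 x + flat 0 (- 1 * x + 1))"

lemma flat_0: "flat 0 x \<ge> 0" "x > 0 \<Longrightarrow> flat 0 x > 0" "x \<le> 0 \<Longrightarrow> flat 0 x = 0"
  by (simp_all add: flat_def)

lemma flat_0_mono: "x \<le> y \<Longrightarrow> flat 0 x \<le> flat 0 y"
  by (auto simp: flat_def frac_le)

lemma step_denom: "flat 0 x + flat 0 (- 1 * x + 1) > 0"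
  using flat_0(1)[of x] flat_0(1)[of "- 1 * x + 1"] flat_0(2)[of x] flat_0(2)[of "- 1 * x + 1"]
  by (cases "x > 0") auto

lemma smooth1_step: "smooth1 step"
  unfolding step_def using step_denom
  by (intro smooth1_intros smooth1_flat) (metis less_irrefl)

lemma step_eq: "x \<le> 0 \<Longrightarrow> step x = 0" "x \<ge> 1 \<Longrightarrow> step x = 1"
  using flat_0(2)[of x] by (auto simp: step_def flat_0(3))

lemma step_bounds: "0 \<le> step x" "step x \<le> 1"
  using step_denom[of x] flat_0(1)[of x] flat_0(1)[of "- 1 * x + 1"]
  by (auto simp: step_def field_simps)

lemma step_mono: "x \<le> y \<Longrightarrow> step x \<le> step y"
proof -
  assume "x \<le> y"
  then have "flat 0 x * flat 0 (- 1 * y + 1) \<le> flat 0 y * flat 0 (- 1 * x + 1)"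
    by (intro mult_mono flat_0_mono flat_0) auto
  then show ?thesis using step_denom[of x] step_denom[of y]
    by (simp add: step_def field_simps)
qed

lemma deriv_step_nonneg: "0 \<le> deriv step x"
  using mono_on_imp_deriv_nonneg[of UNIV step "deriv step x" x] smooth1_deriv(1)[OF smooth1_step] step_mono
  by (auto simp: mono_on_def)

lemma deriv_step_eq_0: "x \<le> 0 \<or> x \<ge> 1 \<Longrightarrow> deriv step x = 0"
  using DERIV_local_min[OF smooth1_deriv(1)[OF smooth1_step, of x], of 1]
    DERIV_local_max[OF smooth1_deriv(1)[OF smooth1_step, of x], of 1] step_bounds step_eq[of x] by auto

lemma continuous_deriv_step: "continuous_on A (deriv step)"
  using smooth1_deriv(1)[OF smooth1_deriv(2)[OF smooth1_step]] DERIV_isCont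
  by (intro continuous_at_imp_continuous_on) blast

lemma deriv_step_bounded: "\<exists>K\<ge>1. \<forall>x. deriv step x \<le> K"
proof -
  obtain K where K: "\<And>x. x \<in> {0..1} \<Longrightarrow> norm (deriv step x) \<le> K"
    using compact_imp_bounded[OF compact_continuous_image[OF continuous_deriv_step, of "{0..1}"]]
    unfolding bounded_iff by blast
  have "deriv step x \<le> max 1 K" for x
    using K[of x] deriv_step_eq_0[of x] by (cases "x \<in> {0..1}") auto
  then show ?thesis by (intro exI[of _ "max 1 K"]) auto
qed

text \<open>Some positive mass of the bump \<open>deriv step\<close> is all that
  \<open>delta_lower\<close> needs; the mean value theorem and continuity provide it without
  evaluating an integral.\<close>

lemma deriv_step_lower: "\<exists>a b. a < b \<and> (\<forall>x\<in>{a..b}. 1/2 \<le> deriv step x)"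
proof -
  obtain z where z: "step 1 - step 0 = (1 - 0) * deriv step z"
    using MVT2[of 0 1 step "deriv step"] smooth1_deriv(1)[OF smooth1_step] by auto
  then have "deriv step z = 1" by (simp add: step_eq)
  moreover have "isCont (deriv step) z" using continuous_deriv_step[of UNIV] by (simp add: continuous_on_eq_continuous_at)
  ultimately obtain d where d: "d > 0" "\<And>x. dist x z < d \<Longrightarrow> dist (deriv step x) 1 < 1/2"
    unfolding continuous_at_eps_delta by (metis half_gt_zero zero_less_one)
  have "\<forall>x\<in>{z..z + d/2}. 1/2 \<le> deriv step x"
  proof
    fix x assume "x \<in> {z..z + d/2}"
    then show "1/2 \<le> deriv step x" using d(2)[of x] d(1) by (auto simp: dist_real_def abs_if split: if_splits)
  qed
  moreover have "z < z + d/2" using d(1) by simp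
  ultimately show ?thesis by blast
qed

section \<open>Test functions in product form\<close>

lemma differentiable_nth_compose:
  fixes f :: "real \<Rightarrow> real"
  assumes "smooth1 f" shows "(\<lambda>p::real^2. f (p$i)) differentiable (at p)"
proof -
  have "f differentiable (at (p$i))"
    using smooth1_deriv(1)[OF assms] by (auto simp: real_differentiable_def)
  moreover have "(\<lambda>p::real^2. p$i) differentiable (at p)"
    by (intro bounded_linear_imp_differentiable bounded_linear_vec_nth)
  ultimately show ?thesis by (rule differentiable_compose)
qed

lemma partial_tensor:
  assumes "smooth1 f" "smooth1 g"
  shows "partial 1 (\<lambda>p. f (p$1) * g (p$2)) = (\<lambda>p. deriv f (p$1) * g (p$2))"
    and "partial 2 (\<lambda>p. f (p$1) * g (p$2)) = (\<lambda>p. f (p$1) * deriv g (p$2))"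
proof -
  have d: "((\<lambda>r. h (x + r)) has_real_derivative deriv h x) (at 0)" if "smooth1 h" for h x
    using DERIV_shift[of h "deriv h x" 0 x] smooth1_deriv(1)[OF that, of x] by (simp add: add.commute)
  show "partial 1 (\<lambda>p. f (p$1) * g (p$2)) = (\<lambda>p. deriv f (p$1) * g (p$2))"
    by (rule ext, rule partial_eqI, unfold vec2_nth_line, rule DERIV_cmult_right, rule d[OF assms(1)])
  show "partial 2 (\<lambda>p. f (p$1) * g (p$2)) = (\<lambda>p. f (p$1) * deriv g (p$2))"
    by (rule ext, rule partial_eqI, unfold vec2_nth_line, rule DERIV_cmult, rule d[OF assms(2)])
qed

text \<open>Partial derivatives of a product function are again product functions, so the induction
  runs over all f and g. Product functions are the only test functions that have to be
  constructed.\<close>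

lemma Ck_tensor:
  assumes "smooth1 f" "smooth1 g"
  shows "Ck k (\<lambda>p. f (p$1) * g (p$2))"
  using assms
proof (induction k arbitrary: f g)
  case 0
  have "isCont f x" "isCont g x" for x
    using smooth1_deriv(1)[OF 0(1)] smooth1_deriv(1)[OF 0(2)] DERIV_isCont by blast+
  then have "continuous_on UNIV f" "continuous_on UNIV g" by (auto intro: continuous_at_imp_continuous_on)
  then show ?case by (auto intro!: continuous_intros intro: continuous_on_compose2)
next
  case (Suc k)
  have "partial i (\<lambda>p. f (p$1) * g (p$2)) \<in> {\<lambda>p. deriv f (p$1) * g (p$2), \<lambda>p. f (p$1) * deriv g (p$2)}" for i
    using exhaust_2[of i] partial_tensor[OF Suc.prems] by auto
  moreover have "(\<lambda>p::real^2. f (p$1) * g (p$2)) differentiable_on UNIV"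
    using differentiable_nth_compose Suc.prems unfolding differentiable_on_def by (intro ballI differentiable_mult) auto
  ultimately show ?case
    using Suc.IH[OF smooth1_deriv(2)[OF Suc.prems(1)] Suc.prems(2)] Suc.IH[OF Suc.prems(1) smooth1_deriv(2)[OF Suc.prems(2)]]
    by (auto simp: ) (metis (no_types, lifting) insertE singletonD)
qed

lemma test_function_tensor:
  assumes "smooth1 f" "smooth1 g" and "\<And>x. x \<notin> {a..b} \<Longrightarrow> f x = 0" "\<And>x. x \<notin> {c..d} \<Longrightarrow> g x = 0"
  shows "test_function (\<lambda>p. f (p$1) * g (p$2))"
proof -
  have "{p::real^2. f (p$1) * g (p$2) \<noteq> 0} \<subseteq> cbox (vector [a, c]) (vector [b, d])"
    using assms(3,4) by (auto simp: mem_box_cart forall_2) force+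
  then have "closure {p::real^2. f (p$1) * g (p$2) \<noteq> 0} \<subseteq> cbox (vector [a, c]) (vector [b, d])"
    by (rule closure_minimal) (rule closed_cbox)
  then have "compact (closure {p::real^2. f (p$1) * g (p$2) \<noteq> 0})"
    unfolding compact_eq_bounded_closed using bounded_subset[OF bounded_cbox] closed_closure by blast
  then show ?thesis using Ck_tensor[OF assms(1,2)] by (simp add: test_function_def smooth_def)
qed

lemma integrable_mult_compact_support:
  assumes "locally_integrable f" "\<phi> \<in> borel_measurable borel" "compact K"
    and "\<And>p. \<bar>\<phi> p\<bar> \<le> B" "\<And>p. p \<notin> K \<Longrightarrow> \<phi> p = 0"
  shows "integrable lborel (\<lambda>p. f p * \<phi> p)"
proof (rule Bochner_Integration.integrable_bound)
  have int: "integrable lborel (\<lambda>p. indicator K p *\<^sub>R f p)"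
    using assms(1,3) by (simp add: locally_integrable_def set_integrable_def)
  then show "integrable lborel (\<lambda>p. B * (indicator K p *\<^sub>R f p))" by simp
  have "(\<lambda>p. f p * \<phi> p) = (\<lambda>p. (indicator K p *\<^sub>R f p) * \<phi> p)"
    using assms(5) by (force simp: indicator_def fun_eq_iff)
  moreover have "(\<lambda>p. (indicator K p *\<^sub>R f p) * \<phi> p) \<in> borel_measurable lborel"
    using int assms(2) by (intro borel_measurable_times) auto
  ultimately show "(\<lambda>p. f p * \<phi> p) \<in> borel_measurable lborel" by simp
  have "\<bar>f p * \<phi> p\<bar> \<le> \<bar>B * (indicator K p *\<^sub>R f p)\<bar>" for p
  proof (cases "p \<in> K")
    case True
    have "\<bar>f p\<bar> * \<bar>\<phi> p\<bar> \<le> \<bar>f p\<bar> * \<bar>B\<bar>" using assms(4)[of p] by (intro mult_left_mono) auto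
    with True show ?thesis by (simp add: abs_mult mult.commute)
  qed (simp add: assms(5))
  then show "AE p in lborel. norm (f p * \<phi> p) \<le> norm (B * (indicator K p *\<^sub>R f p))" by simp
qed

lemma integrable_mult_test_function:
  assumes f: "locally_integrable f" and t: "test_function \<phi>"
  shows "integrable lborel (\<lambda>p. f p * \<phi> p)"
proof -
  have c: "continuous_on UNIV \<phi>" using t by (auto simp: test_function_def smooth_def dest: spec[of _ 0])
  define K where "K = closure {p. \<phi> p \<noteq> 0}"
  have K: "compact K" using t by (simp add: K_def test_function_def)
  have out: "\<phi> p = 0" if "p \<notin> K" for p using that closure_subset[of "{p. \<phi> p \<noteq> 0}"] by (auto simp: K_def)
  obtain B where B: "\<And>p. p \<in> K \<Longrightarrow> \<bar>\<phi> p\<bar> \<le> B"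
    using compact_imp_bounded[OF compact_continuous_image[OF continuous_on_subset[OF c] K]] unfolding bounded_iff by auto
  have "\<bar>\<phi> p\<bar> \<le> max 0 B" for p using B[of p] out[of p] by (cases "p \<in> K") auto
  then show ?thesis
    using c by (intro integrable_mult_compact_support[OF f _ K _ out]) (auto intro: borel_measurable_continuous_onI)
qed

lemma locally_integrable_measurable:
  assumes "locally_integrable f" shows "f \<in> borel_measurable borel"
proof (rule borel_measurable_LIMSEQ_real)
  show "(\<lambda>n. indicator (cball 0 (real n)) p *\<^sub>R f p) \<longlonglongrightarrow> f p" for p
  proof (rule tendsto_eventually)
    obtain N where "norm p \<le> real N" using real_arch_simple by blast
    then show "\<forall>\<^sub>F n in sequentially. indicator (cball 0 (real n)) p *\<^sub>R f p = f p"
      unfolding eventually_sequentially by (intro exI[of _ N]) (auto simp: indicator_def)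
  qed
  show "(\<lambda>p. indicator (cball 0 (real n)) p *\<^sub>R f p) \<in> borel_measurable borel" for n
  proof -
    have "integrable lborel (\<lambda>p. indicator (cball 0 (real n)) p *\<^sub>R f p)"
      using assms compact_cball unfolding locally_integrable_def set_integrable_def by blast
    from borel_measurable_integrable[OF this] show ?thesis by simp
  qed
qed

section \<open>Uniqueness of weak derivatives\<close>

text \<open>The indicator of an open box is the pointwise limit of products of smooth plateau
  functions supported in the closed box, with values of modulus at most 1, so dominated convergence
  applies.\<close>

lemma box_integral_eq_0:
  fixes l u :: "real^2"
  assumes f: "locally_integrable f" and 0: "\<And>\<phi>. test_function \<phi> \<Longrightarrow> (\<integral>p. f p * \<phi> p \<partial>lborel) = 0"
  shows "(\<integral>p. f p * indicator (box l u) p \<partial>lborel) = 0"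
proof (cases "box l u = {}")
  case False
  then have lu: "l$1 < u$1" "l$2 < u$2" by (auto simp: interval_ne_empty_cart)
  \<comment> \<open>The ramps of the plateau have width 1 / r n. The added constant makes this at
    most each side length already for n = 0, without which \<psi> would not vanish outside the
    box.\<close>
  define r where "r n = real n + (1 / (u$1 - l$1) + 1 / (u$2 - l$2))" for n :: nat
  have r: "r n > 0" for n using lu by (simp add: r_def add_nonneg_pos)
  have rl: "r n * (u$i - l$i) \<ge> 1" for n i
  proof -
    have "r n \<ge> 1 / (u$i - l$i)" using exhaust_2[of i] lu by (auto simp: r_def)
    then show ?thesis using lu exhaust_2[of i] by (auto simp: field_simps)
  qed
  define \<psi> where "\<psi> i n x = step (r n * x + (- (r n * l$i))) + (-1) * step (r n * x + (1 - r n * u$i))" for i n x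
  have sm: "smooth1 (\<psi> i n)" for i n
    unfolding \<psi>_def by (intro smooth1_intros smooth1_step)
  have supp': "\<psi> i n x = 0" if "x \<le> l$i \<or> x \<ge> u$i" for i n x
  proof -
    have "r n * x \<le> r n * l$i \<or> r n * x \<ge> r n * u$i" using that r[of n] by auto
    then show ?thesis using rl[of n i] by (auto simp: \<psi>_def step_eq right_diff_distrib)
  qed
  then have supp: "\<psi> i n x = 0" if "x \<notin> {l$i..u$i}" for i n x using that by fastforce
  have bd: "\<bar>\<psi> i n x\<bar> \<le> 1" for i n x
    using step_bounds[of "r n * x + (- (r n * l$i))"] step_bounds[of "r n * x + (1 - r n * u$i)"]
    by (simp add: \<psi>_def abs_le_iff)
  have rinf: "filterlim (\<lambda>n. r n) at_top sequentially"
    unfolding r_def by (intro filterlim_tendsto_add_at_top[OF tendsto_const] filterlim_real_sequentially | subst add.commute)+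
  have ev: "\<forall>\<^sub>F n in sequentially. r n * c \<ge> 1" if "c > 0" for c
  proof -
    have "\<forall>\<^sub>F n in sequentially. r n \<ge> 1 / c" using rinf by (simp add: filterlim_at_top)
    then show ?thesis by eventually_elim (use that in \<open>simp add: field_simps\<close>)
  qed
  have lim: "(\<lambda>n. \<psi> i n x) \<longlonglongrightarrow> indicator {l$i<..<u$i} x" for i x
  proof -
    have "\<forall>\<^sub>F n in sequentially. \<psi> i n x = indicator {l$i<..<u$i} x"
    proof (cases "x \<le> l$i \<or> x \<ge> u$i")
      case True
      then show ?thesis using supp' by auto
    next
      case False
      then have "\<forall>\<^sub>F n in sequentially. r n * (x - l$i) \<ge> 1" "\<forall>\<^sub>F n in sequentially. r n * (u$i - x) \<ge> 1"
        by (auto intro: ev)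
      then show ?thesis
        by eventually_elim (use False in \<open>simp add: \<psi>_def step_eq right_diff_distrib\<close>)
    qed
    then show ?thesis by (rule tendsto_eventually)
  qed
  have ind: "indicator (box l u) p = indicator {l$1<..<u$1} (p$1) * (indicator {l$2<..<u$2} (p$2) :: real)" for p
    by (auto simp: indicator_def mem_box_cart forall_2)
  have meas: "(\<lambda>p::real^2. \<psi> 1 n (p$1) * \<psi> 2 n (p$2)) \<in> borel_measurable borel" for n
    using Ck_tensor[OF sm sm, of 0 1 n 2 n] by (intro borel_measurable_continuous_onI) simp
  have K: "compact (cbox l u)" by (rule compact_cbox)
  have fm: "f \<in> borel_measurable borel" using f by (rule locally_integrable_measurable)
  have "(\<lambda>n. \<integral>p. f p * (\<psi> 1 n (p$1) * \<psi> 2 n (p$2)) \<partial>lborel) \<longlonglongrightarrow> (\<integral>p. f p * indicator (box l u) p \<partial>lborel)"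
  proof (rule integral_dominated_convergence)
    show "integrable lborel (\<lambda>p. \<bar>indicator (cbox l u) p *\<^sub>R f p\<bar>)"
      using f K by (intro integrable_abs) (simp add: locally_integrable_def set_integrable_def)
    show "AE p in lborel. (\<lambda>n. f p * (\<psi> 1 n (p$1) * \<psi> 2 n (p$2))) \<longlonglongrightarrow> f p * indicator (box l u) p"
      unfolding ind by (intro AE_I2 tendsto_intros lim)
    show "AE p in lborel. norm (f p * (\<psi> 1 n (p$1) * \<psi> 2 n (p$2))) \<le> \<bar>indicator (cbox l u) p *\<^sub>R f p\<bar>" for n
    proof (rule AE_I2)
      fix p :: "real^2"
      have "\<bar>\<psi> 1 n (p$1)\<bar> * \<bar>\<psi> 2 n (p$2)\<bar> \<le> 1 * 1" by (intro mult_mono bd) auto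
      then have "\<bar>f p\<bar> * (\<bar>\<psi> 1 n (p$1)\<bar> * \<bar>\<psi> 2 n (p$2)\<bar>) \<le> \<bar>f p\<bar> * 1" by (intro mult_left_mono) auto
      then show "norm (f p * (\<psi> 1 n (p$1) * \<psi> 2 n (p$2))) \<le> \<bar>indicator (cbox l u) p *\<^sub>R f p\<bar>"
        using supp[of "p$1" 1 n] supp[of "p$2" 2 n]
        by (cases "p \<in> cbox l u") (auto simp: mem_box_cart forall_2 abs_mult)
    qed
  qed (use fm meas in \<open>auto intro!: borel_measurable_times\<close>)
  moreover have "(\<integral>p. f p * (\<psi> 1 n (p$1) * \<psi> 2 n (p$2)) \<partial>lborel) = 0" for n
    by (rule 0, rule test_function_tensor[OF sm sm supp supp])
  ultimately have "(\<lambda>n::nat. 0) \<longlonglongrightarrow> (\<integral>p. f p * indicator (box l u) p \<partial>lborel)" by simp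
  then show ?thesis by (simp add: LIMSEQ_const_iff)
qed simp

text \<open>On a bounded box let \<open>P 1\<close> and \<open>P (-1)\<close> have the positive and
  the negative part of f as densities. They are finite on boxes and agree there by
  \<open>box_integral_eq_0\<close>; open boxes are stable under intersection and generate the Borel
  sets, so the measures coincide, the two parts agree almost everywhere, and both vanish.\<close>

lemma AE_eq_0_if_weakly_0:
  assumes f: "locally_integrable f" and 0: "\<And>\<phi>. test_function \<phi> \<Longrightarrow> (\<integral>p. f p * \<phi> p \<partial>lborel) = 0"
  shows "AE p in lborel. f p = 0"
proof -
  have fm [measurable]: "f \<in> borel_measurable borel" using f by (rule locally_integrable_measurable)
  let ?A = "\<lambda>n::nat. box (- (real n *\<^sub>R One)) (real n *\<^sub>R One) :: (real^2) set"
  have "AE p in lborel. f p * indicator (?A n) p = 0" for n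
  proof -
    define g where "g p = f p * indicator (?A n) p" for p
    have [measurable]: "g \<in> borel_measurable borel" unfolding g_def by measurable
    have gi: "integrable lborel g"
      unfolding g_def by (rule integrable_mult_compact_support[OF f _ compact_cbox[of "- (real n *\<^sub>R One)" "real n *\<^sub>R One"], of _ 1])
        (use box_subset_cbox in \<open>auto simp: indicator_def\<close>)
    have i: "integrable lborel (\<lambda>p. max 0 (s * g p) * indicator (box l u) p)" for s l u
    proof -
      have "integrable lborel (\<lambda>p. max 0 (s * g p))" using gi by (intro Bochner_Integration.integrable_max) auto
      then show ?thesis by (rule integrable_real_mult_indicator[rotated]) auto
    qed
    define P where "P s = density lborel (\<lambda>p. ennreal (max 0 (s * g p)))" for s :: real
    have P: "emeasure (P s) (box l u) = ennreal (\<integral>p. max 0 (s * g p) * indicator (box l u) p \<partial>lborel)" for s l u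
    proof -
      have "emeasure (P s) (box l u) = (\<integral>\<^sup>+p. ennreal (max 0 (s * g p)) * indicator (box l u) p \<partial>lborel)"
        unfolding P_def by (rule emeasure_density) auto
      also have "\<dots> = (\<integral>\<^sup>+p. ennreal (max 0 (s * g p) * indicator (box l u) p) \<partial>lborel)"
        by (intro nn_integral_cong) (auto simp: indicator_def)
      also have "\<dots> = ennreal (\<integral>p. max 0 (s * g p) * indicator (box l u) p \<partial>lborel)"
        by (rule nn_integral_eq_integral[OF i]) auto
      finally show ?thesis .
    qed
    have eq: "emeasure (P 1) (box l u) = emeasure (P (-1)) (box l u)" for l u
    proof -
      obtain l' u' where box: "?A n \<inter> box l u = box l' u'" unfolding box_Int_box by blast
      have "(\<integral>p. max 0 (1 * g p) * indicator (box l u) p \<partial>lborel) - (\<integral>p. max 0 ((-1) * g p) * indicator (box l u) p \<partial>lborel)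
        = (\<integral>p. max 0 (1 * g p) * indicator (box l u) p - max 0 ((-1) * g p) * indicator (box l u) p \<partial>lborel)"
        using Bochner_Integration.integral_diff[OF i[of 1] i[of "-1"]] by simp
      also have "\<dots> = (\<integral>p. f p * indicator (box l' u') p \<partial>lborel)"
        unfolding box[symmetric] by (intro Bochner_Integration.integral_cong) (auto simp: g_def indicator_def max_def)
      also have "\<dots> = 0" using box_integral_eq_0[OF f 0] .
      finally show ?thesis unfolding P by simp
    qed
    have "P 1 = P (-1)"
    proof (rule measure_eqI_generator_eq)
      let ?E = "range (\<lambda>(a, b). box a b::(real^2) set)"
      show "Int_stable ?E"
        by (auto simp: Int_stable_def box_Int_box)
      show "?E \<subseteq> Pow UNIV" "sets (P 1) = sigma_sets UNIV ?E" "sets (P (-1)) = sigma_sets UNIV ?E"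
        by (simp_all add: borel_eq_box P_def)
      show "range ?A \<subseteq> ?E" "(\<Union>i. ?A i) = UNIV"
        unfolding UN_box_eq_UNIV by auto
      show "emeasure (P 1) (?A i) \<noteq> \<infinity>" for i by (simp add: P)
      show "emeasure (P 1) X = emeasure (P (-1)) X" if "X \<in> ?E" for X using that eq by auto
    qed
    then have "AE p in lborel. ennreal (max 0 (1 * g p)) = ennreal (max 0 ((-1) * g p))"
      unfolding P_def by (subst (asm) sigma_finite_measure.density_unique_iff[OF sigma_finite_lborel]) auto
    then show ?thesis by (rule AE_mp) (auto simp: g_def[symmetric] max_def split: if_splits)
  qed
  then have "AE p in lborel. \<forall>n. f p * indicator (?A n) p = 0" unfolding AE_all_countable by blast
  then show ?thesis
  proof (rule AE_mp, intro AE_I2 impI)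
    fix p assume *: "\<forall>n. f p * indicator (?A n) p = 0"
    obtain n where "p \<in> ?A n" using UN_box_eq_UNIV by blast
    then show "f p = 0" using *[rule_format, of n] by simp
  qed
qed

text \<open>As \<open>weak_partial\<close> is an arbitrary choice, this is what makes it computable
  at all: any weak derivative found by hand agrees with it up to a null set.\<close>

lemma weak_partial_unique:
  assumes "is_weak_partial i f g" "is_weak_partial i f h"
  shows "AE p in lborel. g p = h p"
proof -
  have gh: "locally_integrable g" "locally_integrable h" using assms by (auto simp: is_weak_partial_def)
  have "AE p in lborel. g p - h p = 0"
  proof (rule AE_eq_0_if_weakly_0)
    show "locally_integrable (\<lambda>p. g p - h p)"
      using gh by (auto simp: locally_integrable_def set_integrable_def right_diff_distrib)
    fix \<phi> assume t: "test_function \<phi>"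
    show "(\<integral>p. (g p - h p) * \<phi> p \<partial>lborel) = 0"
      using assms t integrable_mult_test_function[OF gh(1) t] integrable_mult_test_function[OF gh(2) t]
      by (simp add: left_diff_distrib is_weak_partial_def)
  qed
  then show ?thesis by simp
qed

section \<open>Sobolev embedding\<close>

lemma lists_length_2:
  "{I::2 list. length I = 0} = {[]}" "{I::2 list. length I = Suc 0} = {[1], [2]}"
  "{I::2 list. length I = 2} = {[1,1], [1,2], [2,1], [2,2]}"
proof -
  show "{I::2 list. length I = 0} = {[]}" by auto
  show "{I::2 list. length I = Suc 0} = {[1], [2]}" using exhaust_2 by (auto simp: length_Suc_conv)
  show "{I::2 list. length I = 2} = {[1,1], [1,2], [2,1], [2,2]}"
    using exhaust_2 by (auto simp: length_Suc_conv numeral_2_eq_2)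
qed

lemma nabla_2: "nabla D 2 f [i, j] p = D i (D j f) p - (\<Sum>k\<in>UNIV. christoffel p k i j * D k f p)"
  by (simp add: numeral_2_eq_2)

lemma nabla_normsq_0: "nabla_normsq 0 f p = (f p)\<^sup>2"
  by (simp add: nabla_normsq_def tensor_inner_def lists_length_2 power2_eq_square)

lemma nabla_normsq_1: "nabla_normsq 1 f p = exp (2 * p$2) * (weak_partial 1 f p)\<^sup>2 + (weak_partial 2 f p)\<^sup>2"
  by (simp add: nabla_normsq_def tensor_inner_def lists_length_2 power2_eq_square)

lemma nabla_normsq_2:
  "nabla_normsq 2 f p = exp (2 * p$2) * exp (2 * p$2) * (nabla weak_partial 2 f [1, 1] p)\<^sup>2
    + exp (2 * p$2) * (nabla weak_partial 2 f [1, 2] p)\<^sup>2 + exp (2 * p$2) * (nabla weak_partial 2 f [2, 1] p)\<^sup>2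
    + (nabla weak_partial 2 f [2, 2] p)\<^sup>2"
proof -
  have "{..<2::nat} = {0, 1}" by auto
  then show ?thesis
    unfolding nabla_normsq_def tensor_inner_def lists_length_2 by (simp add: power2_eq_square)
qed

lemma prod_met_inv:
  assumes "length I = l" "length K = l"
  shows "(\<Prod>a<l. met_inv p (I ! a) (K ! a)) = (if I = K then \<Prod>a<l. met_inv p (I ! a) (I ! a) else 0)"
proof (cases "I = K")
  case False
  then obtain a where "a < l" "I ! a \<noteq> K ! a" using assms nth_equalityI by metis
  then have "met_inv p (I ! a) (K ! a) = 0" by (simp add: met_inv_def)
  then show ?thesis using False \<open>a < l\<close> by auto
qed simp

text \<open>The inverse metric is diagonal, so the double sum over index lists collapses to squares
  with nonnegative weights.\<close>

lemma nabla_normsq_nonneg: "0 \<le> nabla_normsq l f p"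
proof -
  define S where "S I = nabla weak_partial l f I p" for I
  have fin: "finite {I::2 list. length I = l}" using finite_lists_length_eq[of "UNIV :: 2 set" l] by simp
  define P where "P I = (\<Prod>a<l. met_inv p (I ! a) (I ! a))" for I :: "2 list"
  have "nabla_normsq l f p = (\<Sum>I\<in>{I. length I = l}. P I * (S I)\<^sup>2)"
    unfolding nabla_normsq_def tensor_inner_def S_def[symmetric]
  proof (rule sum.cong[OF refl])
    fix I :: "2 list" assume I: "I \<in> {I. length I = l}"
    have "(\<Sum>K\<in>{K. length K = l}. (\<Prod>a<l. met_inv p (I ! a) (K ! a)) * S I * S K)
        = (\<Sum>K\<in>{K. length K = l}. if I = K then P I * (S I)\<^sup>2 else 0)"
      by (rule sum.cong[OF refl], subst prod_met_inv[of _ l]) (use I in \<open>auto simp: P_def power2_eq_square\<close>)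
    also have "\<dots> = P I * (S I)\<^sup>2" by (subst sum.delta'[OF fin]) (use I in simp)
    finally show "(\<Sum>K\<in>{K. length K = l}. (\<Prod>a<l. met_inv p (I ! a) (K ! a)) * S I * S K) = P I * (S I)\<^sup>2" .
  qed
  also have "\<dots> \<ge> 0" by (intro sum_nonneg mult_nonneg_nonneg prod_nonneg) (auto simp: P_def met_inv_def intro!: prod_nonneg)
  finally show ?thesis .
qed

section \<open>Bumps, their primitives, and pairings with product test functions\<close>

definition dstep :: "real \<Rightarrow> real \<Rightarrow> real \<Rightarrow> real" where
  "dstep c r x = deriv step ((x - c) / r) / r"

text \<open>The primitive of \<open>dstep c r\<close>, a bump of integral 1 on [c, c + r]. Since all
  bumps have the same integral, the difference of two of them is the derivative of a compactly
  supported function; this is how averages over different boxes are compared through weak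
  derivatives.\<close>

definition bstep :: "real \<Rightarrow> real \<Rightarrow> real \<Rightarrow> real" where
  "bstep c r x = step ((x - c) / r)"

definition step_const :: real where
  "step_const = (SOME K. K \<ge> 1 \<and> (\<forall>x. deriv step x \<le> K))"

lemma step_const: "step_const \<ge> 1" "deriv step x \<le> step_const"
  using someI_ex[OF deriv_step_bounded] unfolding step_const_def by auto

lemma smooth1_bstep: "smooth1 (bstep c r)"
proof -
  have "bstep c r = (\<lambda>x. step ((1 / r) * x + (- c / r)))" by (simp add: bstep_def fun_eq_iff diff_divide_distrib)
  then show ?thesis using smooth1_intros(4)[OF smooth1_step] by (simp only:)
qed

lemma deriv_bstep: "deriv (bstep c r) = dstep c r"
proof
  fix x
  have "((\<lambda>x. (x - c) / r) has_real_derivative 1 / r) (at x)"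
    by (rule DERIV_cdivide) (auto intro!: derivative_eq_intros)
  from DERIV_chain2[OF smooth1_deriv(1)[OF smooth1_step] this] show "deriv (bstep c r) x = dstep c r x"
    unfolding bstep_def dstep_def by (intro DERIV_imp_deriv) simp
qed

lemma smooth1_dstep: "smooth1 (dstep c r)"
  using smooth1_deriv(2)[OF smooth1_bstep] by (simp add: deriv_bstep)

lemma dstep_bounds: "r > 0 \<Longrightarrow> 0 \<le> dstep c r x" "r > 0 \<Longrightarrow> dstep c r x \<le> step_const / r"
  using step_const(2) deriv_step_nonneg by (auto simp: dstep_def intro: divide_right_mono)

lemma dstep_support: "r > 0 \<Longrightarrow> x \<notin> {c..c + r} \<Longrightarrow> dstep c r x = 0"
  using deriv_step_eq_0[of "(x - c) / r"] by (auto simp: dstep_def field_simps not_le)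

lemma bstep_bounds: "0 \<le> bstep c r x" "bstep c r x \<le> 1"
  using step_bounds by (auto simp: bstep_def)

lemma bstep_eq: "r > 0 \<Longrightarrow> x \<le> c \<Longrightarrow> bstep c r x = 0" "r > 0 \<Longrightarrow> x \<ge> c + r \<Longrightarrow> bstep c r x = 1"
  by (auto simp: bstep_def step_eq field_simps)

lemma smooth1_diff: "smooth1 f \<Longrightarrow> smooth1 g \<Longrightarrow> smooth1 (\<lambda>x. f x - g x)"
  using smooth1_intros(2)[OF _ smooth1_intros(3)[OF smooth1_intros(1)[of "-1"]], of f g] by simp

lemma deriv_diff_bstep: "deriv (\<lambda>x. bstep c r x - bstep d s x) = (\<lambda>x. dstep c r x - dstep d s x)"
  using smooth1_deriv(1)[OF smooth1_bstep] deriv_bstep by (intro ext DERIV_imp_deriv DERIV_diff) metis+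

abbreviation tensor :: "(real \<Rightarrow> real) \<Rightarrow> (real \<Rightarrow> real) \<Rightarrow> real^2 \<Rightarrow> real" where
  "tensor a b \<equiv> \<lambda>p. a (p$1) * b (p$2)"

abbreviation pairing :: "(real^2 \<Rightarrow> real) \<Rightarrow> (real \<Rightarrow> real) \<Rightarrow> (real \<Rightarrow> real) \<Rightarrow> real" where
  "pairing f a b \<equiv> \<integral>p. f p * tensor a b p \<partial>lborel"

definition supported :: "(real \<Rightarrow> real) \<Rightarrow> real \<Rightarrow> real \<Rightarrow> bool" where
  "supported a l u \<longleftrightarrow> smooth1 a \<and> (\<forall>x. x \<notin> {l..u} \<longrightarrow> a x = 0)"

lemma integrable_tensor:
  assumes "locally_integrable f" "supported a l u" "supported b l' u'"
  shows "integrable lborel (\<lambda>p. f p * tensor a b p)"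
proof -
  define K where "K = cbox (vector [l, l']) (vector [u, u'] :: real^2)"
  have K: "compact K" unfolding K_def by (rule compact_cbox)
  have out: "tensor a b p = 0" if "p \<notin> K" for p
    using that assms(2,3) by (auto simp: K_def mem_box_cart forall_2 supported_def)
  have c: "continuous_on UNIV (tensor a b)"
    using Ck_tensor[of a b 0] assms(2,3) by (simp add: supported_def)
  obtain B where B: "\<And>p. p \<in> K \<Longrightarrow> \<bar>tensor a b p\<bar> \<le> B"
    using compact_imp_bounded[OF compact_continuous_image[OF continuous_on_subset[OF c] K]] unfolding bounded_iff by auto
  have "\<bar>tensor a b p\<bar> \<le> max 0 B" for p using B[of p] out[of p] by (cases "p \<in> K") auto
  then show ?thesis
    using c by (intro integrable_mult_compact_support[OF assms(1) _ K _ out] borel_measurable_continuous_onI) auto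
qed

lemma weak_partial_tensor:
  assumes "supported a l u" "supported b l' u'"
  shows "is_weak_partial 1 f g \<Longrightarrow> pairing f (deriv a) b = - pairing g a b"
    and "is_weak_partial 2 f g \<Longrightarrow> pairing f a (deriv b) = - pairing g a b"
proof -
  have "test_function (tensor a b)"
    using assms unfolding supported_def by (intro test_function_tensor) auto
  then show "is_weak_partial 1 f g \<Longrightarrow> pairing f (deriv a) b = - pairing g a b"
    "is_weak_partial 2 f g \<Longrightarrow> pairing f a (deriv b) = - pairing g a b"
    using assms partial_tensor[of a b] by (auto simp: is_weak_partial_def supported_def)
qed

lemma supported_dstep: "r > 0 \<Longrightarrow> c + r \<le> u \<Longrightarrow> supported (dstep c r) c u"
  using dstep_support by (auto simp: supported_def smooth1_dstep)

lemma supported_bstep_diff: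
  "\<lbrakk>r > 0; s > 0; c \<le> d; c + r \<le> u; d + s \<le> u\<rbrakk> \<Longrightarrow> supported (\<lambda>x. bstep c r x - bstep d s x) c u"
  using bstep_eq by (auto simp: supported_def smooth1_diff smooth1_bstep not_le)

lemma supported_diff:
  "supported a l u \<Longrightarrow> supported b l u \<Longrightarrow> supported (\<lambda>x. a x - b x) l u"
  by (auto simp: supported_def smooth1_diff)

text \<open>Pointwise st \<le> (\<mu> s^2 + t^2 / \<mu>) / 2, where s carries sqrt N and half of the
  density exp(-x2) of \<open>hvol\<close>, and t carries the kernel \<kappa> and the inverse factor.
  Keeping \<mu> free replaces Cauchy--Schwarz for integrals.\<close>

lemma energy_bound:
  fixes g N \<kappa> :: "real^2 \<Rightarrow> real"
  assumes g: "integrable lborel g" and N: "integrable hvol N" "\<And>q. N q \<ge> 0" and B: "B \<in> sets borel"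
    and \<kappa>: "integrable lborel (\<lambda>q. indicator B q * ((\<kappa> q)\<^sup>2 * exp (q$2)))"
      "(\<integral>q. indicator B q * ((\<kappa> q)\<^sup>2 * exp (q$2)) \<partial>lborel) \<le> V"
    and le: "\<And>q. \<bar>g q\<bar> \<le> indicator B q * (\<kappa> q * sqrt (N q))"
    and E: "(\<integral>q. indicator B q * N q \<partial>hvol) \<le> E" and \<mu>: "\<mu> > 0"
  shows "\<bar>\<integral>q. g q \<partial>lborel\<bar> \<le> (\<mu> * E + V / \<mu>) / 2"
proof -
  have sets: "sets hvol = sets borel" by (simp add: hvol_def)
  have BN: "integrable hvol (\<lambda>q. indicator B q * N q)"
    using integrable_real_mult_indicator[of B hvol N] N(1) B sets by (simp add: mult.commute)
  then have m: "(\<lambda>q. indicator B q * N q) \<in> borel_measurable borel"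
    using borel_measurable_integrable measurable_cong_sets[OF sets refl] by blast
  have em: "(\<lambda>q::real^2. exp (- q$2)) \<in> borel_measurable borel"
    by (intro borel_measurable_continuous_onI continuous_intros)
  have BN': "integrable lborel (\<lambda>q. exp (- q$2) * (indicator B q * N q))"
    using BN m em unfolding hvol_def by (subst (asm) integrable_density) auto
  have eq: "(\<integral>q. indicator B q * N q \<partial>hvol) = (\<integral>q. exp (- q$2) * (indicator B q * N q) \<partial>lborel)"
    using m em unfolding hvol_def by (subst integral_density) auto
  have pw: "\<bar>g q\<bar> \<le> (\<mu> / 2) * (exp (- q$2) * (indicator B q * N q)) + (1 / (2 * \<mu>)) * (indicator B q * ((\<kappa> q)\<^sup>2 * exp (q$2)))" for q
  proof (cases "q \<in> B")
    case True
    define s t where "s = sqrt (N q) * exp (- q$2 / 2)" and "t = \<kappa> q * exp (q$2 / 2)"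
    have st: "s * t = \<kappa> q * sqrt (N q)" by (simp add: s_def t_def flip: exp_add)
    have s2: "s\<^sup>2 = exp (- q$2) * N q" using N(2)[of q] by (simp add: s_def power_mult_distrib flip: exp_double)
    have t2: "t\<^sup>2 = (\<kappa> q)\<^sup>2 * exp (q$2)" by (simp add: t_def power_mult_distrib flip: exp_double)
    have "0 \<le> (\<mu> * s - t)\<^sup>2 / (2 * \<mu>)" using \<mu> by simp
    also have "\<dots> = (\<mu> / 2) * s\<^sup>2 + (1 / (2 * \<mu>)) * t\<^sup>2 - s * t"
      using \<mu> by (simp add: power2_eq_square field_simps)
    finally show ?thesis using le[of q] True st s2 t2 by simp
  qed (use le[of q] in simp)
  have "\<bar>\<integral>q. g q \<partial>lborel\<bar> \<le> (\<integral>q. \<bar>g q\<bar> \<partial>lborel)" by (rule integral_abs_bound)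
  also have "\<dots> \<le> (\<integral>q. (\<mu> / 2) * (exp (- q$2) * (indicator B q * N q)) + (1 / (2 * \<mu>)) * (indicator B q * ((\<kappa> q)\<^sup>2 * exp (q$2))) \<partial>lborel)"
    using g BN' \<kappa>(1) pw by (intro integral_mono integrable_abs Bochner_Integration.integrable_add integrable_mult_right) auto
  also have "\<dots> = (\<mu> / 2) * (\<integral>q. exp (- q$2) * (indicator B q * N q) \<partial>lborel) + (1 / (2 * \<mu>)) * (\<integral>q. indicator B q * ((\<kappa> q)\<^sup>2 * exp (q$2)) \<partial>lborel)"
    using BN' \<kappa>(1) by (subst Bochner_Integration.integral_add) auto
  also have "\<dots> \<le> (\<mu> / 2) * E + (1 / (2 * \<mu>)) * V"
    using \<mu> \<kappa>(2) E eq by (intro add_mono mult_left_mono) auto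
  finally show ?thesis using \<mu> by (simp add: field_simps)
qed

lemma measure_box_cart:
  "a \<le> b \<Longrightarrow> c \<le> d \<Longrightarrow> measure lborel (cbox (vector [a, c]) (vector [b, d] :: real^2)) = (b - a) * (d - c)"
proof -
  assume "a \<le> b" "c \<le> d"
  then have "cbox (vector [a, c]) (vector [b, d] :: real^2) \<noteq> {}" by (auto simp: interval_ne_empty_cart forall_2)
  then show ?thesis by (simp add: content_cbox_cart UNIV_2)
qed

lemma box_integral_le:
  fixes g :: "real^2 \<Rightarrow> real"
  assumes "continuous_on UNIV g" "a \<le> b" "c \<le> d"
    and "\<And>q. q$1 \<in> {a..b} \<Longrightarrow> q$2 \<in> {c..d} \<Longrightarrow> 0 \<le> g q \<and> g q \<le> M"
  shows "integrable lborel (\<lambda>q. indicator (cbox (vector [a, c]) (vector [b, d])) q * g q)"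
    and "(\<integral>q. indicator (cbox (vector [a, c]) (vector [b, d])) q * g q \<partial>lborel) \<le> M * ((b - a) * (d - c))"
proof -
  let ?B = "cbox (vector [a, c]) (vector [b, d]) :: (real^2) set"
  have gB: "0 \<le> g q \<and> g q \<le> M" if "q \<in> ?B" for q
    using that assms(4) by (simp add: mem_box_cart forall_2)
  have iM: "integrable lborel (\<lambda>q. indicator ?B q * M)"
    using emeasure_lborel_cbox_finite[of "vector [a, c] :: real^2" "vector [b, d]"]
    by (intro integrable_mult_left integrable_real_indicator) auto
  show i: "integrable lborel (\<lambda>q. indicator ?B q * g q)"
  proof (rule Bochner_Integration.integrable_bound[OF iM])
    show "(\<lambda>q. indicator ?B q * g q) \<in> borel_measurable lborel"
      using assms(1) by (intro borel_measurable_times borel_measurable_indicator) (auto intro: borel_measurable_continuous_onI)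
    show "AE q in lborel. norm (indicator ?B q * g q) \<le> norm (indicator ?B q * M)"
      using gB by (intro AE_I2) (force simp: indicator_def)
  qed
  have "(\<integral>q. indicator ?B q * g q \<partial>lborel) \<le> (\<integral>q. indicator ?B q * M \<partial>lborel)"
    using i iM gB by (intro integral_mono) (auto simp: indicator_def)
  also have "\<dots> = M * ((b - a) * (d - c))"
    using measure_box_cart[OF assms(2,3)] by simp
  finally show "(\<integral>q. indicator ?B q * g q \<partial>lborel) \<le> M * ((b - a) * (d - c))" .
qed


section \<open>Pointwise bounds from the energy in one box\<close>

definition weakly_C2 :: "(real^2 \<Rightarrow> real) \<Rightarrow> bool" where
  "weakly_C2 f \<longleftrightarrow> (\<forall>i. is_weak_partial i f (weak_partial i f) \<and>
     (\<forall>j. is_weak_partial j (weak_partial i f) (weak_partial j (weak_partial i f))))"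

text \<open>The part of the squared Sobolev density that is both controlled by
  \<open>sobolev_norm\<close> and sufficient for sup bounds in dimension two; order zero is absent
  on purpose.\<close>

definition energy :: "(real^2 \<Rightarrow> real) \<Rightarrow> real^2 \<Rightarrow> real" where
  "energy f p = nabla_normsq 1 f p + nabla_normsq 2 f p"

lemma energy_nonneg: "0 \<le> energy f p"
  using nabla_normsq_nonneg[of 1 f p] nabla_normsq_nonneg[of 2 f p] by (simp add: energy_def)

text \<open>Each index 1 contributes a factor \<open>exp (- p$2)\<close>, the length of the
  coordinate vector field. The covariant mixed derivative differs from the coordinate one by the
  first partial derivative, because \<open>christoffel p 1 2 1 = -1\<close>; this accounts for the
  factor 2.\<close>

lemma energy_bounds:
  "\<bar>weak_partial 1 f p\<bar> \<le> exp (- p$2) * sqrt (energy f p)" "\<bar>weak_partial 2 f p\<bar> \<le> sqrt (energy f p)"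
  "\<bar>weak_partial 2 (weak_partial 1 f) p\<bar> \<le> 2 * exp (- p$2) * sqrt (energy f p)"
proof -
  define e where "e = exp (p$2)"
  have e: "e > 0" "exp (2 * p$2) = e\<^sup>2" "exp (- p$2) = 1 / e"
    by (simp_all add: e_def exp_minus inverse_eq_divide flip: exp_double)
  define h where "h = nabla weak_partial 2 f [2, 1] p"
  have h: "h = weak_partial 2 (weak_partial 1 f) p + weak_partial 1 f p"
    by (simp add: h_def nabla_2 sum_2)
  have "0 \<le> e\<^sup>2 * e\<^sup>2 * (nabla weak_partial 2 f [1, 1] p)\<^sup>2" "0 \<le> e\<^sup>2 * (nabla weak_partial 2 f [1, 2] p)\<^sup>2"
    "0 \<le> (nabla weak_partial 2 f [2, 2] p)\<^sup>2" "0 \<le> e\<^sup>2 * h\<^sup>2" "0 \<le> e\<^sup>2 * (weak_partial 1 f p)\<^sup>2" "0 \<le> (weak_partial 2 f p)\<^sup>2"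
    by auto
  then have 1: "(e * weak_partial 1 f p)\<^sup>2 \<le> energy f p" and 2: "(weak_partial 2 f p)\<^sup>2 \<le> energy f p"
    and 3: "(e * h)\<^sup>2 \<le> energy f p"
    unfolding energy_def nabla_normsq_1 nabla_normsq_2 e(2) h_def[symmetric] power_mult_distrib by linarith+
  have a1: "\<bar>e * weak_partial 1 f p\<bar> \<le> sqrt (energy f p)" and a3: "\<bar>e * h\<bar> \<le> sqrt (energy f p)"
    and "\<bar>weak_partial 2 f p\<bar> \<le> sqrt (energy f p)"
    using real_sqrt_le_mono[OF 1] real_sqrt_le_mono[OF 2] real_sqrt_le_mono[OF 3] by simp_all
  then show "\<bar>weak_partial 2 f p\<bar> \<le> sqrt (energy f p)" by simp
  show "\<bar>weak_partial 1 f p\<bar> \<le> exp (- p$2) * sqrt (energy f p)"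
    using a1 e(1) unfolding e(3) by (simp add: abs_mult field_simps)
  have "\<bar>e * weak_partial 2 (weak_partial 1 f) p\<bar> \<le> \<bar>e * h\<bar> + \<bar>e * weak_partial 1 f p\<bar>"
    unfolding h by (simp add: distrib_left)
  then have "\<bar>e * weak_partial 2 (weak_partial 1 f) p\<bar> \<le> 2 * sqrt (energy f p)" using a1 a3 by linarith
  then show "\<bar>weak_partial 2 (weak_partial 1 f) p\<bar> \<le> 2 * exp (- p$2) * sqrt (energy f p)"
    using e(1) unfolding e(3) by (simp add: abs_mult field_simps)
qed

text \<open>All these boxes are images of \<open>hbox 0\<close> under the isometries that translate
  x1 or map (x1, x2) to (exp(c) x1, x2 + c). Hence the constants below do not depend on p.\<close>

definition hbox :: "real^2 \<Rightarrow> (real^2) set" where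
  "hbox p = cbox (vector [p$1, p$2]) (vector [p$1 + exp (p$2), p$2 + 1])"

lemma mem_hbox: "q \<in> hbox p \<longleftrightarrow> q$1 \<in> {p$1..p$1 + exp (p$2)} \<and> q$2 \<in> {p$2..p$2 + 1}"
  by (auto simp: hbox_def mem_box_cart forall_2)

text \<open>The kernel C exp(-x2) is scaled to the box: its weighted square is at most C^2 exp(-p2),
  and the coordinate area is exp(p2), so the second term of \<open>energy_bound\<close> is uniform
  in p.\<close>

lemma box_energy_bound:
  fixes g N :: "real^2 \<Rightarrow> real"
  assumes g: "integrable lborel g" and N: "integrable hvol N" "\<And>q. N q \<ge> 0"
    and le: "\<And>q. q \<in> hbox p \<Longrightarrow> \<bar>g q\<bar> \<le> C * exp (- q$2) * sqrt (N q)" "\<And>q. q \<notin> hbox p \<Longrightarrow> g q = 0"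
    and E: "(\<integral>q. indicator (hbox p) q * N q \<partial>hvol) \<le> E" and \<mu>: "\<mu> > 0"
  shows "\<bar>\<integral>q. g q \<partial>lborel\<bar> \<le> (\<mu> * E + C\<^sup>2 / \<mu>) / 2"
proof (rule energy_bound[OF g N, of "hbox p" "\<lambda>q. C * exp (- q$2)"])
  have eq: "(C * exp (- q$2))\<^sup>2 * exp (q$2) = C\<^sup>2 * exp (- q$2)" for q :: "real^2"
    by (simp add: power_mult_distrib power2_eq_square mult.assoc flip: exp_add)
  have c: "continuous_on UNIV (\<lambda>q::real^2. C\<^sup>2 * exp (- q$2))" by (intro continuous_intros)
  have b: "0 \<le> C\<^sup>2 * exp (- q$2) \<and> C\<^sup>2 * exp (- q$2) \<le> C\<^sup>2 * exp (- p$2)"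
    if "q$1 \<in> {p$1..p$1 + exp (p$2)}" "q$2 \<in> {p$2..p$2 + 1}" for q :: "real^2"
    using that by (auto intro: mult_left_mono)
  show "integrable lborel (\<lambda>q. indicator (hbox p) q * ((C * exp (- q$2))\<^sup>2 * exp (q$2)))"
    unfolding eq hbox_def by (rule box_integral_le(1)[OF c _ _ b]) auto
  have "(\<integral>q. indicator (hbox p) q * (C\<^sup>2 * exp (- q$2)) \<partial>lborel)
      \<le> C\<^sup>2 * exp (- p$2) * ((p$1 + exp (p$2) - p$1) * (p$2 + 1 - p$2))"
    unfolding hbox_def by (rule box_integral_le(2)[OF c _ _ b]) auto
  then show "(\<integral>q. indicator (hbox p) q * ((C * exp (- q$2))\<^sup>2 * exp (q$2)) \<partial>lborel) \<le> C\<^sup>2"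
    unfolding eq by (simp add: mult.assoc flip: exp_add)
  show "\<bar>g q\<bar> \<le> indicator (hbox p) q * (C * exp (- q$2) * sqrt (N q))" for q
    using le[of q] by (cases "q \<in> hbox p") auto
qed (use E \<mu> in \<open>auto simp: hbox_def\<close>)

lemma exp_hbox:
  assumes "q \<in> hbox p" shows "1 / exp (p$2) \<le> 3 * exp (- q$2)"
proof -
  have "exp (- p$2) \<le> exp (1 + - q$2)" using assms by (simp add: mem_hbox)
  also have "\<dots> \<le> 3 * exp (- q$2)" unfolding exp_add using e_less_272 by (intro mult_right_mono) auto
  finally show ?thesis by (simp add: exp_minus inverse_eq_divide)
qed

text \<open>With \<open>\<delta>\<^sub>r\<close> the bump \<open>dstep c r\<close> and H, G the primitives of \<open>\<delta>\<^sub>\<epsilon> - \<delta>\<^sub>w\<close> and \<open>\<delta>\<^sub>\<epsilon> - \<delta>\<^sub>1\<close>, the product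
  \<open>\<delta>\<^sub>\<epsilon> \<delta>\<^sub>\<epsilon> - \<delta>\<^sub>w \<delta>\<^sub>1\<close> equals \<open>H' G' + H' \<delta>\<^sub>1 + \<delta>\<^sub>w G'\<close>: only mixed derivatives of order two occur, and no singular kernel.\<close>

lemma delta_expansion:
  fixes p :: "real^2"
  defines "w \<equiv> exp (p$2)"
  assumes f: "weakly_C2 f" and N: "integrable hvol (energy f)"
    and E: "(\<integral>q. indicator (hbox p) q * energy f q \<partial>hvol) \<le> E" and \<mu>: "\<mu> > 0"
    and \<epsilon>: "0 < \<epsilon>" "\<epsilon> \<le> w" "\<epsilon> \<le> 1"
  shows "\<bar>pairing f (dstep (p$1) \<epsilon>) (dstep (p$2) \<epsilon>) - pairing f (dstep (p$1) w) (dstep (p$2) 1)\<bar> \<le> 3 * ((\<mu> * E + (3 * step_const\<^sup>2)\<^sup>2 / \<mu>) / 2)"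
proof -
  define f1 f2 f12 where "f1 = weak_partial 1 f" and "f2 = weak_partial 2 f" and "f12 = weak_partial 2 (weak_partial 1 f)"
  have wp: "is_weak_partial 1 f f1" "is_weak_partial 2 f f2" "is_weak_partial 2 f1 f12"
    using f by (auto simp: weakly_C2_def f1_def f2_def f12_def)
  then have li: "locally_integrable f" "locally_integrable f1" "locally_integrable f2" "locally_integrable f12"
    by (auto simp: is_weak_partial_def)
  have w: "w > 0" by (simp add: w_def)
  define K where "K = step_const"
  have K: "K \<ge> 1" by (simp add: K_def step_const)
  define H where "H x = bstep (p$1) \<epsilon> x - bstep (p$1) w x" for x
  define G where "G x = bstep (p$2) \<epsilon> x - bstep (p$2) 1 x" for x
  define dw d1 where "dw = dstep (p$1) w" and "d1 = dstep (p$2) 1"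
  have dH: "deriv H = (\<lambda>x. dstep (p$1) \<epsilon> x - dw x)" unfolding H_def dw_def by (rule deriv_diff_bstep)
  have dG: "deriv G = (\<lambda>x. dstep (p$2) \<epsilon> x - d1 x)" unfolding G_def d1_def by (rule deriv_diff_bstep)
  have sup: "supported H (p$1) (p$1 + w)" "supported G (p$2) (p$2 + 1)" "supported dw (p$1) (p$1 + w)" "supported d1 (p$2) (p$2 + 1)"
    "supported (deriv H) (p$1) (p$1 + w)" "supported (deriv G) (p$2) (p$2 + 1)"
    using \<epsilon> w unfolding dH dG unfolding H_def G_def dw_def d1_def
    by (auto intro: supported_bstep_diff intro!: supported_diff[of "dstep _ _"] supported_dstep)
  have bd: "\<bar>H x\<bar> \<le> 1" "\<bar>G x\<bar> \<le> 1" "\<bar>dw x\<bar> \<le> K / w" "\<bar>d1 x\<bar> \<le> K" for x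
    using bstep_bounds[of "p$1" \<epsilon> x] bstep_bounds[of "p$1" w x] bstep_bounds[of "p$2" \<epsilon> x] bstep_bounds[of "p$2" 1 x]
      dstep_bounds[OF w, of "p$1" x] dstep_bounds[of 1 "p$2" x]
    by (auto simp: H_def G_def dw_def d1_def K_def abs_le_iff)
  have out: "H (q$1) = 0 \<or> G (q$2) = 0" "H (q$1) = 0 \<or> d1 (q$2) = 0" "dw (q$1) = 0 \<or> G (q$2) = 0" if "q \<notin> hbox p" for q
    using that sup unfolding supported_def mem_hbox w_def by blast+
  have "pairing f (dstep (p$1) \<epsilon>) (dstep (p$2) \<epsilon>) - pairing f dw d1 = (\<integral>q. f q * tensor (dstep (p$1) \<epsilon>) (dstep (p$2) \<epsilon>) q - f q * tensor dw d1 q \<partial>lborel)"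
    using integrable_tensor[OF li(1) supported_dstep[OF \<epsilon>(1) order_refl] supported_dstep[OF \<epsilon>(1) order_refl]]
      integrable_tensor[OF li(1) sup(3,4)]
    by (intro Bochner_Integration.integral_diff[symmetric]) auto
  also have "\<dots> = (\<integral>q. f q * tensor (deriv H) (deriv G) q + f q * tensor (deriv H) d1 q + f q * tensor dw (deriv G) q \<partial>lborel)"
    unfolding dH dG by (intro Bochner_Integration.integral_cong) (auto simp: algebra_simps)
  also have "\<dots> = pairing f (deriv H) (deriv G) + pairing f (deriv H) d1 + pairing f dw (deriv G)"
    using integrable_tensor[OF li(1) sup(5,6)] integrable_tensor[OF li(1) sup(5,4)] integrable_tensor[OF li(1) sup(3,6)]
    by (subst Bochner_Integration.integral_add | simp)+
  also have "\<dots> = pairing f12 H G - pairing f1 H d1 - pairing f2 dw G"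
    using weak_partial_tensor(1)[OF sup(1,6) wp(1)] weak_partial_tensor(2)[OF sup(1,2) wp(3)]
      weak_partial_tensor(1)[OF sup(1,4) wp(1)] weak_partial_tensor(2)[OF sup(3,2) wp(2)] by simp
  finally have eq: "pairing f (dstep (p$1) \<epsilon>) (dstep (p$2) \<epsilon>) - pairing f dw d1 = pairing f12 H G - pairing f1 H d1 - pairing f2 dw G" .
  have KK: "K \<le> K\<^sup>2" using K self_le_power[of K 2] by simp
  \<comment> \<open>The three kernels are at most 2, K and 3 K times \<open>exp (- q$2)\<close>, the
    last one by \<open>exp_hbox\<close>; \<open>3 * K^2\<close> covers them all because K is at
    least 1.\<close>
  note B = box_energy_bound[OF _ N energy_nonneg _ _ E \<mu>, where C = "3 * K\<^sup>2"]
  have "\<bar>pairing f12 H G\<bar> \<le> (\<mu> * E + (3 * K\<^sup>2)\<^sup>2 / \<mu>) / 2"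
  proof (rule B)
    fix q assume "q \<in> hbox p"
    have "\<bar>H (q$1) * G (q$2)\<bar> \<le> 1 * 1" unfolding abs_mult by (intro mult_mono bd) auto
    then have "\<bar>f12 q\<bar> * \<bar>H (q$1) * G (q$2)\<bar> \<le> (2 * exp (- q$2) * sqrt (energy f q)) * 1"
      using energy_bounds(3)[of f q] energy_nonneg[of f q] unfolding f12_def by (intro mult_mono) auto
    also have "\<dots> \<le> 3 * K\<^sup>2 * exp (- q$2) * sqrt (energy f q)"
    proof -
      have "2 \<le> 3 * K\<^sup>2" using K KK by simp
      from mult_right_mono[OF this, of "exp (- q$2) * sqrt (energy f q)"] show ?thesis using energy_nonneg[of f q] by (simp add: mult.assoc)
    qed
    finally show "\<bar>f12 q * (H (q$1) * G (q$2))\<bar> \<le> 3 * K\<^sup>2 * exp (- q$2) * sqrt (energy f q)" by (simp add: abs_mult)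
  qed (use out integrable_tensor[OF li(4) sup(1,2)] in auto)
  moreover have "\<bar>pairing f1 H d1\<bar> \<le> (\<mu> * E + (3 * K\<^sup>2)\<^sup>2 / \<mu>) / 2"
  proof (rule B)
    fix q assume "q \<in> hbox p"
    have "\<bar>H (q$1) * d1 (q$2)\<bar> \<le> 1 * K" unfolding abs_mult by (intro mult_mono bd) auto
    then have "\<bar>f1 q\<bar> * \<bar>H (q$1) * d1 (q$2)\<bar> \<le> (exp (- q$2) * sqrt (energy f q)) * K"
      using energy_bounds(1)[of f q] K energy_nonneg[of f q] unfolding f1_def by (intro mult_mono) auto
    also have "\<dots> \<le> (exp (- q$2) * sqrt (energy f q)) * (3 * K\<^sup>2)"
      using K KK energy_nonneg[of f q] by (intro mult_left_mono) auto
    finally show "\<bar>f1 q * (H (q$1) * d1 (q$2))\<bar> \<le> 3 * K\<^sup>2 * exp (- q$2) * sqrt (energy f q)" by (simp add: abs_mult mult_ac)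
  qed (use out integrable_tensor[OF li(2) sup(1,4)] in auto)
  moreover have "\<bar>pairing f2 dw G\<bar> \<le> (\<mu> * E + (3 * K\<^sup>2)\<^sup>2 / \<mu>) / 2"
  proof (rule B)
    fix q assume q: "q \<in> hbox p"
    have "\<bar>dw (q$1) * G (q$2)\<bar> \<le> (K / w) * 1" unfolding abs_mult using K w by (intro mult_mono bd) auto
    also have "\<dots> \<le> K * (3 * exp (- q$2))" using exp_hbox[OF q] K by (simp add: w_def field_simps)
    also have "\<dots> \<le> 3 * K\<^sup>2 * exp (- q$2)" using KK by simp
    finally have "\<bar>f2 q\<bar> * \<bar>dw (q$1) * G (q$2)\<bar> \<le> sqrt (energy f q) * (3 * K\<^sup>2 * exp (- q$2))"
      using energy_bounds(2)[of f q] energy_nonneg[of f q] unfolding f2_def by (intro mult_mono) auto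
    then show "\<bar>f2 q * (dw (q$1) * G (q$2))\<bar> \<le> 3 * K\<^sup>2 * exp (- q$2) * sqrt (energy f q)" by (simp add: abs_mult mult_ac)
  qed (use out integrable_tensor[OF li(3) sup(3,2)] in auto)
  ultimately show ?thesis using eq unfolding dw_def d1_def K_def by linarith
qed

lemma locally_integrable_continuous:
  "continuous_on UNIV f \<Longrightarrow> locally_integrable f"
  unfolding locally_integrable_def set_integrable_def
  using borel_integrable_compact continuous_on_subset by blast

text \<open>If |f p| exceeded B / c, then by continuity f would keep its sign and stay beyond some m
  > B / c on a small box with corner p, and the pairing would be at least m times the mass of the
  bump. That mass is at least c = (b - a)^2 / 4: in each direction the bump is at least 1/2 on an
  interval of rescaled length b - a. No convergence of the averages is involved.\<close>

lemma delta_lower: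
  "\<exists>c>0. \<forall>f p B r. continuous_on UNIV f \<longrightarrow> r > 0 \<longrightarrow>
    (\<forall>\<epsilon>. 0 < \<epsilon> \<longrightarrow> \<epsilon> \<le> r \<longrightarrow> \<bar>pairing f (dstep (p$1) \<epsilon>) (dstep (p$2) \<epsilon>)\<bar> \<le> B) \<longrightarrow> c * \<bar>f p\<bar> \<le> B"
proof -
  obtain a b where ab: "a < b" "\<And>x. x \<in> {a..b} \<Longrightarrow> 1/2 \<le> deriv step x" using deriv_step_lower by blast
  define c where "c = (b - a)\<^sup>2 / 4"
  have c: "c > 0" using ab by (simp add: c_def)
  moreover have "c * \<bar>f p\<bar> \<le> B" if f: "continuous_on UNIV f" and r: "r > 0"
    and B: "\<And>\<epsilon>. 0 < \<epsilon> \<Longrightarrow> \<epsilon> \<le> r \<Longrightarrow> \<bar>pairing f (dstep (p$1) \<epsilon>) (dstep (p$2) \<epsilon>)\<bar> \<le> B" for f p B r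
  proof (rule ccontr)
    assume "\<not> c * \<bar>f p\<bar> \<le> B"
    then have lt: "B / c < \<bar>f p\<bar>" using c by (simp add: field_simps)
    define m where "m = (\<bar>f p\<bar> + B / c) / 2"
    have "x < y \<Longrightarrow> x < (y + x) / 2 \<and> (y + x) / 2 < y" for x y :: real by auto
    from this[OF lt] have m1: "B / c < m" and m2: "m < \<bar>f p\<bar>" by (simp_all only: m_def)
    have "B \<ge> 0" using B[of r] r by linarith
    then have m0: "m > 0" using m1 c by (smt (verit) divide_nonneg_pos)
    define s where "s = sgn (f p)"
    have s: "s * f p = \<bar>f p\<bar>" "\<bar>s\<bar> \<le> 1" by (auto simp: s_def sgn_if)
    have "isCont f p" using f by (simp add: continuous_on_eq_continuous_at)
    then obtain d where d: "d > 0" "\<And>q. dist q p < d \<Longrightarrow> dist (f q) (f p) < \<bar>f p\<bar> - m"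
      unfolding continuous_at_eps_delta using m2 by (metis diff_gt_0_iff_gt)
    \<comment> \<open>The support of the bump has diameter at most 2 \<epsilon>, which d / 4 keeps
      below d.\<close>
    define \<epsilon> where "\<epsilon> = min r (d / 4)"
    have \<epsilon>: "\<epsilon> > 0" "\<epsilon> \<le> r" "\<epsilon> \<le> d / 4" using r d(1) by (auto simp: \<epsilon>_def)
    define T where "T = tensor (dstep (p$1) \<epsilon>) (dstep (p$2) \<epsilon>)"
    have T0: "T q \<ge> 0" for q using dstep_bounds(1) \<epsilon>(1) by (simp add: T_def)
    have sup: "supported (dstep (p$1) \<epsilon>) (p$1) (p$1 + \<epsilon>)" "supported (dstep (p$2) \<epsilon>) (p$2) (p$2 + \<epsilon>)"
      using \<epsilon>(1) by (auto intro: supported_dstep)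
    have iT: "integrable lborel T" and ifT: "integrable lborel (\<lambda>q. f q * T q)"
      using integrable_tensor[OF locally_integrable_continuous sup, of "\<lambda>_. 1"] integrable_tensor[OF locally_integrable_continuous[OF f] sup]
      by (simp_all add: T_def)
    have ge: "m * T q \<le> s * (f q * T q)" for q
    proof (cases "T q = 0")
      case False
      then have "q$1 \<in> {p$1..p$1 + \<epsilon>}" "q$2 \<in> {p$2..p$2 + \<epsilon>}" using sup unfolding T_def supported_def by fastforce+
      then have "\<bar>(q - p)$1\<bar> + \<bar>(q - p)$2\<bar> \<le> 2 * \<epsilon>" by auto
      then have "dist q p < d" using norm_le_l1_cart[of "q - p"] \<epsilon> d(1) by (simp add: sum_2 dist_norm)
      then have "\<bar>f q - f p\<bar> < \<bar>f p\<bar> - m" using d(2) by (simp add: dist_real_def)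
      moreover have "\<bar>s * (f q - f p)\<bar> \<le> 1 * \<bar>f q - f p\<bar>" unfolding abs_mult using s(2) by (intro mult_right_mono) auto
      ultimately have "m \<le> s * f q" using s(1) by (simp add: right_diff_distrib)
      from mult_right_mono[OF this T0[of q]] show ?thesis by (simp add: mult.assoc)
    qed simp
    let ?B = "cbox (vector [p$1 + \<epsilon> * a, p$2 + \<epsilon> * a]) (vector [p$1 + \<epsilon> * b, p$2 + \<epsilon> * b]) :: (real^2) set"
    have area: "measure lborel ?B = (\<epsilon> * (b - a)) * (\<epsilon> * (b - a))"
      using measure_box_cart[of "p$1 + \<epsilon> * a" "p$1 + \<epsilon> * b" "p$2 + \<epsilon> * a" "p$2 + \<epsilon> * b"] ab(1) \<epsilon>(1) by (simp add: algebra_simps)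
    have iB: "integrable lborel (\<lambda>q. indicator ?B q * (1 / (2 * \<epsilon>) * (1 / (2 * \<epsilon>))) :: real)"
      using emeasure_lborel_cbox_finite by (intro integrable_mult_left integrable_real_indicator) auto
    have TB: "indicator ?B q * (1 / (2 * \<epsilon>) * (1 / (2 * \<epsilon>))) \<le> T q" for q
    proof (cases "q \<in> ?B")
      case True
      have "1 / (2 * \<epsilon>) \<le> dstep (p$i) \<epsilon> (q$i)" for i
      proof -
        have "p$i + \<epsilon> * a \<le> q$i" "q$i \<le> p$i + \<epsilon> * b" using True exhaust_2[of i] by (auto simp: mem_box_cart forall_2)
        then have "(q$i - p$i) / \<epsilon> \<in> {a..b}" using \<epsilon>(1) by (auto simp: field_simps)
        from ab(2)[OF this] show ?thesis using \<epsilon>(1) by (simp add: dstep_def field_simps)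
      qed
      then have "1 / (2 * \<epsilon>) * (1 / (2 * \<epsilon>)) \<le> T q" unfolding T_def using \<epsilon>(1) by (intro mult_mono) (auto intro: dstep_bounds)
      then show ?thesis using True by simp
    qed (use T0 in simp)
    have "c = (\<integral>q. indicator ?B q * (1 / (2 * \<epsilon>) * (1 / (2 * \<epsilon>))) \<partial>lborel)"
      using \<epsilon>(1) area by (simp add: c_def power2_eq_square field_simps)
    also have "\<dots> \<le> (\<integral>q. T q \<partial>lborel)" using iB iT TB by (intro integral_mono) auto
    finally have "m * c \<le> m * (\<integral>q. T q \<partial>lborel)" using m0 by (intro mult_left_mono) auto
    also have "\<dots> = (\<integral>q. m * T q \<partial>lborel)" by simp
    also have "\<dots> \<le> (\<integral>q. s * (f q * T q) \<partial>lborel)" using iT ifT ge by (intro integral_mono) auto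
    also have "\<dots> = s * (\<integral>q. f q * T q \<partial>lborel)" by simp
    also have "\<dots> \<le> \<bar>s\<bar> * \<bar>\<integral>q. f q * T q \<partial>lborel\<bar>" by (metis abs_ge_self abs_mult)
    also have "\<dots> \<le> 1 * \<bar>\<integral>q. f q * T q \<partial>lborel\<bar>" using s(2) by (intro mult_right_mono) auto
    also have "\<dots> \<le> B" using B[OF \<epsilon>(1,2)] unfolding T_def by simp
    finally show False using m1 c by (simp add: field_simps)
  qed
  ultimately show ?thesis by (intro exI[of _ c]) auto
qed

text \<open>By \<open>delta_expansion\<close> the averages at small scales stay close to the one
  over \<open>hbox p\<close>, so the value at p is controlled once that single average is. The local
  and the global embedding differ only in how they bound it.\<close>

lemma sup_le_average:
  "\<exists>C>0. \<forall>f p \<mu> E. continuous_on UNIV f \<longrightarrow> weakly_C2 f \<longrightarrow> integrable hvol (energy f) \<longrightarrow> \<mu> > 0 \<longrightarrow>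
    (\<integral>q. indicator (hbox p) q * energy f q \<partial>hvol) \<le> E \<longrightarrow>
    \<bar>\<integral>q. f q * tensor (dstep (p$1) (exp (p$2))) (dstep (p$2) 1) q \<partial>lborel\<bar> \<le> (\<mu> * E + (3 * step_const\<^sup>2)\<^sup>2 / \<mu>) / 2 \<longrightarrow>
    \<bar>f p\<bar> \<le> C * (\<mu> * E + 1 / \<mu>)"
proof -
  obtain c where c: "c > 0" "\<forall>f p B r. continuous_on UNIV f \<longrightarrow> r > 0 \<longrightarrow>
    (\<forall>\<epsilon>. 0 < \<epsilon> \<longrightarrow> \<epsilon> \<le> r \<longrightarrow> \<bar>pairing f (dstep (p$1) \<epsilon>) (dstep (p$2) \<epsilon>)\<bar> \<le> B) \<longrightarrow> c * \<bar>f p\<bar> \<le> B"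
    using delta_lower by blast
  define A where "A = (3 * step_const\<^sup>2)\<^sup>2"
  have A: "A \<ge> 1" unfolding A_def using step_const(1) by (metis one_le_power mult_mono' mult_1 one_le_numeral zero_le_one)
  have "\<bar>f p\<bar> \<le> (2 * A / c) * (\<mu> * E + 1 / \<mu>)"
    if f: "continuous_on UNIV f" "weakly_C2 f" "integrable hvol (energy f)" and \<mu>: "\<mu> > 0"
      and E: "(\<integral>q. indicator (hbox p) q * energy f q \<partial>hvol) \<le> E"
      and bnd: "\<bar>\<integral>q. f q * tensor (dstep (p$1) (exp (p$2))) (dstep (p$2) 1) q \<partial>lborel\<bar> \<le> (\<mu> * E + A / \<mu>) / 2" for f p \<mu> E
  proof -
    have "0 \<le> (\<integral>q. indicator (hbox p) q * energy f q \<partial>hvol)"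
      using energy_nonneg by (intro integral_nonneg_AE) auto
    then have E0: "E \<ge> 0" using E by linarith
    have "\<bar>pairing f (dstep (p$1) \<epsilon>) (dstep (p$2) \<epsilon>)\<bar> \<le> 2 * (\<mu> * E + A / \<mu>)"
      if \<epsilon>: "0 < \<epsilon>" "\<epsilon> \<le> min (exp (p$2)) 1" for \<epsilon>
    proof -
      have "\<epsilon> \<le> exp (p$2)" "\<epsilon> \<le> 1" using \<epsilon> by auto
      note D = delta_expansion[OF f(2,3) E \<mu> \<epsilon>(1) this, folded A_def]
      have arith: "\<bar>x\<bar> \<le> k / 2 \<Longrightarrow> \<bar>y - x\<bar> \<le> 3 * (k / 2) \<Longrightarrow> \<bar>y\<bar> \<le> 2 * k" for x y k :: real by linarith
      show ?thesis by (rule arith[OF bnd D])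
    qed
    then have "c * \<bar>f p\<bar> \<le> 2 * (\<mu> * E + A / \<mu>)" by (intro c(2)[rule_format, OF f(1), of "min (exp (p$2)) 1"]) auto
    also have "\<dots> \<le> 2 * (A * (\<mu> * E) + A * (1 / \<mu>))"
    proof -
      have "1 * (\<mu> * E) \<le> A * (\<mu> * E)" using A E0 \<mu> by (intro mult_right_mono) auto
      then show ?thesis by simp
    qed
    finally show ?thesis using c(1) by (simp add: field_simps)
  qed
  moreover have "2 * A / c > 0" using A c(1) by simp
  ultimately show ?thesis unfolding A_def by blast
qed

text \<open>Here the average is bounded by the square integral of f over \<open>hbox p\<close>.
  Since only that box enters, the right-hand side becomes small far away, which is what
  \<open>sobolev_decay\<close> exploits.\<close>

lemma sobolev_sup_local:
  "\<exists>C>0. \<forall>f p \<mu>. continuous_on UNIV f \<longrightarrow> weakly_C2 f \<longrightarrow> integrable hvol (nabla_normsq 0 f) \<longrightarrow> integrable hvol (energy f) \<longrightarrow>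
    \<mu> > 0 \<longrightarrow> \<bar>f p\<bar> \<le> C * (\<mu> * (\<integral>q. indicator (hbox p) q * (nabla_normsq 0 f q + energy f q) \<partial>hvol) + 1 / \<mu>)"
proof -
  obtain C where C: "C > 0" "\<forall>f p \<mu> E. continuous_on UNIV f \<longrightarrow> weakly_C2 f \<longrightarrow> integrable hvol (energy f) \<longrightarrow> \<mu> > 0 \<longrightarrow>
    (\<integral>q. indicator (hbox p) q * energy f q \<partial>hvol) \<le> E \<longrightarrow>
    \<bar>\<integral>q. f q * tensor (dstep (p$1) (exp (p$2))) (dstep (p$2) 1) q \<partial>lborel\<bar> \<le> (\<mu> * E + (3 * step_const\<^sup>2)\<^sup>2 / \<mu>) / 2 \<longrightarrow>
    \<bar>f p\<bar> \<le> C * (\<mu> * E + 1 / \<mu>)" using sup_le_average by blast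
  have "\<bar>f p\<bar> \<le> C * (\<mu> * (\<integral>q. indicator (hbox p) q * (nabla_normsq 0 f q + energy f q) \<partial>hvol) + 1 / \<mu>)"
    if f: "continuous_on UNIV f" "weakly_C2 f" "integrable hvol (nabla_normsq 0 f)" "integrable hvol (energy f)" and \<mu>: "\<mu> > 0" for f p \<mu>
  proof -
    define w K where "w = exp (p$2)" and "K = step_const"
    have w: "w > 0" by (simp add: w_def)
    define E where "E = (\<integral>q. indicator (hbox p) q * (nabla_normsq 0 f q + energy f q) \<partial>hvol)"
    have hb: "hbox p \<in> sets hvol" by (simp add: hvol_def hbox_def)
    have i: "integrable hvol (\<lambda>q. indicator (hbox p) q * nabla_normsq 0 f q)" "integrable hvol (\<lambda>q. indicator (hbox p) q * energy f q)"
      using integrable_real_mult_indicator[OF hb f(3)] integrable_real_mult_indicator[OF hb f(4)] by (simp_all add: mult.commute)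
    have nn: "0 \<le> (\<integral>q. indicator (hbox p) q * nabla_normsq 0 f q \<partial>hvol)" "0 \<le> (\<integral>q. indicator (hbox p) q * energy f q \<partial>hvol)"
      using nabla_normsq_nonneg[of 0] energy_nonneg by (auto intro!: integral_nonneg_AE)
    have "E = (\<integral>q. indicator (hbox p) q * nabla_normsq 0 f q \<partial>hvol) + (\<integral>q. indicator (hbox p) q * energy f q \<partial>hvol)"
      using i by (simp add: distrib_left E_def)
    then have E0: "(\<integral>q. indicator (hbox p) q * nabla_normsq 0 f q \<partial>hvol) \<le> E" and E1: "(\<integral>q. indicator (hbox p) q * energy f q \<partial>hvol) \<le> E"
      using nn by linarith+
    have sup: "supported (dstep (p$1) w) (p$1) (p$1 + w)" "supported (dstep (p$2) 1) (p$2) (p$2 + 1)"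
      using w by (auto intro: supported_dstep)
    have "\<bar>pairing f (dstep (p$1) w) (dstep (p$2) 1)\<bar> \<le> (\<mu> * E + (3 * K\<^sup>2)\<^sup>2 / \<mu>) / 2"
    proof (rule box_energy_bound[OF _ f(3) nabla_normsq_nonneg _ _ E0 \<mu>])
      show "integrable lborel (\<lambda>q. f q * tensor (dstep (p$1) w) (dstep (p$2) 1) q)"
        by (rule integrable_tensor[OF locally_integrable_continuous[OF f(1)] sup])
      show "f q * tensor (dstep (p$1) w) (dstep (p$2) 1) q = 0" if "q \<notin> hbox p" for q
        using that sup unfolding supported_def mem_hbox w_def by force
      fix q assume q: "q \<in> hbox p"
      have "tensor (dstep (p$1) w) (dstep (p$2) 1) q \<le> (K / w) * (K / 1)"
        unfolding K_def using w step_const(1) by (intro mult_mono dstep_bounds) auto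
      also have "\<dots> = K\<^sup>2 * (1 / w)" by (simp add: power2_eq_square)
      also have "\<dots> \<le> K\<^sup>2 * (3 * exp (- q$2))" using exp_hbox[OF q] unfolding w_def by (intro mult_left_mono) auto
      finally have "\<bar>f q\<bar> * tensor (dstep (p$1) w) (dstep (p$2) 1) q \<le> \<bar>f q\<bar> * (3 * K\<^sup>2 * exp (- q$2))"
        by (intro mult_left_mono) auto
      then show "\<bar>f q * tensor (dstep (p$1) w) (dstep (p$2) 1) q\<bar> \<le> 3 * K\<^sup>2 * exp (- q$2) * sqrt (nabla_normsq 0 f q)"
        using dstep_bounds(1) w by (simp add: abs_mult nabla_normsq_0 mult_ac)
    qed
    then show ?thesis using C(2) f(1,2,4) \<mu> E1 unfolding E_def w_def K_def by blast
  qed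
  then show ?thesis using C(1) by blast
qed

section \<open>Estimates without a term of order zero\<close>

lemma integral_exp_strip:
  fixes p :: "real^2"
  defines "B \<equiv> \<lambda>n. cbox (vector [p$1, p$2 - real n]) (vector [p$1 + exp (p$2), p$2 + 1]) :: (real^2) set"
  shows "integrable lborel (\<lambda>q. indicator (B n) q * exp (q$2))"
    and "(\<integral>q. indicator (B n) q * exp (q$2) \<partial>lborel) \<le> exp (p$2) * exp (p$2 + 1) * (2 - (1/2)^n)"
proof -
  have cont: "continuous_on UNIV (\<lambda>q::real^2. exp (q$2))" by (intro continuous_intros)
  have i: "integrable lborel (\<lambda>q. indicator (B n) q * exp (q$2))" for n
    unfolding B_def by (rule box_integral_le(1)[OF cont, where M = "exp (p$2 + 1)"]) auto
  then show "integrable lborel (\<lambda>q. indicator (B n) q * exp (q$2))" .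
  show "(\<integral>q. indicator (B n) q * exp (q$2) \<partial>lborel) \<le> exp (p$2) * exp (p$2 + 1) * (2 - (1/2)^n)"
  \<comment> \<open>The strip is cut into layers of height 1; the weight falls by at least the
    factor 1/2 per layer, and the subtracted power in the bound is the tail of the geometric series,
    which makes the induction close.\<close>
  proof (induction n)
    case 0
    have "(\<integral>q. indicator (B 0) q * exp (q$2) \<partial>lborel) \<le> exp (p$2 + 1) * ((p$1 + exp (p$2) - p$1) * (p$2 + 1 - (p$2 - real 0)))"
      unfolding B_def by (rule box_integral_le(2)[OF cont]) auto
    then show ?case by (simp add: mult.commute)
  next
    case (Suc n)
    define b where "b = cbox (vector [p$1, p$2 - real (Suc n)]) (vector [p$1 + exp (p$2), p$2 - real n] :: real^2)"
    have ib: "integrable lborel (\<lambda>q. indicator b q * exp (q$2))"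
      unfolding b_def by (rule box_integral_le(1)[OF cont, where M = "exp (p$2 - real n)"]) auto
    have "(\<integral>q. indicator b q * exp (q$2) \<partial>lborel) \<le> exp (p$2 - real n) * ((p$1 + exp (p$2) - p$1) * (p$2 - real n - (p$2 - real (Suc n))))"
      unfolding b_def by (rule box_integral_le(2)[OF cont]) auto
    also have "\<dots> = exp (p$2) * exp (p$2 + 1) * exp (- 1) ^ Suc n"
      by (simp add: exp_of_nat_mult[symmetric] algebra_simps flip: exp_add)
    also have "\<dots> \<le> exp (p$2) * exp (p$2 + 1) * (1/2) ^ Suc n"
    proof -
      have "exp (-1::real) \<le> 1/2" using exp_ge_add_one_self[of "1::real"] by (simp add: exp_minus inverse_eq_divide field_simps)
      then show ?thesis by (intro mult_left_mono power_mono) auto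
    qed
    finally have 1: "(\<integral>q. indicator b q * exp (q$2) \<partial>lborel) \<le> exp (p$2) * exp (p$2 + 1) * (1/2) ^ Suc n" .
    have "(\<integral>q. indicator (B (Suc n)) q * exp (q$2) \<partial>lborel) \<le> (\<integral>q. indicator (B n) q * exp (q$2) + indicator b q * exp (q$2) \<partial>lborel)"
    proof (intro integral_mono Bochner_Integration.integrable_add i ib)
      fix q :: "real^2"
      have "q \<in> B (Suc n) \<Longrightarrow> q \<in> B n \<or> q \<in> b" by (auto simp: B_def b_def mem_box_cart forall_2)
      then show "indicator (B (Suc n)) q * exp (q$2) \<le> indicator (B n) q * exp (q$2) + indicator b q * exp (q$2)"
        by (auto simp: indicator_def)
    qed
    also have "\<dots> = (\<integral>q. indicator (B n) q * exp (q$2) \<partial>lborel) + (\<integral>q. indicator b q * exp (q$2) \<partial>lborel)"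
      by (rule Bochner_Integration.integral_add[OF i ib])
    also have "\<dots> \<le> exp (p$2) * exp (p$2 + 1) * (2 - (1/2)^n) + exp (p$2) * exp (p$2 + 1) * (1/2) ^ Suc n"
      using Suc.IH 1 by (rule add_mono)
    also have "\<dots> = exp (p$2) * exp (p$2 + 1) * (2 - (1/2)^Suc n)" by (simp add: right_diff_distrib)
    finally show ?case .
  qed
qed

text \<open>The bump in x2 is moved down by n at the cost of a pairing with the weak derivative in
  x2. The kernel has constant size K / w on the strip, but the weight exp(x2), reciprocal to the
  volume density, makes its squared integral bounded independently of n. The average at the lower
  end is small because f vanishes at infinity.\<close>

lemma far_average:
  fixes p :: "real^2"
  assumes f: "continuous_on UNIV f" "weakly_C2 f" "integrable hvol (energy f)" "(f \<longlongrightarrow> 0) at_infinity" and \<mu>: "\<mu> > 0"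
    and E: "(\<integral>q. energy f q \<partial>hvol) \<le> E"
  shows "\<bar>\<integral>q. f q * tensor (dstep (p$1) (exp (p$2))) (dstep (p$2) 1) q \<partial>lborel\<bar> \<le> (\<mu> * E + 6 * step_const\<^sup>2 / \<mu>) / 2"
proof (rule field_le_epsilon)
  fix e :: real assume e: "e > 0"
  define w K where "w = exp (p$2)" and "K = step_const"
  have w: "w > 0" and K: "K \<ge> 1" by (simp_all add: w_def K_def step_const)
  define f2 where "f2 = weak_partial 2 f"
  have wp: "is_weak_partial 2 f f2" using f(2) by (auto simp: weakly_C2_def f2_def)
  then have li: "locally_integrable f" "locally_integrable f2" by (auto simp: is_weak_partial_def)
  have "\<forall>\<^sub>F q in at_infinity. \<bar>f q\<bar> < e / K\<^sup>2"
    using tendstoD[OF f(4), of "e / K\<^sup>2"] e K by (simp add: dist_real_def)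
  then obtain R where R: "\<And>q. norm q \<ge> R \<Longrightarrow> \<bar>f q\<bar> < e / K\<^sup>2" by (auto simp: eventually_at_infinity)
  \<comment> \<open>The summand 1 is the height of the shifted bump: its whole support then lies at
    \<open>q$2\<close> below -R.\<close>
  obtain n where n: "R + \<bar>p$2\<bar> + 1 \<le> real n" using real_arch_simple by blast
  define G where "G x = bstep (p$2 - real n) 1 x - bstep (p$2) 1 x" for x
  define dw d1 dn where "dw = dstep (p$1) w" and "d1 = dstep (p$2) 1" and "dn = dstep (p$2 - real n) 1"
  have dG: "deriv G = (\<lambda>x. dn x - d1 x)" unfolding G_def dn_def d1_def by (rule deriv_diff_bstep)
  have sup: "supported dw (p$1) (p$1 + w)" "supported d1 (p$2) (p$2 + 1)" "supported dn (p$2 - real n) (p$2 - real n + 1)"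
    "supported G (p$2 - real n) (p$2 + 1)"
    using w unfolding dw_def d1_def dn_def G_def by (auto intro!: supported_dstep supported_bstep_diff)
  have bd: "\<bar>G x\<bar> \<le> 1" "\<bar>dw x\<bar> \<le> K / w" "\<bar>dn x\<bar> \<le> K" for x
    using bstep_bounds[of "p$2 - real n" 1 x] bstep_bounds[of "p$2" 1 x] dstep_bounds[OF w, of "p$1" x] dstep_bounds[of 1 "p$2 - real n" x]
    by (auto simp: G_def dw_def dn_def K_def abs_le_iff)
  have "pairing f dw dn - pairing f dw d1 = (\<integral>q. f q * tensor dw dn q - f q * tensor dw d1 q \<partial>lborel)"
    using integrable_tensor[OF li(1) sup(1,3)] integrable_tensor[OF li(1) sup(1,2)]
    by (intro Bochner_Integration.integral_diff[symmetric]) auto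
  also have "\<dots> = pairing f dw (deriv G)" unfolding dG by (intro Bochner_Integration.integral_cong) (auto simp: algebra_simps)
  also have "\<dots> = - pairing f2 dw G" by (rule weak_partial_tensor(2)[OF sup(1,4) wp])
  finally have eq: "pairing f dw d1 = pairing f dw dn + pairing f2 dw G" by simp
  define B where "B = cbox (vector [p$1, p$2 - real n]) (vector [p$1 + exp (p$2), p$2 + 1] :: real^2)"
  have B: "q \<in> B \<longleftrightarrow> q$1 \<in> {p$1..p$1 + w} \<and> q$2 \<in> {p$2 - real n..p$2 + 1}" for q
    by (auto simp: B_def w_def mem_box_cart forall_2)
  have "\<bar>pairing f2 dw G\<bar> \<le> (\<mu> * E + 6 * K\<^sup>2 / \<mu>) / 2"
  proof (rule energy_bound[OF _ f(3) energy_nonneg, of _ B "\<lambda>q. K / w"])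
    show "integrable lborel (\<lambda>q. f2 q * tensor dw G q)" by (rule integrable_tensor[OF li(2) sup(1,4)])
    show "B \<in> sets borel" by (simp add: B_def)
    note strip = integral_exp_strip[of p n, folded B_def]
    have eq: "indicator B q * ((K / w)\<^sup>2 * exp (q$2)) = (K / w)\<^sup>2 * (indicator B q * exp (q$2))" for q :: "real^2" by simp
    show "integrable lborel (\<lambda>q. indicator B q * ((K / w)\<^sup>2 * exp (q$2)))"
      unfolding eq using strip(1) by simp
    have "(\<integral>q. indicator B q * ((K / w)\<^sup>2 * exp (q$2)) \<partial>lborel) = (K / w)\<^sup>2 * (\<integral>q. indicator B q * exp (q$2) \<partial>lborel)"
      unfolding eq by simp
    also have "\<dots> \<le> (K / w)\<^sup>2 * (exp (p$2) * exp (p$2 + 1) * (2 - (1/2)^n))"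
      by (rule mult_left_mono[OF strip(2)]) simp
    also have "\<dots> = K\<^sup>2 * (exp 1 * (2 - (1/2)^n))"
      using w by (simp add: exp_add power_divide power2_eq_square flip: w_def)
    \<comment> \<open>Here 3 bounds e and 2 bounds the geometric sum, which gives the constant
      6.\<close>
    also have "\<dots> \<le> K\<^sup>2 * (3 * 2)"
    proof -
      have h: "0 \<le> (1/2::real)^n" "(1/2::real)^n \<le> 1" by (simp, rule power_le_one) auto
      have "exp 1 * (2 - (1/2)^n) \<le> 3 * (2::real)"
        by (rule mult_mono) (use h e_less_272 in linarith)+
      then show ?thesis by (intro mult_left_mono) auto
    qed
    finally show "(\<integral>q. indicator B q * ((K / w)\<^sup>2 * exp (q$2)) \<partial>lborel) \<le> 6 * K\<^sup>2" by simp
    show "\<bar>f2 q * tensor dw G q\<bar> \<le> indicator B q * (K / w * sqrt (energy f q))" for q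
    proof (cases "q \<in> B")
      case True
      have "\<bar>tensor dw G q\<bar> \<le> (K / w) * 1" unfolding abs_mult using K w by (intro mult_mono bd) auto
      then have "\<bar>f2 q\<bar> * \<bar>tensor dw G q\<bar> \<le> sqrt (energy f q) * (K / w)"
        using energy_bounds(2)[of f q] energy_nonneg[of f q] unfolding f2_def by (intro mult_mono) auto
      then show ?thesis using True by (simp add: abs_mult mult_ac)
    next
      case False
      then have "tensor dw G q = 0" using sup(1,4) unfolding supported_def B by force
      then show ?thesis using False by simp
    qed
    have "B \<in> sets hvol" by (simp add: hvol_def B_def)
    from integrable_real_mult_indicator[OF this f(3)] have "integrable hvol (\<lambda>q. indicator B q * energy f q)"
      by (simp add: mult.commute)
    then have "(\<integral>q. indicator B q * energy f q \<partial>hvol) \<le> (\<integral>q. energy f q \<partial>hvol)"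
      using f(3) energy_nonneg by (intro integral_mono) (auto simp: indicator_def)
    then show "(\<integral>q. indicator B q * energy f q \<partial>hvol) \<le> E" using E by linarith
  qed (rule \<mu>)
  moreover have "\<bar>pairing f dw dn\<bar> \<le> e"
  proof -
    let ?b = "cbox (vector [p$1, p$2 - real n]) (vector [p$1 + w, p$2 - real n + 1]) :: (real^2) set"
    have c: "continuous_on UNIV (\<lambda>q::real^2. e / w)" by simp
    have b: "integrable lborel (\<lambda>q. indicator ?b q * (e / w))"
      "(\<integral>q. indicator ?b q * (e / w) \<partial>lborel) \<le> e / w * ((p$1 + w - p$1) * (p$2 - real n + 1 - (p$2 - real n)))"
      using w e by (intro box_integral_le(1)[OF c, where M = "e / w"]; simp) (rule box_integral_le(2)[OF c]; use w e in simp)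
    have "\<bar>f q * tensor dw dn q\<bar> \<le> indicator ?b q * (e / w)" for q
    proof (cases "q \<in> ?b")
      case True
      then have "q$2 \<le> p$2 - real n + 1" by (simp add: mem_box_cart forall_2)
      then have "\<bar>q$2\<bar> \<ge> R" using n by linarith
      then have "norm q \<ge> R" using component_le_norm_cart[of q 2] by linarith
      then have "\<bar>f q\<bar> \<le> e / K\<^sup>2" using R by (simp add: less_imp_le)
      moreover have "\<bar>tensor dw dn q\<bar> \<le> (K / w) * K" unfolding abs_mult using K w by (intro mult_mono bd) auto
      ultimately have "\<bar>f q\<bar> * \<bar>tensor dw dn q\<bar> \<le> (e / K\<^sup>2) * ((K / w) * K)" using e by (intro mult_mono) auto
      then show ?thesis using True K by (simp add: abs_mult power2_eq_square)
    next
      case False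
      then have "tensor dw dn q = 0" using sup(1,3) unfolding supported_def by (auto simp: mem_box_cart forall_2)
      then show ?thesis using False by simp
    qed
    then have "(\<integral>q. \<bar>f q * tensor dw dn q\<bar> \<partial>lborel) \<le> (\<integral>q. indicator ?b q * (e / w) \<partial>lborel)"
      using integrable_tensor[OF li(1) sup(1,3)] b(1) by (intro integral_mono) auto
    also have "\<dots> \<le> e" using b(2) w by simp
    finally show ?thesis using integral_abs_bound[of lborel "\<lambda>q. f q * tensor dw dn q"] by linarith
  qed
  ultimately show "\<bar>pairing f (dstep (p$1) (exp (p$2))) (dstep (p$2) 1)\<bar> \<le> (\<mu> * E + 6 * step_const\<^sup>2 / \<mu>) / 2 + e"
    using eq unfolding dw_def d1_def w_def K_def by (smt (verit) abs_triangle_ineq)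
qed

text \<open>Decay at infinity takes the place of square integrability through
  \<open>far_average\<close>; the result involves only what \<open>sobolev_norm\<close>
  measures.\<close>

lemma sobolev_sup_global:
  "\<exists>C>0. \<forall>f p \<mu> E. continuous_on UNIV f \<longrightarrow> weakly_C2 f \<longrightarrow> integrable hvol (energy f) \<longrightarrow> (f \<longlongrightarrow> 0) at_infinity \<longrightarrow>
    \<mu> > 0 \<longrightarrow> (\<integral>q. energy f q \<partial>hvol) \<le> E \<longrightarrow> \<bar>f p\<bar> \<le> C * (\<mu> * E + 1 / \<mu>)"
proof -
  obtain C where C: "C > 0" "\<forall>f p \<mu> E. continuous_on UNIV f \<longrightarrow> weakly_C2 f \<longrightarrow> integrable hvol (energy f) \<longrightarrow> \<mu> > 0 \<longrightarrow>
    (\<integral>q. indicator (hbox p) q * energy f q \<partial>hvol) \<le> E \<longrightarrow>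
    \<bar>\<integral>q. f q * tensor (dstep (p$1) (exp (p$2))) (dstep (p$2) 1) q \<partial>lborel\<bar> \<le> (\<mu> * E + (3 * step_const\<^sup>2)\<^sup>2 / \<mu>) / 2 \<longrightarrow>
    \<bar>f p\<bar> \<le> C * (\<mu> * E + 1 / \<mu>)" using sup_le_average by blast
  have "\<bar>f p\<bar> \<le> C * (\<mu> * E + 1 / \<mu>)"
    if f: "continuous_on UNIV f" "weakly_C2 f" "integrable hvol (energy f)" "(f \<longlongrightarrow> 0) at_infinity" and \<mu>: "\<mu> > 0"
      and E: "(\<integral>q. energy f q \<partial>hvol) \<le> E" for f p \<mu> E
  proof -
    have "hbox p \<in> sets hvol" by (simp add: hvol_def hbox_def)
    from integrable_real_mult_indicator[OF this f(3)] have "integrable hvol (\<lambda>q. indicator (hbox p) q * energy f q)"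
      by (simp add: mult.commute)
    then have "(\<integral>q. indicator (hbox p) q * energy f q \<partial>hvol) \<le> (\<integral>q. energy f q \<partial>hvol)"
      using f(3) energy_nonneg by (intro integral_mono) (auto simp: indicator_def)
    then have 1: "(\<integral>q. indicator (hbox p) q * energy f q \<partial>hvol) \<le> E" using E by linarith
    have "1 * 1 \<le> step_const * step_const" using step_const(1) by (intro mult_mono) auto
    then have s: "1 \<le> step_const\<^sup>2" by (simp add: power2_eq_square)
    have "6 * step_const\<^sup>2 * 1 \<le> 9 * step_const\<^sup>2 * step_const\<^sup>2" using s by (intro mult_mono) auto
    then have "6 * step_const\<^sup>2 \<le> (3 * step_const\<^sup>2)\<^sup>2" by (simp add: power2_eq_square)
    then have "6 * step_const\<^sup>2 / \<mu> \<le> (3 * step_const\<^sup>2)\<^sup>2 / \<mu>" using \<mu> by (intro divide_right_mono) auto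
    moreover have "a \<le> b \<Longrightarrow> (x + a) / 2 \<le> (x + b) / 2" for a b x :: real by simp
    ultimately have "(\<mu> * E + 6 * step_const\<^sup>2 / \<mu>) / 2 \<le> (\<mu> * E + (3 * step_const\<^sup>2)\<^sup>2 / \<mu>) / 2" by blast
    from order_trans[OF far_average[OF f \<mu> E] this] show ?thesis using C(2) f \<mu> 1 by blast
  qed
  then show ?thesis using C(1) by blast
qed

text \<open>By dominated convergence the squared density has little mass outside a large ball, and
  \<open>hbox p\<close> lies outside that ball once p is far enough, so
  \<open>sobolev_sup_local\<close> applies with small integral.\<close>

lemma sobolev_decay:
  assumes f: "continuous_on UNIV f" "weakly_C2 f" "integrable hvol (nabla_normsq 0 f)" "integrable hvol (energy f)"
  shows "(f \<longlongrightarrow> 0) at_infinity"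
proof (rule tendstoI)
  fix e :: real assume e: "e > 0"
  obtain C where C: "C > 0" "\<forall>f p \<mu>. continuous_on UNIV f \<longrightarrow> weakly_C2 f \<longrightarrow> integrable hvol (nabla_normsq 0 f) \<longrightarrow> integrable hvol (energy f) \<longrightarrow>
    \<mu> > 0 \<longrightarrow> \<bar>f p\<bar> \<le> C * (\<mu> * (\<integral>q. indicator (hbox p) q * (nabla_normsq 0 f q + energy f q) \<partial>hvol) + 1 / \<mu>)"
    using sobolev_sup_local by blast
  define N where "N q = nabla_normsq 0 f q + energy f q" for q
  have N0: "N q \<ge> 0" for q using nabla_normsq_nonneg[of 0 f q] energy_nonneg[of f q] by (simp add: N_def)
  have N: "integrable hvol N" unfolding N_def using f by simp
  have ms: "S \<in> sets hvol \<longleftrightarrow> S \<in> sets borel" for S by (simp add: hvol_def)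
  have iN: "integrable hvol (\<lambda>q. indicator S q * N q)" if "S \<in> sets borel" for S
    using integrable_real_mult_indicator[OF _ N, of S] that by (simp add: mult.commute ms)
  have "(\<lambda>n. \<integral>q. indicator (- cball 0 (real n)) q * N q \<partial>hvol) \<longlonglongrightarrow> (\<integral>q. 0 \<partial>hvol)"
  proof (rule integral_dominated_convergence[where w = N])
    show "(\<lambda>q. indicator (- cball 0 (real n)) q * N q) \<in> borel_measurable hvol" for n
      by (rule borel_measurable_integrable[OF iN]) auto
    show "AE q in hvol. (\<lambda>n. indicator (- cball 0 (real n)) q * N q) \<longlonglongrightarrow> 0"
    proof (rule AE_I2, rule tendsto_eventually)
      fix q :: "real^2"
      obtain m where "norm q \<le> real m" using real_arch_simple by blast
      then show "\<forall>\<^sub>F n in sequentially. indicator (- cball 0 (real n)) q * N q = 0"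
        unfolding eventually_sequentially by (intro exI[of _ m]) (auto simp: indicator_def)
    qed
    show "AE q in hvol. norm (indicator (- cball 0 (real n)) q * N q) \<le> N q" for n
      using N0 by (intro AE_I2) (auto simp: indicator_def)
  qed (use N in auto)
  \<comment> \<open>With mass at most d = 1 / \<mu>^2 outside the ball, both terms of the local
    bound are at most C / \<mu> = e / 4, and their sum e / 2 is below e.\<close>
  define \<mu> where "\<mu> = 4 * C / e"
  have \<mu>: "\<mu> > 0" using C(1) e by (simp add: \<mu>_def)
  define d where "d = 1 / (\<mu> * \<mu>)"
  have d: "d > 0" using \<mu> by (simp add: d_def)
  have "\<forall>\<^sub>F n in sequentially. dist (\<integral>q. indicator (- cball 0 (real n)) q * N q \<partial>hvol) (\<integral>q. 0 \<partial>hvol) < d"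
    using \<open>_ \<longlonglongrightarrow> _\<close> d by (rule tendstoD)
  then obtain n where n: "\<bar>\<integral>q. indicator (- cball 0 (real n)) q * N q \<partial>hvol\<bar> < d"
    by (auto simp: eventually_sequentially dist_real_def)
  \<comment> \<open>If \<open>hbox p\<close> met the ball of radius n, then |p2| would be at most n
    + 1 and |p1| at most n + exp(n + 1).\<close>
  have "\<bar>f p\<bar> < e" if p: "norm p > 2 * real n + 1 + exp (real n + 1)" for p
  proof -
    have "q \<in> - cball 0 (real n)" if q: "q \<in> hbox p" for q
    proof (rule ccontr)
      assume "\<not> q \<in> - cball 0 (real n)"
      then have "norm q \<le> real n" by simp
      then have "\<bar>q$1\<bar> \<le> real n" "\<bar>q$2\<bar> \<le> real n"
        using component_le_norm_cart[of q 1] component_le_norm_cart[of q 2] by linarith+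
      then have 2: "\<bar>p$2\<bar> \<le> real n + 1" and 3: "\<bar>p$1\<bar> \<le> real n + exp (p$2)"
        using q by (auto simp: mem_hbox)
      have 4: "exp (p$2) \<le> exp (real n + 1)" using 2 by simp
      have "norm p \<le> 2 * real n + 1 + exp (real n + 1)" using 2 3 4 norm_le_l1_cart[of p] unfolding sum_2 by linarith
      then show False using p by simp
    qed
    then have "(\<integral>q. indicator (hbox p) q * N q \<partial>hvol) \<le> (\<integral>q. indicator (- cball 0 (real n)) q * N q \<partial>hvol)"
      using N0 by (intro integral_mono iN) (auto simp: hbox_def indicator_def)
    then have "\<mu> * (\<integral>q. indicator (hbox p) q * N q \<partial>hvol) \<le> \<mu> * d" using n \<mu> by (intro mult_left_mono) auto
    also have "\<dots> = 1 / \<mu>" using \<mu> by (simp add: d_def)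
    finally have "C * (\<mu> * (\<integral>q. indicator (hbox p) q * N q \<partial>hvol) + 1 / \<mu>) \<le> C * (1 / \<mu> + 1 / \<mu>)"
      using C(1) by (intro mult_left_mono) auto
    also have "\<dots> = e / 2" using C(1) e by (simp add: \<mu>_def field_simps)
    finally show ?thesis using C(2)[rule_format, OF f \<mu>, of p] e unfolding N_def by linarith
  qed
  then show "\<forall>\<^sub>F p in at_infinity. dist (f p) 0 < e"
    unfolding eventually_at_infinity
    by (intro exI[of _ "2 * real n + 2 + exp (real n + 1)"]) (auto simp: dist_real_def)
qed

section \<open>Differences of Sobolev functions\<close>

lemma test_function_partial:
  assumes "test_function \<phi>" shows "test_function (partial i \<phi>)"
proof -
  have sm: "Ck (Suc k) \<phi>" for k using assms by (simp only: test_function_def smooth_def)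
  then have "smooth (partial i \<phi>)" by (simp add: smooth_def)
  moreover have "{p. partial i \<phi> p \<noteq> 0} \<subseteq> closure {p. \<phi> p \<noteq> 0}"
  proof (rule ccontr)
    assume "\<not> ?thesis"
    then obtain p where p: "partial i \<phi> p \<noteq> 0" "p \<in> - closure {p. \<phi> p \<noteq> 0}" by blast
    have "open (- closure {p. \<phi> p \<noteq> 0})" by (intro open_Compl closed_closure)
    then obtain d where d: "d > 0" "ball p d \<subseteq> - closure {p. \<phi> p \<noteq> 0}" using p(2) open_contains_ball by blast
    have z: "\<phi> q = 0" if "dist p q < d" for q
      using d(2) that closure_subset[of "{p. \<phi> p \<noteq> 0}"] by (auto simp: subset_eq)
    have "((\<lambda>r. \<phi> (p + r *\<^sub>R axis i 1)) has_real_derivative 0) (at 0)"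
    proof (rule has_field_derivative_transform_within_open[where f = "\<lambda>r. 0"])
      show "0 = \<phi> (p + r *\<^sub>R axis i 1)" if "r \<in> {-d<..<d}" for r
        using that z[of "p + r *\<^sub>R axis i 1"] by (simp add: dist_norm abs_less_iff)
    qed (use d in auto)
    then show False using partial_eqI p(1) by blast
  qed
  then have "closure {p. partial i \<phi> p \<noteq> 0} \<subseteq> closure {p. \<phi> p \<noteq> 0}" by (simp add: closure_minimal)
  then have "compact (closure {p. partial i \<phi> p \<noteq> 0})"
    using assms closed_closure unfolding test_function_def compact_eq_bounded_closed by (metis bounded_subset)
  ultimately show ?thesis by (simp add: test_function_def)
qed

lemma locally_integrable_diff:
  "locally_integrable f \<Longrightarrow> locally_integrable g \<Longrightarrow> locally_integrable (\<lambda>p. f p - g p)"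
  by (auto simp: locally_integrable_def set_integrable_def right_diff_distrib)

lemma is_weak_partial_diff:
  assumes "is_weak_partial i f f'" "is_weak_partial i g g'"
  shows "is_weak_partial i (\<lambda>p. f p - g p) (\<lambda>p. f' p - g' p)"
proof -
  have li: "locally_integrable f" "locally_integrable f'" "locally_integrable g" "locally_integrable g'"
    using assms by (auto simp: is_weak_partial_def)
  have "(\<integral>p. (f p - g p) * partial i \<phi> p \<partial>lborel) = - (\<integral>p. (f' p - g' p) * \<phi> p \<partial>lborel)" if t: "test_function \<phi>" for \<phi>
    using assms t integrable_mult_test_function[OF li(1) test_function_partial[OF t]] integrable_mult_test_function[OF li(2) t]
      integrable_mult_test_function[OF li(3) test_function_partial[OF t]] integrable_mult_test_function[OF li(4) t]
    by (simp add: left_diff_distrib is_weak_partial_def)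
  then show ?thesis using li locally_integrable_diff by (auto simp: is_weak_partial_def)
qed

lemma is_weak_partial_cong_AE:
  assumes "is_weak_partial i f g" "AE p in lborel. f p = f' p" "locally_integrable f'"
  shows "is_weak_partial i f' g"
proof -
  have m: "f \<in> borel_measurable borel" "f' \<in> borel_measurable borel"
    using assms locally_integrable_measurable by (auto simp: is_weak_partial_def)
  have "(\<integral>p. f' p * partial i \<phi> p \<partial>lborel) = (\<integral>p. f p * partial i \<phi> p \<partial>lborel)" if t: "test_function \<phi>" for \<phi>
  proof (rule integral_cong_AE)
    have "Ck 0 (partial i \<phi>)" using test_function_partial[OF t] unfolding test_function_def smooth_def by blast
    then have "continuous_on UNIV (partial i \<phi>)" by simp
    then have "partial i \<phi> \<in> borel_measurable borel" by (rule borel_measurable_continuous_onI)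
    then show "(\<lambda>p. f' p * partial i \<phi> p) \<in> borel_measurable lborel" "(\<lambda>p. f p * partial i \<phi> p) \<in> borel_measurable lborel"
      using m by auto
    show "AE p in lborel. f' p * partial i \<phi> p = f p * partial i \<phi> p" using assms(2) by eventually_elim simp
  qed
  then show ?thesis using assms by (simp add: is_weak_partial_def)
qed

lemma weak_partial_works: "is_weak_partial i f g \<Longrightarrow> is_weak_partial i f (weak_partial i f)"
  unfolding weak_partial_def by (rule someI[of "is_weak_partial i f"])

text \<open>Linearity of \<open>weak_partial\<close> holds only almost everywhere. For second
  derivatives the chosen first derivative of h must first be exchanged for the difference of the
  chosen ones, which \<open>is_weak_partial_cong_AE\<close> permits.\<close>

lemma weakly_C2_diff:
  assumes f: "weakly_C2 f" and g: "weakly_C2 g"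
  defines "h \<equiv> \<lambda>p. f p - g p"
  shows "weakly_C2 h" and "AE p in lborel. weak_partial i h p = weak_partial i f p - weak_partial i g p"
    and "AE p in lborel. weak_partial j (weak_partial i h) p = weak_partial j (weak_partial i f) p - weak_partial j (weak_partial i g) p"
proof -
  have 1: "is_weak_partial i h (\<lambda>p. weak_partial i f p - weak_partial i g p)" for i
    using f g unfolding h_def weakly_C2_def by (intro is_weak_partial_diff) auto
  have 2: "is_weak_partial i h (weak_partial i h)" for i using weak_partial_works[OF 1] .
  have 3: "AE p in lborel. weak_partial i h p = weak_partial i f p - weak_partial i g p" for i
    using weak_partial_unique[OF 2 1] .
  have li: "locally_integrable (weak_partial i h)" for i using 2[of i] by (simp add: is_weak_partial_def)
  have 4: "is_weak_partial j (weak_partial i h) (\<lambda>p. weak_partial j (weak_partial i f) p - weak_partial j (weak_partial i g) p)" for i j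
  proof (rule is_weak_partial_cong_AE[OF _ _ li])
    show "is_weak_partial j (\<lambda>p. weak_partial i f p - weak_partial i g p) (\<lambda>p. weak_partial j (weak_partial i f) p - weak_partial j (weak_partial i g) p)"
      using f g unfolding weakly_C2_def by (intro is_weak_partial_diff) auto
    show "AE p in lborel. weak_partial i f p - weak_partial i g p = weak_partial i h p" using 3[of i] by eventually_elim simp
  qed
  have 5: "is_weak_partial j (weak_partial i h) (weak_partial j (weak_partial i h))" for i j using weak_partial_works[OF 4] .
  show "weakly_C2 h" using 2 5 by (simp add: weakly_C2_def)
  show "AE p in lborel. weak_partial i h p = weak_partial i f p - weak_partial i g p" by (rule 3)
  show "AE p in lborel. weak_partial j (weak_partial i h) p = weak_partial j (weak_partial i f) p - weak_partial j (weak_partial i g) p"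
    by (rule weak_partial_unique[OF 5 4])
qed

lemma energy_eq:
  "energy f p = exp (2 * p$2) * (weak_partial 1 f p)\<^sup>2 + (weak_partial 2 f p)\<^sup>2 +
     (exp (2 * p$2) * exp (2 * p$2) * (weak_partial 1 (weak_partial 1 f) p - exp (- 2 * p$2) * weak_partial 2 f p)\<^sup>2
      + exp (2 * p$2) * (weak_partial 1 (weak_partial 2 f) p + weak_partial 1 f p)\<^sup>2
      + exp (2 * p$2) * (weak_partial 2 (weak_partial 1 f) p + weak_partial 1 f p)\<^sup>2
      + (weak_partial 2 (weak_partial 2 f) p)\<^sup>2)"
  unfolding energy_def nabla_normsq_1 nabla_normsq_2 nabla_2 sum_2 by simp

lemma energy_measurable:
  assumes "weakly_C2 f" shows "energy f \<in> borel_measurable borel"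
proof -
  have [measurable]: "weak_partial i f \<in> borel_measurable borel" "weak_partial j (weak_partial i f) \<in> borel_measurable borel" for i j
    using assms by (auto simp: weakly_C2_def is_weak_partial_def intro: locally_integrable_measurable)
  have [measurable]: "(\<lambda>p::real^2. exp (c * p$2)) \<in> borel_measurable borel" for c :: real
    by (intro borel_measurable_continuous_onI continuous_intros)
  show ?thesis unfolding energy_eq[abs_def] by measurable
qed

text \<open>Termwise (x - y)^2 \<le> 2 x^2 + 2 y^2 for the six squares of \<open>energy_eq\<close>,
  outside a null set; null sets for \<open>lborel\<close> are null for \<open>hvol\<close> as
  well.\<close>

lemma energy_diff_integrable:
  assumes f: "weakly_C2 f" "integrable hvol (energy f)" and g: "weakly_C2 g" "integrable hvol (energy g)"
  shows "integrable hvol (energy (\<lambda>p. f p - g p))"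
proof (rule Bochner_Integration.integrable_bound)
  define h where "h p = f p - g p" for p
  note d = weakly_C2_diff[OF f(1) g(1), folded h_def[abs_def]]
  have sets: "sets hvol = sets borel" by (simp add: hvol_def)
  show "integrable hvol (\<lambda>p. 2 * (energy f p + energy g p))" using f g by simp
  show "energy (\<lambda>p. f p - g p) \<in> borel_measurable hvol"
    using energy_measurable[OF d(1)] measurable_cong_sets[OF sets refl] unfolding h_def by blast
  have "AE p in lborel. energy h p \<le> 2 * (energy f p + energy g p)"
    using d(2)[of 1] d(2)[of 2] d(3)[of 1 1] d(3)[of 1 2] d(3)[of 2 1] d(3)[of 2 2]
  proof eventually_elim
    case (elim p)
    have sq: "c * (x - y)\<^sup>2 \<le> 2 * (c * x\<^sup>2 + c * y\<^sup>2)" if "c \<ge> 0" for c x y :: real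
    proof -
      have "0 \<le> c * (x + y)\<^sup>2" using that by simp
      then show ?thesis by (simp add: power2_eq_square algebra_simps)
    qed
    define e where "e = exp (2 * p$2)"
    have e: "0 \<le> e" "0 \<le> e * e" by (simp_all add: e_def)
    have r: "weak_partial 1 (weak_partial 1 f) p - weak_partial 1 (weak_partial 1 g) p - exp (- 2 * p$2) * (weak_partial 2 f p - weak_partial 2 g p)
       = (weak_partial 1 (weak_partial 1 f) p - exp (- 2 * p$2) * weak_partial 2 f p) - (weak_partial 1 (weak_partial 1 g) p - exp (- 2 * p$2) * weak_partial 2 g p)"
      "weak_partial i (weak_partial j f) p - weak_partial i (weak_partial j g) p + (weak_partial 1 f p - weak_partial 1 g p)
       = (weak_partial i (weak_partial j f) p + weak_partial 1 f p) - (weak_partial i (weak_partial j g) p + weak_partial 1 g p)" for i j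
      by (simp_all add: algebra_simps)
    have arith: "\<lbrakk>a \<le> 2 * (a1 + a2); b \<le> 2 * (b1 + b2); c \<le> 2 * (c1 + c2); d \<le> 2 * (d1 + d2); k \<le> 2 * (k1 + k2); l \<le> 2 * (l1 + l2)\<rbrakk>
      \<Longrightarrow> a + b + (c + d + k + l) \<le> 2 * (a1 + b1 + (c1 + d1 + k1 + l1) + (a2 + b2 + (c2 + d2 + k2 + l2)))"
      for a a1 a2 b b1 b2 c c1 c2 d d1 d2 k k1 k2 l l1 l2 :: real
      unfolding distrib_left by linarith
    show ?case
      unfolding energy_eq elim r e_def[symmetric]
      by (rule arith[OF sq[OF e(1)] sq[OF zero_le_one, unfolded mult_1] sq[OF e(2)] sq[OF e(1)] sq[OF e(1)] sq[OF zero_le_one, unfolded mult_1]])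
  qed
  then have "AE p in hvol. energy h p \<le> 2 * (energy f p + energy g p)"
    unfolding hvol_def by (subst AE_density) (auto intro!: borel_measurable_continuous_onI continuous_intros)
  then show "AE p in hvol. norm (energy (\<lambda>p. f p - g p) p) \<le> norm (2 * (energy f p + energy g p))"
    unfolding h_def[symmetric]
    by (rule AE_mp) (auto intro!: AE_I2 simp: abs_of_nonneg energy_nonneg)
qed

lemma sobolev_weakly_C2:
  assumes "f \<in> sobolev 3"
  shows "weakly_C2 f" "integrable hvol (nabla_normsq 0 f)" "integrable hvol (energy f)"
proof -
  have "weakly_differentiable 3 f" and i: "\<forall>l\<le>3. integrable hvol (nabla_normsq l f)" using assms by (auto simp: sobolev_def)
  then show "weakly_C2 f"
    unfolding numeral_3_eq_3 weakly_differentiable.simps weakly_C2_def by (blast intro: weak_partial_works)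
  show "integrable hvol (nabla_normsq 0 f)" using i by auto
  have "energy f = (\<lambda>p. nabla_normsq 1 f p + nabla_normsq 2 f p)" by (auto simp: energy_def)
  then show "integrable hvol (energy f)" using i by auto
qed

lemma sobolev_norm_nonneg: "0 \<le> sobolev_norm k f"
  unfolding sobolev_norm_def by (intro real_sqrt_ge_zero sum_nonneg integral_nonneg_AE AE_I2 nabla_normsq_nonneg)

lemma energy_le_sobolev_norm:
  assumes "integrable hvol (energy f)" "weakly_C2 f"
  shows "(\<integral>p. energy f p \<partial>hvol) \<le> (sobolev_norm 3 f)\<^sup>2"
proof -
  have sets: "sets hvol = sets borel" by (simp add: hvol_def)
  have [measurable]: "weak_partial i f \<in> borel_measurable borel" for i
    using assms(2) by (auto simp: weakly_C2_def is_weak_partial_def intro: locally_integrable_measurable)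
  have [measurable]: "(\<lambda>p::real^2. exp (c * p$2)) \<in> borel_measurable borel" for c :: real
    by (intro borel_measurable_continuous_onI continuous_intros)
  have "nabla_normsq 1 f \<in> borel_measurable borel" unfolding nabla_normsq_1[abs_def] by measurable
  then have m: "nabla_normsq 1 f \<in> borel_measurable hvol" using measurable_cong_sets[OF sets refl] by blast
  have "norm (nabla_normsq 1 f p) \<le> norm (energy f p)" for p
    using nabla_normsq_nonneg[of 1 f p] nabla_normsq_nonneg[of 2 f p] by (simp add: energy_def)
  then have i1: "integrable hvol (nabla_normsq 1 f)"
    using Bochner_Integration.integrable_bound[OF assms(1) m] by blast
  have i2: "integrable hvol (nabla_normsq 2 f)"
    using Bochner_Integration.integrable_diff[OF assms(1) i1] by (simp add: energy_def)
  have "(\<integral>p. energy f p \<partial>hvol) = (\<integral>p. nabla_normsq 1 f p \<partial>hvol) + (\<integral>p. nabla_normsq 2 f p \<partial>hvol)"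
    unfolding energy_def by (rule Bochner_Integration.integral_add[OF i1 i2])
  also have "\<dots> \<le> (\<Sum>l=1..3. \<integral>p. nabla_normsq l f p \<partial>hvol)"
  proof -
    have "{1..3::nat} = {1, 2, 3}" by auto
    \<comment> \<open>Only nonnegativity of the third order integral is used; without integrability
      it has the default value 0, so integrability of that term need not be established for
      differences.\<close>
    then show ?thesis using nabla_normsq_nonneg[of 3 f] by (simp add: integral_nonneg_AE)
  qed
  also have "\<dots> = (sobolev_norm 3 f)\<^sup>2"
    unfolding sobolev_norm_def by (subst real_sqrt_pow2) (auto intro!: sum_nonneg integral_nonneg_AE AE_I2 nabla_normsq_nonneg)
  finally show ?thesis .
qed

section \<open>Uniform estimates in time\<close>

text \<open>Finite subcover; monotonicity in R lets the maximum of finitely many local bounds serve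
  everywhere. It is applied both to radii of decay and to sup bounds.\<close>

lemma compact_locally_uniform:
  fixes S :: "real set" and P :: "real \<Rightarrow> real \<Rightarrow> bool"
  assumes "compact S" and mono: "\<And>t R R'. P t R \<Longrightarrow> R \<le> R' \<Longrightarrow> P t R'"
    and loc: "\<And>t. t \<in> S \<Longrightarrow> \<exists>\<delta>>0. \<exists>R. \<forall>r\<in>S. dist t r < \<delta> \<longrightarrow> P r R"
  shows "\<exists>R. \<forall>t\<in>S. P t R"
proof -
  obtain \<delta> R where d: "\<And>t. t \<in> S \<Longrightarrow> \<delta> t > 0" "\<And>t r. t \<in> S \<Longrightarrow> r \<in> S \<Longrightarrow> dist t r < \<delta> t \<Longrightarrow> P r (R t)"
    using loc by metis
  have "S \<subseteq> (\<Union>t\<in>S. ball t (\<delta> t))" using d(1) by (auto intro: centre_in_ball[THEN iffD2])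
  then obtain D where D: "D \<subseteq> S" "finite D" "S \<subseteq> (\<Union>t\<in>D. ball t (\<delta> t))"
    using compactE_image[OF assms(1), of S "\<lambda>t. ball t (\<delta> t)"] by auto
  have "P r (Max (R ` D))" if "r \<in> S" for r
  proof -
    obtain t where t: "t \<in> D" "dist t r < \<delta> t" using D(3) \<open>r \<in> S\<close> by auto
    then have "P r (R t)" using d(2)[of t r] D(1) \<open>r \<in> S\<close> by auto
    then show ?thesis using mono D(2) t(1) by (meson Max_ge finite_imageI imageI)
  qed
  then show ?thesis by blast
qed

text \<open>The choice \<mu> = 1 / s balances the two terms of \<open>sobolev_sup_global\<close>. A
  separate s > 0 is kept since the norm may be 0.\<close>

lemma sup_le_sobolev_norm:
  "\<exists>C>0. \<forall>f p s. continuous_on UNIV f \<longrightarrow> weakly_C2 f \<longrightarrow> integrable hvol (energy f) \<longrightarrow> (f \<longlongrightarrow> 0) at_infinity \<longrightarrow>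
    s > 0 \<longrightarrow> sobolev_norm 3 f \<le> s \<longrightarrow> \<bar>f p\<bar> \<le> C * s"
proof -
  obtain C where C: "C > 0" "\<forall>f p \<mu> E. continuous_on UNIV f \<longrightarrow> weakly_C2 f \<longrightarrow> integrable hvol (energy f) \<longrightarrow> (f \<longlongrightarrow> 0) at_infinity \<longrightarrow>
    \<mu> > 0 \<longrightarrow> (\<integral>q. energy f q \<partial>hvol) \<le> E \<longrightarrow> \<bar>f p\<bar> \<le> C * (\<mu> * E + 1 / \<mu>)" using sobolev_sup_global by blast
  have "\<bar>f p\<bar> \<le> (2 * C) * s" if f: "continuous_on UNIV f" "weakly_C2 f" "integrable hvol (energy f)" "(f \<longlongrightarrow> 0) at_infinity"
    and s: "s > 0" "sobolev_norm 3 f \<le> s" for f p s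
  proof -
    have "(sobolev_norm 3 f)\<^sup>2 \<le> s\<^sup>2" using s sobolev_norm_nonneg by (intro power_mono) auto
    then have "(\<integral>q. energy f q \<partial>hvol) \<le> s\<^sup>2" using energy_le_sobolev_norm[OF f(3,2)] by linarith
    then have "\<bar>f p\<bar> \<le> C * ((1 / s) * s\<^sup>2 + 1 / (1 / s))" using s(1) by (intro C(2)[rule_format, OF f]) auto
    also have "\<dots> = (2 * C) * s" using s(1) by (simp add: power2_eq_square)
    finally show ?thesis .
  qed
  then show ?thesis using C(1) by (intro exI[of _ "2 * C"]) simp
qed

text \<open>For each t the difference to Q decays by \<open>sobolev_decay\<close>. The difference of
  two times therefore decays too, Q cancels in it, and \<open>sup_le_sobolev_norm\<close> makes it
  uniformly small for nearby times. So decay and boundedness hold locally uniformly in t, and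
  compactness of the time interval finishes.\<close>

lemma sobolev_maps_uniform:
  fixes u :: "real \<Rightarrow> real^3 \<Rightarrow> real^3"
  assumes u: "continuous_into_sobolev_maps T 3 Q u"
    and cont: "\<And>t j. t \<in> {0..T} \<Longrightarrow> continuous_on UNIV (\<lambda>p. coords (u t) p $ j)" "\<And>j. continuous_on UNIV (\<lambda>p. coords Q p $ j)"
  shows "\<And>e. e > 0 \<Longrightarrow> \<exists>R. \<forall>t\<in>{0..T}. \<forall>p j. norm p > R \<longrightarrow> \<bar>coords (u t) p $ j - coords Q p $ j\<bar> \<le> e"
    and "\<exists>K. \<forall>t\<in>{0..T}. \<forall>p j. \<bar>coords (u t) p $ j - coords Q p $ j\<bar> \<le> K"
proof -
  define d where "d t j p = coords (u t) p $ j - coords Q p $ j" for t j p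
  have sob: "d t j \<in> sobolev 3" if "t \<in> {0..T}" for t j
    using u that by (auto simp: continuous_into_sobolev_maps_def sobolev_maps_def d_def[abs_def])
  note sob2 = sobolev_weakly_C2[OF sob]
  have dc: "continuous_on UNIV (d t j)" if "t \<in> {0..T}" for t j
    unfolding d_def by (intro continuous_intros cont that)
  have decay: "(d t j \<longlongrightarrow> 0) at_infinity" if "t \<in> {0..T}" for t j
    by (rule sobolev_decay[OF dc sob2]) (rule that)+
  obtain C where C: "C > 0" "\<forall>f p s. continuous_on UNIV f \<longrightarrow> weakly_C2 f \<longrightarrow> integrable hvol (energy f) \<longrightarrow> (f \<longlongrightarrow> 0) at_infinity \<longrightarrow>
    s > 0 \<longrightarrow> sobolev_norm 3 f \<le> s \<longrightarrow> \<bar>f p\<bar> \<le> C * s" using sup_le_sobolev_norm by blast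
  have close: "\<exists>\<delta>>0. \<forall>r\<in>{0..T}. dist t r < \<delta> \<longrightarrow> (\<forall>p j. \<bar>d r j p - d t j p\<bar> \<le> e)" if t: "t \<in> {0..T}" and e: "e > 0" for t e
  proof -
    have "((\<lambda>r. sobolev_dist 3 (u r) (u t)) \<longlongrightarrow> 0) (at t within {0..T})"
      using u t by (simp add: continuous_into_sobolev_maps_def)
    then have "\<forall>\<^sub>F r in at t within {0..T}. dist (sobolev_dist 3 (u r) (u t)) 0 < e / C"
      using e C(1) by (intro tendstoD) auto
    then obtain \<delta> where \<delta>: "\<delta> > 0" "\<And>r. r \<in> {0..T} \<Longrightarrow> r \<noteq> t \<Longrightarrow> dist r t < \<delta> \<Longrightarrow> dist (sobolev_dist 3 (u r) (u t)) 0 < e / C"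
      by (auto simp: eventually_at)
    have "\<bar>d r j p - d t j p\<bar> \<le> e" if r: "r \<in> {0..T}" "dist t r < \<delta>" for r p j
    \<comment> \<open>The limit at t gives no information about r = t itself.\<close>
    proof (cases "r = t")
      case True then show ?thesis using e by simp
    next
      case False
      have eq: "(\<lambda>p. d r j p - d t j p) = (\<lambda>p. coords (u r) p $ j - coords (u t) p $ j)" by (auto simp: d_def)
      have "sobolev_norm 3 (\<lambda>p. d r j p - d t j p) \<le> sobolev_dist 3 (u r) (u t)"
        unfolding sobolev_dist_def eq by (rule member_le_sum) (auto simp: sobolev_norm_nonneg)
      also have "\<dots> \<le> e / C"
      proof -
        have "dist (sobolev_dist 3 (u r) (u t)) 0 < e / C"
          by (rule \<delta>(2)[OF r(1) False]) (use r(2) in \<open>simp add: dist_commute\<close>)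
        then show ?thesis by (simp add: dist_real_def)
      qed
      finally have n: "sobolev_norm 3 (\<lambda>p. d r j p - d t j p) \<le> e / C" .
      have "\<bar>d r j p - d t j p\<bar> \<le> C * (e / C)"
      proof (rule C(2)[rule_format, where f = "\<lambda>p. d r j p - d t j p", OF _ _ _ _ _ n])
        show "continuous_on UNIV (\<lambda>p. d r j p - d t j p)" by (intro continuous_intros dc r t)
        show "weakly_C2 (\<lambda>p. d r j p - d t j p)" by (rule weakly_C2_diff(1)[OF sob2(1)[OF r(1)] sob2(1)[OF t]])
        show "integrable hvol (energy (\<lambda>p. d r j p - d t j p))"
          by (rule energy_diff_integrable[OF sob2(1)[OF r(1)] sob2(3)[OF r(1)] sob2(1)[OF t] sob2(3)[OF t]])
        show "((\<lambda>p. d r j p - d t j p) \<longlongrightarrow> 0) at_infinity" using tendsto_diff[OF decay[OF r(1)] decay[OF t]] by simp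
      qed (use e C(1) in simp)
      then show ?thesis using C(1) by simp
    qed
    then show ?thesis using \<delta>(1) by blast
  qed
  show "\<exists>R. \<forall>t\<in>{0..T}. \<forall>p j. norm p > R \<longrightarrow> \<bar>coords (u t) p $ j - coords Q p $ j\<bar> \<le> e" if e: "e > 0" for e
    unfolding d_def[symmetric]
  proof (rule compact_locally_uniform[of "{0..T}" "\<lambda>t R. \<forall>p j. norm p > R \<longrightarrow> \<bar>d t j p\<bar> \<le> e"])
    fix t assume t: "t \<in> {0..T}"
    have "\<exists>R. \<forall>p. norm p \<ge> R \<longrightarrow> \<bar>d t j p\<bar> < e / 2" for j
      using tendstoD[OF decay[OF t], of "e / 2" j] e by (simp add: eventually_at_infinity dist_real_def)
    then obtain R where R: "\<And>j p. norm p \<ge> R j \<Longrightarrow> \<bar>d t j p\<bar> < e / 2" by metis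
    obtain \<delta> where \<delta>: "\<delta> > 0" "\<And>r p j. r \<in> {0..T} \<Longrightarrow> dist t r < \<delta> \<Longrightarrow> \<bar>d r j p - d t j p\<bar> \<le> e / 2"
      using close[OF t, of "e / 2"] e by auto
    have "\<bar>d r j p\<bar> \<le> e" if "r \<in> {0..T}" "dist t r < \<delta>" "norm p > max (R 1) (R 2)" for r p j
    proof -
      have "norm p \<ge> R j" using that(3) exhaust_2[of j] by auto
      then show ?thesis using R[of j p] \<delta>(2)[OF that(1,2), of j p] by linarith
    qed
    then show "\<exists>\<delta>>0. \<exists>R. \<forall>r\<in>{0..T}. dist t r < \<delta> \<longrightarrow> (\<forall>p j. norm p > R \<longrightarrow> \<bar>d r j p\<bar> \<le> e)" using \<delta>(1) by blast
  qed auto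
  show "\<exists>K. \<forall>t\<in>{0..T}. \<forall>p j. \<bar>coords (u t) p $ j - coords Q p $ j\<bar> \<le> K"
    unfolding d_def[symmetric]
  proof (rule compact_locally_uniform[of "{0..T}" "\<lambda>t K. \<forall>p j. \<bar>d t j p\<bar> \<le> K"])
    fix t assume t: "t \<in> {0..T}"
    have "\<exists>K. \<forall>p. \<bar>d t j p\<bar> \<le> K" for j
    proof -
      obtain R where R: "\<And>p. norm p \<ge> R \<Longrightarrow> \<bar>d t j p\<bar> < 1"
        using tendstoD[OF decay[OF t], of 1 j] by (auto simp add: eventually_at_infinity dist_real_def)
      obtain K where K: "\<And>p. p \<in> cball 0 R \<Longrightarrow> \<bar>d t j p\<bar> \<le> K"
        using compact_imp_bounded[OF compact_continuous_image[OF continuous_on_subset[OF dc[OF t]] compact_cball]]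
        unfolding bounded_iff by (metis imageI real_norm_def subset_UNIV)
      have "\<bar>d t j p\<bar> \<le> max 1 K" for p using R[of p] K[of p] by (cases "norm p \<le> R") auto
      then show ?thesis by blast
    qed
    then obtain K where K: "\<And>j p. \<bar>d t j p\<bar> \<le> K j" by metis
    obtain \<delta> where \<delta>: "\<delta> > 0" "\<And>r p j. r \<in> {0..T} \<Longrightarrow> dist t r < \<delta> \<Longrightarrow> \<bar>d r j p - d t j p\<bar> \<le> 1"
      using close[OF t, of 1] by auto
    have "\<bar>d r j p\<bar> \<le> max (K 1) (K 2) + 1" if "r \<in> {0..T}" "dist t r < \<delta>" for r p j
    proof -
      have "K j \<le> max (K 1) (K 2)" using exhaust_2[of j] by auto
      then show ?thesis using K[where j=j and p=p] \<delta>(2)[OF that(1,2), of j p] by linarith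
    qed
    then show "\<exists>\<delta>>0. \<exists>K. \<forall>r\<in>{0..T}. dist t r < \<delta> \<longrightarrow> (\<forall>p j. \<bar>d r j p\<bar> \<le> K)" using \<delta>(1) by blast
  qed (auto intro: order_trans)
qed

section \<open>Bounds for the distance in terms of coordinates\<close>

lemma hcosh_le_coords:
  assumes "\<And>j. \<bar>y$j - z$j\<bar> \<le> \<eta>" "\<bar>y$2\<bar> \<le> K" "\<bar>z$2\<bar> \<le> K"
  shows "hcosh y z \<le> cosh \<eta> + \<eta>\<^sup>2 * exp (2 * K) / 2"
proof -
  have "cosh (y$2 - z$2) \<le> cosh \<eta>"
    using assms(1)[of 2] cosh_real_nonneg_le_iff[of "\<bar>y$2 - z$2\<bar>" \<eta>] by (simp add: cosh_real_abs)
  moreover have "(y$1 - z$1)\<^sup>2 \<le> \<eta>\<^sup>2" using assms(1)[of 1] by (metis abs_ge_zero power2_abs power_mono)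
  then have "(y$1 - z$1)\<^sup>2 * exp (- y$2 - z$2) \<le> \<eta>\<^sup>2 * exp (2 * K)"
    using assms(2,3) by (intro mult_mono) auto
  ultimately show ?thesis by (simp add: hcosh_def)
qed

text \<open>Together with \<open>hcosh_le_coords\<close> this moves bounds between coordinates and
  \<open>hcosh\<close>; only finiteness of the constant matters.\<close>

lemma coords_le_hcosh:
  assumes "hcosh y z \<le> L" "\<And>j. \<bar>z$j\<bar> \<le> K"
  shows "\<bar>y$j\<bar> \<le> 2 * L + 2 * L * exp (2 * L + 2 * K) + 1 + K"
proof -
  have L: "L \<ge> 1" using assms(1) hcosh_ge_1[of y z] by linarith
  have nn: "0 \<le> (y$1 - z$1)\<^sup>2 * exp (- y$2 - z$2)" by simp
  have c: "cosh (y$2 - z$2) \<le> L" using assms(1) nn unfolding hcosh_def by linarith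
  have 2: "\<bar>y$2 - z$2\<bar> \<le> 2 * L" using c abs_le_2_cosh[of "y$2 - z$2"] by linarith
  have "(y$1 - z$1)\<^sup>2 * exp (- y$2 - z$2) \<le> 2 * L"
    using assms(1) cosh_real_ge_1[of "y$2 - z$2"] unfolding hcosh_def by linarith
  moreover have "exp (- y$2 - z$2) = 1 / exp (y$2 + z$2)" 
    by (simp add: exp_minus inverse_eq_divide exp_add exp_diff)
  ultimately have "(y$1 - z$1)\<^sup>2 \<le> 2 * L * exp (y$2 + z$2)" by (simp add: field_simps)
  also have "\<dots> \<le> 2 * L * exp (2 * L + 2 * K)" using 2 assms(2)[of 2] L by (intro mult_left_mono) auto
  finally have "(y$1 - z$1)\<^sup>2 \<le> 2 * L * exp (2 * L + 2 * K)" .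
  moreover have "\<bar>y$1 - z$1\<bar> \<le> (y$1 - z$1)\<^sup>2 + 1" by (rule abs_le_square_plus_1)
  moreover have "0 \<le> 2 * L * exp (2 * L + 2 * K)" using L by simp
  ultimately show ?thesis using 2 L assms(2)[of j] exhaust_2[of j] by (elim disjE) auto
qed

lemma bounded_coords:
  assumes "compact (closure (Q ` H2))" "Q ` H2 \<subseteq> H2"
  obtains K where "\<And>p j. \<bar>coords Q p $ j\<bar> \<le> K"
proof -
  obtain M where M: "\<And>x. x \<in> Q ` H2 \<Longrightarrow> norm x \<le> M"
    using compact_imp_bounded[OF assms(1)] closure_subset[of "Q ` H2"] unfolding bounded_iff by blast
  have "\<bar>coords Q p $ j\<bar> \<le> 2 * M + (2 * M * exp (2 * M) + 1)" for p j
  proof -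
    define z where "z = coords Q p"
    have "norm (Psi z) \<le> M" using M Psi_coords[OF assms(2)] Psi_in_H2 unfolding z_def by simp
    moreover have "Psi z $ 1 = height z" by simp
    ultimately have h: "height z \<le> M" using component_le_norm_cart[of "Psi z" 1] by linarith
    then have "2 * height z * exp (2 * height z) \<le> 2 * M * exp (2 * M)"
      using height_ge_1[of z] by (intro mult_mono) auto
    then show ?thesis using height_bounds_norm[of z] component_le_norm_cart[of z j] h unfolding z_def by linarith
  qed
  then show ?thesis using that by blast
qed

text \<open>The initial data satisfy the hypothesis of \<open>heat_flow_decay\<close> with M
  independent of t: outside a large ball u(t) is so close to Q that \<open>hcosh\<close> is below 1
  + \<epsilon>, and inside it a uniform bound B is absorbed by M \<phi> powr (-1/2).\<close>

theorem heat_flow_uniform_decay: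
  assumes Q: "admissible Q" and u: "continuous_into_sobolev_maps T 3 Q u"
    and flow: "\<And>t. t \<in> {0..T} \<Longrightarrow> heat_flow (\<lambda>s. v s t) (u t)" and \<epsilon>: "\<epsilon> > 0"
  shows "\<exists>M. \<forall>t\<in>{0..T}. \<forall>s\<ge>0. \<forall>p. hcosh (coords (v s t) p) (coords Q p) \<le> 1 + \<epsilon> + M * exp (- s / 4)"
proof -
  define q where "q = coords Q"
  have Q': "Q ` H2 \<subseteq> H2" "\<And>j. smooth (\<lambda>p. q p $ j)" "\<And>p. tension partial q p = 0" "compact (closure (Q ` H2))"
    using Q by (auto simp: admissible_def harmonic_map_def q_def)
  have qc: "continuous_on UNIV (\<lambda>p. q p $ j)" for j using Q'(2)[of j, unfolded smooth_def, rule_format, of 0] by simp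
  have q2: "Ck 2 (\<lambda>p. q p $ j)" for j using Q'(2)[of j] by (simp only: smooth_def)
  have qcont: "continuous_on UNIV q" using continuous_on_vec_lambda[of UNIV "\<lambda>i p. q p $ i"] qc by simp
  have vs: "(v s t) ` H2 \<subseteq> H2" if "t \<in> {0..T}" "s \<ge> 0" for s t using flow[OF that(1)] that(2) by (simp add: heat_flow_def)
  have us: "(u t) ` H2 \<subseteq> H2" if "t \<in> {0..T}" for t
    using u that by (simp add: continuous_into_sobolev_maps_def sobolev_maps_def)
  have v0: "coords (v 0 t) p = coords (u t) p" if "t \<in> {0..T}" for t p
    using flow[OF that] Psi_in_H2 by (simp add: heat_flow_def coords_def)
  have vcont: "continuous_on ({0..} \<times> UNIV) (\<lambda>(s, p). coords (v s t) p)" if t: "t \<in> {0..T}" for t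
  proof -
    have c: "continuous_on ({0..} \<times> H2) (\<lambda>y. v (fst y) t (snd y))"
      using flow[OF t] by (simp add: heat_flow_def case_prod_beta)
    have pc: "continuous_on ({0..} \<times> UNIV) (\<lambda>y. (fst y, Psi (snd y)))"
      by (intro continuous_intros continuous_on_compose2[OF continuous_Psi[of UNIV]]) auto
    have "continuous_on ({0..} \<times> UNIV) (\<lambda>y. v (fst y) t (Psi (snd y)))"
      using continuous_on_compose2[OF c pc] Psi_in_H2 by (simp add: image_subset_iff)
    then have "continuous_on ({0..} \<times> UNIV) (\<lambda>y. Psi_inv (v (fst y) t (Psi (snd y))))"
      using vs[OF t] Psi_in_H2 by (intro continuous_on_compose2[OF continuous_Psi_inv]) (auto simp: image_subset_iff)
    moreover have "Psi_inv (v (fst y) t (Psi (snd y))) = (\<lambda>(s, p). coords (v s t) p) y" if "y \<in> {0..} \<times> UNIV" for y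
      using vs[OF t, of "fst y"] that Psi_in_H2 by (auto simp: coords_def inv_Psi_H2 image_subset_iff)
    ultimately show ?thesis by (simp cong: continuous_on_cong)
  qed
  \<comment> \<open>Membership in the Sobolev space determines u(t) only up to null sets; pointwise
    continuity is taken from the heat flow at s = 0, where it is jointly continuous.\<close>
  have ucont: "continuous_on UNIV (\<lambda>p. coords (u t) p $ j)" if t: "t \<in> {0..T}" for t j
  proof -
    have "continuous_on UNIV (\<lambda>p. (\<lambda>(s, p). coords (v s t) p) (0, p))"
      by (rule continuous_on_compose2[OF vcont[OF t]]) (auto intro!: continuous_intros)
    then have "continuous_on UNIV (\<lambda>p. coords (u t) p)" using v0[OF t] by simp
    then show ?thesis by (intro continuous_intros)
  qed
  note unif = sobolev_maps_uniform[OF u ucont qc[unfolded q_def], folded q_def]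
  obtain K where K: "\<And>p j. \<bar>q p $ j\<bar> \<le> K" unfolding q_def using bounded_coords[OF Q'(4,1)] by metis
  obtain K1 where K1: "\<And>t p j. t \<in> {0..T} \<Longrightarrow> \<bar>coords (u t) p $ j - q p $ j\<bar> \<le> K1" using unif(2) by blast
  have K2: "\<bar>coords (u t) p $ j\<bar> \<le> K + K1" if "t \<in> {0..T}" for t p j
    using K[of p j] K1[OF that, of p j] by linarith
  have K0: "K \<ge> 0" using K[of 0 1] by linarith
  have init_bd: "hcosh (coords (u t) p) (q p) \<le> cosh K1 + K1\<^sup>2 * exp (2 * (K + \<bar>K1\<bar>)) / 2" if t: "t \<in> {0..T}" for t p
  proof (rule hcosh_le_coords[OF K1[OF t]])
    show "\<bar>coords (u t) p $ 2\<bar> \<le> K + \<bar>K1\<bar>" "\<bar>q p $ 2\<bar> \<le> K + \<bar>K1\<bar>"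
      using K2[OF t, of p 2] K[of p 2] by linarith+
  qed
  define B where "B = cosh K1 + K1\<^sup>2 * exp (2 * (K + \<bar>K1\<bar>)) / 2"
  have B: "B \<ge> 0" unfolding B_def by (intro add_nonneg_nonneg) auto
  have "\<exists>\<eta>>0. cosh \<eta> + \<eta>\<^sup>2 * exp (2 * (K + \<bar>K1\<bar>)) / 2 \<le> 1 + \<epsilon>"
  proof -
    have "isCont (\<lambda>\<eta>::real. cosh \<eta> + \<eta>\<^sup>2 * exp (2 * (K + \<bar>K1\<bar>)) / 2) 0" by (intro continuous_intros) auto
    then obtain d where d: "d > 0" "\<And>\<eta>. dist \<eta> 0 < d \<Longrightarrow>
        dist (cosh \<eta> + \<eta>\<^sup>2 * exp (2 * (K + \<bar>K1\<bar>)) / 2) (cosh 0 + 0\<^sup>2 * exp (2 * (K + \<bar>K1\<bar>)) / 2) < \<epsilon>"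
      unfolding continuous_at_eps_delta using \<epsilon> by blast
    show ?thesis using d(1) d(2)[of "d / 2"] by (intro exI[of _ "d / 2"]) (auto simp: dist_real_def)
  qed
  then obtain \<eta> where \<eta>: "\<eta> > 0" "cosh \<eta> + \<eta>\<^sup>2 * exp (2 * (K + \<bar>K1\<bar>)) / 2 \<le> 1 + \<epsilon>" by blast
  obtain R where R: "\<And>t p j. t \<in> {0..T} \<Longrightarrow> norm p > R \<Longrightarrow> \<bar>coords (u t) p $ j - q p $ j\<bar> \<le> \<eta>"
    using unif(1)[OF _ \<eta>(1)] by blast
  have "continuous_on (cball 0 R) height" unfolding height_def[abs_def] by (intro continuous_intros) auto
  from compact_imp_bounded[OF compact_continuous_image[OF this compact_cball]]
  obtain h where h: "\<And>p. p \<in> cball 0 R \<Longrightarrow> norm (height p) \<le> h" unfolding bounded_iff by blast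
  \<comment> \<open>Chosen so that M \<phi> powr (-1/2) is at least B on the ball of radius R, where
    \<open>height\<close> is at most \<open>max 1 h\<close>.\<close>
  define M where "M = B * (max 1 h) powr (1/2)"
  have M: "M \<ge> 0" using B by (simp add: M_def)
  have init: "hcosh (coords (u t) p) (q p) \<le> 1 + \<epsilon> + M * height p powr (-1/2)" if t: "t \<in> {0..T}" for t p
  proof (cases "norm p > R")
    case True
    have "hcosh (coords (u t) p) (q p) \<le> cosh \<eta> + \<eta>\<^sup>2 * exp (2 * (K + \<bar>K1\<bar>)) / 2"
      using R[OF t True] K2[OF t, of p 2] K[of p 2] by (intro hcosh_le_coords) auto
    also have "\<dots> \<le> 1 + \<epsilon>" by (rule \<eta>(2))
    also have "\<dots> \<le> 1 + \<epsilon> + M * height p powr (-1/2)" using M by simp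
    finally show ?thesis .
  next
    case False
    then have "height p \<le> max 1 h" using h[of p] by auto
    then have "(max 1 h) powr (-1/2) \<le> height p powr (-1/2)" using height_ge_1[of p] by (intro powr_mono2') auto
    then have "M * (max 1 h) powr (-1/2) \<le> M * height p powr (-1/2)" using M by (intro mult_left_mono)
    moreover have "M * (max 1 h) powr (-1/2) = B" by (simp add: M_def flip: powr_add)
    ultimately show ?thesis using init_bd[OF t, of p] \<epsilon> unfolding B_def[symmetric] by linarith
  qed
  have "hcosh (coords (v S t) p) (q p) \<le> 1 + \<epsilon> + M * exp (- S / 4)" if t: "t \<in> {0..T}" and S: "S \<ge> 0" for t S p
  proof -
    have "bdd_above ((\<lambda>(s, x). hdist (v s t x) (u t x)) ` ({0..S} \<times> H2))"
      using flow[OF t] by (simp add: heat_flow_def)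
    then obtain D where D: "\<And>s x. s \<in> {0..S} \<Longrightarrow> x \<in> H2 \<Longrightarrow> hdist (v s t x) (u t x) \<le> D"
      unfolding bdd_above_def by fastforce
    \<comment> \<open>D, and hence L, may depend on t and S. This is harmless: the resulting bound
      enters \<open>heat_flow_decay\<close> only as its K, on which the conclusion does not
      depend.\<close>
    define L where "L = 2 * exp D + 2 * exp D * exp (2 * exp D + 2 * (K + K1)) + 1 + (K + K1)"
    have vb: "\<bar>coords (v s t) p $ j\<bar> \<le> L" if s: "s \<in> {0..S}" for s p j
    proof -
      have "hcosh (coords (v s t) p) (coords (u t) p) \<le> exp (hdist (Psi (coords (v s t) p)) (Psi (coords (u t) p)))" by (rule hcosh_le)
      also have "\<dots> = exp (hdist (v s t (Psi p)) (u t (Psi p)))" using Psi_coords[OF vs[OF t]] Psi_coords[OF us[OF t]] s by simp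
      also have "\<dots> \<le> exp D" using D[OF s Psi_in_H2] by simp
      finally show ?thesis unfolding L_def by (rule coords_le_hcosh) (rule K2[OF t])
    qed
    have "hcosh (coords (v s t) p) (q p) \<le> cosh (L + K) + (L + K)\<^sup>2 * exp (2 * (L + K)) / 2" if s: "s \<in> {0..S}" for s p
    proof (rule hcosh_le_coords)
      show "\<bar>coords (v s t) p $ j - q p $ j\<bar> \<le> L + K" for j using vb[OF s, of p j] K[of p j] by linarith
      have "L \<ge> 0" using vb[OF s, of p 2] by linarith
      then show "\<bar>coords (v s t) p $ 2\<bar> \<le> L + K" "\<bar>q p $ 2\<bar> \<le> L + K" using vb[OF s, of p 2] K[of p 2] K0 by linarith+
    qed
    note bdd = this
    show ?thesis
    proof (rule heat_flow_decay[where v = "\<lambda>s. coords (v s t)", OF vcont[OF t] qcont _ q2 Q'(3) _ bdd _ _ M S])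
      show "Ck 2 (\<lambda>p. coords (v s t) p $ j)" if "s > 0" for s j using flow[OF t] that by (simp add: heat_flow_def)
      show "((\<lambda>r. coords (v r t) p) has_vector_derivative tension partial (coords (v s t)) p) (at s)" if "s > 0" for s p
        using flow[OF t] that by (simp add: heat_flow_def)
      show "hcosh (coords (v 0 t) p) (q p) \<le> 1 + \<epsilon> + M * height p powr (-1/2)" for p using init[OF t] v0[OF t] by simp
    qed (use \<epsilon> in auto)
  qed
  then show ?thesis unfolding q_def by blast
qed

theorem lemma3p4:
  fixes \<alpha> \<beta> T :: real
    and Q :: "real^3 \<Rightarrow> real^3"
    and u :: "real \<Rightarrow> real^3 \<Rightarrow> real^3"
    and u_tilde :: "real \<Rightarrow> real \<Rightarrow> real^3 \<Rightarrow> real^3"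
  assumes "\<alpha> > 0" and "T > 0"
    and "admissible Q"
    and "continuous_into_sobolev_maps T 3 Q u"
    and "landau_lifshitz_flow \<alpha> \<beta> T u"
    and "\<And>t. t \<in> {0..T} \<Longrightarrow> heat_flow (\<lambda>s. u_tilde s t) (u t)"
  shows "\<exists>Q_inf. harmonic_map Q_inf \<and>
    ((\<lambda>s. SUP (x, t)\<in>H2 \<times> {0..T}. ereal (hdist (u_tilde s t x) (Q_inf x))) \<longlongrightarrow> 0) at_top"
proof (intro exI conjI)
  show harm: "harmonic_map Q" using assms(3) by (simp add: admissible_def)
  have Q: "Q ` H2 \<subseteq> H2" using harm by (simp add: harmonic_map_def)
  have v: "u_tilde s t ` H2 \<subseteq> H2" if "t \<in> {0..T}" "s \<ge> 0" for s t
    using assms(6)[OF that(1)] that(2) by (simp add: heat_flow_def)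
  have small: "\<forall>\<^sub>F s in at_top. \<forall>t\<in>{0..T}. \<forall>x\<in>H2. hdist (u_tilde s t x) (Q x) \<le> e" if e: "e > 0" for e
  proof -
    \<comment> \<open>One \<epsilon> is the excess that never decays, the other bounds the
      exponential term; together they make cosh e.\<close>
    define \<epsilon> where "\<epsilon> = (cosh e - 1) / 2"
    have \<epsilon>: "\<epsilon> > 0" using e cosh_real_strict_mono[of 0 e] by (simp add: \<epsilon>_def)
    have \<epsilon>2: "2 * \<epsilon> = cosh e - 1" by (simp add: \<epsilon>_def)
    obtain M where M: "\<And>t s p. t \<in> {0..T} \<Longrightarrow> s \<ge> 0 \<Longrightarrow> hcosh (coords (u_tilde s t) p) (coords Q p) \<le> 1 + \<epsilon> + M * exp (- s / 4)"
      using heat_flow_uniform_decay[OF assms(3,4,6) \<epsilon>] by blast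
    have "((\<lambda>s::real. M * exp (- s / 4)) \<longlongrightarrow> 0) at_top" by real_asymp
    then have "\<forall>\<^sub>F s in at_top. M * exp (- s / 4) < \<epsilon>" using \<epsilon> by (rule order_tendstoD)
    moreover have "\<forall>\<^sub>F s in at_top. (s::real) \<ge> 0" by (rule eventually_ge_at_top)
    ultimately show ?thesis
    proof eventually_elim
      case (elim s)
      show ?case
      proof (intro ballI)
        fix t x assume t: "t \<in> {0..T}" and "x \<in> H2"
        then obtain p where p: "x = Psi p" using range_Psi by blast
        have le: "hcosh (coords (u_tilde s t) p) (coords Q p) \<le> cosh e"
          using M[OF t elim(2), of p] elim(1) \<epsilon>2 by linarith
        have "hdist (u_tilde s t x) (Q x) \<le> arcosh (hcosh (coords (u_tilde s t) p) (coords Q p))"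
          using hdist_le[of "coords (u_tilde s t) p" "coords Q p"] Psi_coords[OF v[OF t elim(2)]] Psi_coords[OF Q] by (simp add: p)
        also have "\<dots> \<le> arcosh (cosh e)" using le unfolding not_less[symmetric] by (subst arcosh_less_iff_real) (auto simp: hcosh_ge_1 cosh_real_ge_1)
        also have "\<dots> = e" using e by (simp add: arcosh_cosh_real)
        finally show "hdist (u_tilde s t x) (Q x) \<le> e" .
      qed
    qed
  qed
  let ?F = "\<lambda>s. SUP (x, t)\<in>H2 \<times> {0..T}. ereal (hdist (u_tilde s t x) (Q x))"
  show "(?F \<longlongrightarrow> 0) at_top"
  proof (rule order_tendstoI)
    fix a :: ereal assume a: "a < 0"
    have "\<forall>\<^sub>F s in at_top. (s::real) \<ge> 0" by (rule eventually_ge_at_top)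
    then show "\<forall>\<^sub>F s in at_top. a < ?F s"
    proof eventually_elim
      case (elim s)
      \<comment> \<open>A supremum over the empty set would be -\<infinity> in \<open>ereal\<close>,
        so the lower bound needs a member of the index set: the point \<open>Psi 0\<close> at time
        0.\<close>
      have x: "Psi 0 \<in> H2" by (rule Psi_in_H2)
      have "0 \<le> ereal (hdist (u_tilde s 0 (Psi 0)) (Q (Psi 0)))"
        using hdist_nonneg[of "u_tilde s 0 (Psi 0)" "Q (Psi 0)"] x v[of 0 s] elim Q assms(2) by auto
      also have "\<dots> \<le> ?F s" using x assms(2) by (intro SUP_upper2[of "(Psi 0, 0)"]) auto
      finally show ?case using a by (rule less_le_trans[rotated])
    qed
  next
    fix a :: ereal assume "0 < a"
    then obtain e where e: "0 < ereal e" "ereal e < a" using ereal_dense2 by blast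
    then have "e > 0" by simp
    from small[OF this] show "\<forall>\<^sub>F s in at_top. ?F s < a"
    proof eventually_elim
      case (elim s)
      then have "?F s \<le> ereal e" by (intro SUP_least) auto
      then show ?case using e(2) by (rule le_less_trans)
    qed
  qed
qed

end
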